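(* Under the standing assumptions below, assume in addition that there exists $\alpha>0$ with $\mathbb E[\tau^\alpha]<+\infty$. Then $\zeta$ is a Markov process with respect to $\mathbb F^{\zeta,c}_+$: for all $0\le t<u$ and every bounded measurable (equivalently, bounded continuous) $g:\mathbb R\to\mathbb R$, $$\mathbb E[g(\zeta_u)\mid\mathcal F^{\zeta,c}_{t+}]=\mathbb E[g(\zeta_u)\mid\zeta_t]\quad\mathbb P\text{-a.s.}$$
   Context: $\gamma$ a standard gamma process (driftless subordinator, $\gamma_0=0$, càdlàg, $\mathbb E[e^{-\lambda\gamma_t}]=(1+\lambda)^{-t}$) on a complete probability space $(\Omega,\mathcal F,\mathbb P)$ with null sets $\mathcal N_P$; $\tau:\Omega\to(0,\infty)$ a random variable independent of $\gamma$; $\zeta_t=\gamma_{t\wedge\tau}/\gamma_\tau$, $t\ge0$; $\mathcal F^{\zeta,c}_t=\sigma(\zeta_s,s\le t)\vee\mathcal N_P$ and $\mathcal F^{\zeta,c}_{t+}=\bigcap_{s>t}\mathcal F^{\zeta,c}_s$. *)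

theory Defs
  imports "HOL-Probability.Probability"
begin

definition gen_sets :: "'a measure \<Rightarrow> ('a \<Rightarrow> real) \<Rightarrow> 'a set set" where
  "gen_sets M X = {X -` B \<inter> space M | B. B \<in> sets borel}"

definition standard_gamma_process :: "'a measure \<Rightarrow> (real \<Rightarrow> 'a \<Rightarrow> real) \<Rightarrow> bool" where
  "standard_gamma_process M g \<longleftrightarrow>
     (\<forall>t\<ge>0. g t \<in> borel_measurable M) \<and>
     (\<forall>\<omega>\<in>space M. g 0 \<omega> = 0) \<and>
     (\<forall>\<omega>\<in>space M. mono_on {0..} (\<lambda>t. g t \<omega>)) \<and>
     (\<forall>\<omega>\<in>space M. \<forall>t\<ge>0. continuous (at_right t) (\<lambda>s. g s \<omega>)) \<and>
     (\<forall>\<omega>\<in>space M. \<forall>t>0. \<exists>l. ((\<lambda>s. g s \<omega>) \<longlongrightarrow> l) (at_left t)) \<and>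
     (\<forall>(n::nat) (t::nat \<Rightarrow> real). 0 \<le> t 0 \<and> (\<forall>i<n. t i < t (Suc i)) \<longrightarrow>
        prob_space.indep_vars M (\<lambda>_. borel) (\<lambda>i \<omega>. g (t (Suc i)) \<omega> - g (t i) \<omega>) {..<n}) \<and>
     (\<forall>s t. 0 \<le> s \<and> s \<le> t \<longrightarrow>
        distr M borel (\<lambda>\<omega>. g t \<omega> - g s \<omega>) = distr M borel (g (t - s))) \<and>
     (\<forall>t\<ge>0. \<forall>l\<ge>0. integral\<^sup>L M (\<lambda>\<omega>. exp (- l * g t \<omega>)) = (1 + l) powr (- t))"

definition zeta :: "(real \<Rightarrow> 'a \<Rightarrow> real) \<Rightarrow> ('a \<Rightarrow> real) \<Rightarrow> real \<Rightarrow> 'a \<Rightarrow> real" where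
  "zeta g \<tau> t \<omega> = g (min t (\<tau> \<omega>)) \<omega> / g (\<tau> \<omega>) \<omega>"

definition Fzc :: "'a measure \<Rightarrow> (real \<Rightarrow> 'a \<Rightarrow> real) \<Rightarrow> ('a \<Rightarrow> real) \<Rightarrow> real \<Rightarrow> 'a set set" where
  "Fzc M g \<tau> t = sigma_sets (space M) ((\<Union>s\<in>{0..t}. gen_sets M (zeta g \<tau> s)) \<union> null_sets M)"

definition Fzc_plus :: "'a measure \<Rightarrow> (real \<Rightarrow> 'a \<Rightarrow> real) \<Rightarrow> ('a \<Rightarrow> real) \<Rightarrow> real \<Rightarrow> 'a measure" where
  "Fzc_plus M g \<tau> t = sigma (space M) (\<Inter>s\<in>{t<..}. Fzc M g \<tau> s)"

end

theory Submission
  imports Defs "HOL-Real_Asymp.Real_Asymp"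
begin

text \<open>
  Fix \<open>0 < s < r\<close>. By the gamma--beta algebra (independent gamma variables, normalised by their sum,
  are independent of that sum) the three objects \<open>(\<gamma>\<^sub>v / \<gamma>\<^sub>s)\<close> for \<open>v \<le> s\<close>, \<open>\<gamma>\<^sub>s / \<gamma>\<^sub>r\<close> and
  \<open>(\<gamma>\<^sub>u - \<gamma>\<^sub>s) / (\<gamma>\<^sub>r - \<gamma>\<^sub>s)\<close> are independent, and \<open>\<gamma>\<^sub>s / \<gamma>\<^sub>r\<close> has a beta law. Conditioning on
  \<open>\<tau> = r\<close>, the only part of the past of \<open>\<zeta>\<close> at time \<open>s\<close> that carries information on \<open>(\<tau>, \<zeta>\<^sub>u)\<close> is
  therefore \<open>\<zeta>\<^sub>s\<close>, and Bayes' formula expresses the conditional expectation of \<open>h (\<zeta>\<^sub>u)\<close> as a ratio of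
  integrals against the law of \<open>\<tau>\<close>. For continuous \<open>h\<close> this ratio is continuous as \<open>s\<close> decreases to
  \<open>t\<close>, provided \<open>\<tau>\<close> is truncated at a level \<open>K\<close>; the truncation costs at most \<open>P(\<tau> > K)\<close>. Hence the
  conditional expectation given the right limit of the filtration is an \<open>L\<^sup>1\<close> limit of functions of
  \<open>\<zeta>\<^sub>t\<close>. Powers \<open>h x = x ^ m\<close> suffice, since a law on \<open>[0, 1]\<close> is determined by its moments.
\<close>

section \<open>Finite measures determined by moments and Laplace transforms\<close>

text \<open>The obstacle is the limit as \<open>s\<close> decreases to \<open>t\<close>. For large
  \<open>r\<close> the likelihood of \<open>\<tau> = r\<close> grows like \<open>r powr s\<close>,
  and near \<open>x = 0\<close> (the observed value when \<open>t = 0\<close>) the factor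
  \<open>(1 - x) powr r\<close> gives no uniform decay, so no constant dominates it until
  \<open>\<tau>\<close> is cut at \<open>K\<close>. After the cut the candidate depends on
  \<open>K\<close>, and no formula for the full conditional expectation is passed to the limit. It
  is enough that some function of \<open>\<zeta> t\<close> is within \<open>P(\<tau> > K)\<close> of
  the target when tested on every event of the right-limit filtration: this already makes the two
  conditional expectations arbitrarily close in L1. At \<open>s = 0\<close> the beta law
  degenerates. Its density is therefore divided by \<open>x powr (s - 1) / Gamma s\<close>, which
  cancels in Bayes' quotient; the remaining factor is continuous down to \<open>s = 0\<close>. The
  event \<open>\<tau> \<le> t\<close> is almost surely \<open>\<zeta> t = 1\<close>, so the present
  decides it. The gamma-beta algebra is derived from Laplace transforms and exponential tilting
  rather than from a change of variables in joint densities.\<close>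

text \<open>Weierstrass approximation on the unit interval passes from monomials to continuous test
  functions, and continuous ramps pass from these to open rays, which determine a finite
  measure.\<close>

lemma finite_measure_eq_if_moments_eq:
  fixes N1 N2 :: "real measure"
  assumes fin: "finite_measure N1" "finite_measure N2"
    and sets [measurable_cong]: "sets N1 = sets borel" "sets N2 = sets borel"
    and AE: "AE x in N1. x \<in> {0..1}" "AE x in N2. x \<in> {0..1}"
    and eq: "\<And>n::nat. (\<integral>x. x ^ n \<partial>N1) = (\<integral>x. x ^ n \<partial>N2)"
  shows "N1 = N2"
proof -
  interpret N1: finite_measure N1 by fact
  interpret N2: finite_measure N2 by fact
  have int_pow: "integrable N1 (\<lambda>x. x ^ n)" "integrable N2 (\<lambda>x. x ^ n)" for n :: nat
  proof -
    have "AE x in N1. norm (x ^ n) \<le> 1"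
      using AE(1) by (rule AE_mp) (auto simp: power_le_one)
    then show "integrable N1 (\<lambda>x. x ^ n)"
      by (rule N1.integrable_const_bound) measurable
    have "AE x in N2. norm (x ^ n) \<le> 1"
      using AE(2) by (rule AE_mp) (auto simp: power_le_one)
    then show "integrable N2 (\<lambda>x. x ^ n)"
      by (rule N2.integrable_const_bound) measurable
  qed
  have cont: "(\<integral>x. f x \<partial>N1) = (\<integral>x. f x \<partial>N2)"
    if f: "continuous_on UNIV f" "\<And>x. \<bar>f x\<bar> \<le> 1" for f :: "real \<Rightarrow> real"
  proof -
    have [measurable]: "f \<in> borel_measurable borel"
      using f by (intro borel_measurable_continuous_onI)
    have intf: "integrable N1 f" "integrable N2 f"
      using f by (auto intro!: N1.integrable_const_bound[where B=1] N2.integrable_const_bound[where B=1])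
    \<comment> \<open>An approximation error of \<open>e / c\<close> integrates to at most
      \<open>e\<close> over both measures together; the summand 1 keeps \<open>c\<close> positive
      when both are zero.\<close>
    define c where "c = measure N1 (space N1) + measure N2 (space N2) + 1"
    have c: "c > 0" by (simp add: c_def add_nonneg_pos)
    have "\<bar>(\<integral>x. f x \<partial>N1) - (\<integral>x. f x \<partial>N2)\<bar> \<le> e" if e: "e > 0" for e
    proof -
      obtain p where p: "real_polynomial_function p" "\<And>x. x \<in> {0..1} \<Longrightarrow> \<bar>f x - p x\<bar> < e / c"
        using Stone_Weierstrass_real_polynomial_function[of "{0..1::real}" f "e / c"] f c e
        by (metis compact_Icc continuous_on_subset divide_pos_pos subset_UNIV)
      obtain a n where pa: "p = (\<lambda>x. \<Sum>i\<le>n. a i * x ^ i)"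
        using p(1) real_polynomial_function_iff_sum by blast
      have intp: "integrable N1 p" "integrable N2 p"
        unfolding pa by (auto intro!: Bochner_Integration.integrable_sum integrable_mult_right int_pow)
      have eqp: "(\<integral>x. p x \<partial>N1) = (\<integral>x. p x \<partial>N2)"
        unfolding pa by (subst (1 2) Bochner_Integration.integral_sum) (auto simp: eq int_pow)
      have "\<bar>\<integral>x. f x - p x \<partial>N1\<bar> \<le> (\<integral>x. e / c \<partial>N1)"
      proof (intro order_trans[OF integral_abs_bound] integral_mono_AE)
        show "AE x in N1. \<bar>f x - p x\<bar> \<le> e / c"
          using AE(1) by (rule AE_mp) (use p(2) in \<open>auto intro: less_imp_le\<close>)
      qed (use intf intp in auto)
      moreover have "\<bar>\<integral>x. f x - p x \<partial>N2\<bar> \<le> (\<integral>x. e / c \<partial>N2)"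
      proof (intro order_trans[OF integral_abs_bound] integral_mono_AE)
        show "AE x in N2. \<bar>f x - p x\<bar> \<le> e / c"
          using AE(2) by (rule AE_mp) (use p(2) in \<open>auto intro: less_imp_le\<close>)
      qed (use intf intp in auto)
      moreover have "(\<integral>x. e / c \<partial>N1) + (\<integral>x. e / c \<partial>N2) = (c - 1) / c * e"
        by (simp add: c_def add_divide_distrib distrib_right)
      moreover have "(c - 1) / c * e \<le> e"
        using c e by (simp add: field_simps)
      ultimately show ?thesis
        using intf intp eqp by (simp add: Bochner_Integration.integral_diff)
    qed
    then have "\<bar>(\<integral>x. f x \<partial>N1) - (\<integral>x. f x \<partial>N2)\<bar> \<le> 0"
      by (rule field_le_epsilon[of _ 0, simplified])
    then show ?thesis by simp
  qed
  show ?thesis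
  proof (rule measure_eqI_lessThan)
    fix a :: real
    show "emeasure N1 {a<..} < \<infinity>" by (simp add: less_top[symmetric])
    \<comment> \<open>Ramps that vanish up to \<open>a\<close> and reach 1 at
      \<open>a + 1 / k\<close>; they converge to the indicator of the open ray.\<close>
    define F where "F k x = min 1 (max 0 (real k * (x - a)))" for k x
    have Fc: "continuous_on UNIV (F k)" for k
      unfolding F_def by (intro continuous_intros)
    have [measurable]: "F k \<in> borel_measurable borel" for k
      using Fc by (intro borel_measurable_continuous_onI)
    have Fb: "\<bar>F k x\<bar> \<le> 1" for k x by (auto simp: F_def)
    have lim: "(\<lambda>k. F k x) \<longlonglongrightarrow> indicator {a<..} x" for x
    proof (cases "x > a")
      case True
      have "eventually (\<lambda>k. real k * (x - a) \<ge> 1) sequentially"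
        using True by real_asymp
      then have "eventually (\<lambda>k. F k x = 1) sequentially"
        by eventually_elim (auto simp: F_def)
      then show ?thesis using True by (simp add: tendsto_eventually)
    next
      case False
      then have "F k x = 0" for k
        using mult_nonneg_nonpos[of "real k" "x - a"] by (simp add: F_def max_absorb1)
      then show ?thesis using False by simp
    qed
    have "(\<lambda>k. \<integral>x. F k x \<partial>N1) \<longlonglongrightarrow> (\<integral>x. indicator {a<..} x \<partial>N1)"
      by (rule integral_dominated_convergence[where w="\<lambda>_. 1"]) (auto simp: lim Fb)
    moreover have "(\<lambda>k. \<integral>x. F k x \<partial>N2) \<longlonglongrightarrow> (\<integral>x. indicator {a<..} x \<partial>N2)"
      by (rule integral_dominated_convergence[where w="\<lambda>_. 1"]) (auto simp: lim Fb)
    moreover have "(\<integral>x. F k x \<partial>N1) = (\<integral>x. F k x \<partial>N2)" for k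
      by (intro cont Fc Fb)
    ultimately have "(\<integral>x. indicator {a<..} x \<partial>N1) = (\<integral>x. indicator {a<..} x \<partial>N2 :: real)"
      using LIMSEQ_unique by auto
    then show "emeasure N1 {a<..} = emeasure N2 {a<..}"
      by (simp add: N1.emeasure_eq_measure N2.emeasure_eq_measure)
  qed (simp_all add: sets)
qed

text \<open>The map \<open>exp (- x)\<close> sends the half-line into the unit interval and turns
  the Laplace transform at the integers into moments; \<open>- ln\<close> undoes the map.\<close>

lemma finite_measure_eq_if_laplace_eq:
  fixes N1 N2 :: "real measure"
  assumes fin: "finite_measure N1" "finite_measure N2"
    and sets [measurable_cong]: "sets N1 = sets borel" "sets N2 = sets borel"
    and AE: "AE x in N1. 0 \<le> x" "AE x in N2. 0 \<le> x"
    and eq: "\<And>n::nat. (\<integral>x. exp (- real n * x) \<partial>N1) = (\<integral>x. exp (- real n * x) \<partial>N2)"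
  shows "N1 = N2"
proof -
  have e: "distr N1 borel (\<lambda>x. exp (-x)) = distr N2 borel (\<lambda>x. exp (-x))"
  proof (rule finite_measure_eq_if_moments_eq)
    show "finite_measure (distr N1 borel (\<lambda>x. exp (-x)))" "finite_measure (distr N2 borel (\<lambda>x. exp (-x)))"
      using fin by (auto intro!: finite_measure.finite_measure_distr)
    show "AE x in distr N1 borel (\<lambda>x. exp (-x)). x \<in> {0..1}" "AE x in distr N2 borel (\<lambda>x. exp (-x)). x \<in> {0..1}"
      using AE by (auto simp: AE_distr_iff)
    show "(\<integral>x. x ^ n \<partial>distr N1 borel (\<lambda>x. exp (-x))) = (\<integral>x. x ^ n \<partial>distr N2 borel (\<lambda>x. exp (-x)))" for n
      using eq[of n] by (simp add: integral_distr exp_of_nat_mult[symmetric])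
  qed simp_all
  have inv: "distr (distr N borel (\<lambda>x. exp (-x))) borel (\<lambda>y. - ln y) = N"
    if [measurable_cong]: "sets N = sets borel" for N :: "real measure"
    using that by (simp add: distr_distr comp_def distr_id2)
  show ?thesis
    using inv[OF sets(1)] inv[OF sets(2)] unfolding e by (rule trans[OF sym])
qed

section \<open>Gamma laws and independence\<close>

definition gamma_law :: "real \<Rightarrow> real measure" where
  "gamma_law p = density lborel (\<lambda>x. ennreal (indicator {0..} x * x powr (p - 1) * exp (- x) / Gamma p))"

lemma sets_gamma_law [simp, measurable_cong]: "sets (gamma_law p) = sets borel"
  by (simp add: gamma_law_def)

lemma nn_integral_gamma_law:
  "f \<in> borel_measurable borel \<Longrightarrow>
    (\<integral>\<^sup>+x. f x \<partial>gamma_law p) =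
      (\<integral>\<^sup>+x. ennreal (indicator {0..} x * x powr (p - 1) * exp (- x) / Gamma p) * f x \<partial>lborel)"
  unfolding gamma_law_def by (subst nn_integral_density) auto

lemma AE_gamma_law_pos: "AE x in gamma_law p. 0 < x"
proof -
  have "AE x in lborel. x \<noteq> (0::real)"
    by (rule AE_lborel_singleton)
  then show ?thesis
    unfolding gamma_law_def by (subst AE_density) (auto elim!: eventually_mono split: split_indicator)
qed

text \<open>The substitution \<open>y = (1 + l) * x\<close> turns the tilted density back into the
  Gamma integral.\<close>

lemma laplace_gamma_law:
  assumes p: "p > 0" and l: "l \<ge> 0"
  shows "(\<integral>\<^sup>+x. ennreal (exp (- l * x)) \<partial>gamma_law p) = ennreal ((1 + l) powr (- p))"
proof -
  have G: "Gamma p > 0" using p by (rule Gamma_real_pos)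
  have "(\<integral>\<^sup>+x. ennreal (exp (- l * x)) \<partial>gamma_law p) =
      (\<integral>\<^sup>+x. ennreal (indicator {0..} x * x powr (p - 1) * exp (- ((1 + l) * x)) / Gamma p) \<partial>lborel)"
    using G l by (subst nn_integral_gamma_law) (auto intro!: nn_integral_cong
        simp: ennreal_mult[symmetric] exp_add[symmetric] algebra_simps mult_exp_exp split: split_indicator)
  also have "\<dots> = (\<integral>\<^sup>+x. ennreal ((1 + l) powr (1 - p) / Gamma p) *
      ennreal (indicator {0..} ((1 + l) * x) * ((1 + l) * x) powr (p - 1) / exp ((1 + l) * x)) \<partial>lborel)"
  proof (intro nn_integral_cong)
    fix x :: real
    have "(1 + l) powr (1 - p) * (1 + l) powr (p - 1) = 1"
      using l by (simp add: powr_add[symmetric])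
    then have "x powr (p - 1) * exp (- ((1 + l) * x)) / Gamma p =
        (1 + l) powr (1 - p) / Gamma p * (((1 + l) * x) powr (p - 1) / exp ((1 + l) * x))" if "x \<ge> 0"
      using l that by (simp add: powr_mult exp_minus divide_inverse mult_ac)
    moreover have "0 \<le> (1 + l) * x \<longleftrightarrow> 0 \<le> x"
      using l by (simp add: zero_le_mult_iff)
    ultimately show "ennreal (indicator {0..} x * x powr (p - 1) * exp (- ((1 + l) * x)) / Gamma p) =
        ennreal ((1 + l) powr (1 - p) / Gamma p) *
        ennreal (indicator {0..} ((1 + l) * x) * ((1 + l) * x) powr (p - 1) / exp ((1 + l) * x))"
      using G by (auto simp: ennreal_mult[symmetric] split: split_indicator)
  qed
  also have "\<dots> = ennreal ((1 + l) powr (1 - p) / Gamma p) *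
      (\<integral>\<^sup>+x. ennreal (indicator {0..} ((1 + l) * x) * ((1 + l) * x) powr (p - 1) / exp ((1 + l) * x)) \<partial>lborel)"
    by (rule nn_integral_cmult) measurable
  \<comment> \<open>One factor \<open>1 + l\<close> is set aside to serve as the Jacobian of the
    substitution.\<close>
  also have "\<dots> = ennreal ((1 + l) powr (- p) / Gamma p) * (ennreal (1 + l) *
      (\<integral>\<^sup>+x. ennreal (indicator {0..} ((1 + l) * x) * ((1 + l) * x) powr (p - 1) / exp ((1 + l) * x)) \<partial>lborel))"
  proof -
    have "ennreal ((1 + l) powr (1 - p) / Gamma p) = ennreal ((1 + l) powr (- p) / Gamma p) * ennreal (1 + l)"
      using G l by (subst ennreal_mult[symmetric]) (auto simp: powr_minus powr_diff divide_simps)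
    then show ?thesis by (simp only: mult.assoc)
  qed
  also have "ennreal (1 + l) *
      (\<integral>\<^sup>+x. ennreal (indicator {0..} ((1 + l) * x) * ((1 + l) * x) powr (p - 1) / exp ((1 + l) * x)) \<partial>lborel)
      = (\<integral>\<^sup>+x. ennreal (indicator {0..} x * x powr (p - 1) / exp x) \<partial>lborel)"
    using l by (subst nn_integral_real_affine[where c="1 + l" and t=0 and
        f="\<lambda>x. ennreal (indicator {0..} x * x powr (p - 1) / exp x)"]) auto
  also have "\<dots> = ennreal (Gamma p)"
    by (rule Gamma_conv_nn_integral_real[OF p, symmetric])
  finally show ?thesis
    using G by (simp add: ennreal_mult[symmetric])
qed

lemma prob_space_gamma_law: "p > 0 \<Longrightarrow> prob_space (gamma_law p)"
  using laplace_gamma_law[of p 0] by (intro prob_spaceI) simp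

text \<open>The factor \<open>x ^ n\<close> merely raises the shape from \<open>p\<close> to
  \<open>p + n\<close>. Quotients of these values later give the beta moments.\<close>

lemma moment_gamma_law:
  assumes p: "p > 0"
  shows "(\<integral>\<^sup>+x. ennreal (x ^ n) \<partial>gamma_law p) = ennreal (Gamma (p + real n) / Gamma p)"
proof -
  have G: "Gamma p > 0" using p by (rule Gamma_real_pos)
  have "(\<integral>\<^sup>+x. ennreal (x ^ n) \<partial>gamma_law p) =
      (\<integral>\<^sup>+x. ennreal (1 / Gamma p) * ennreal (indicator {0..} x * x powr (p + real n - 1) / exp x) \<partial>lborel)"
  proof (subst nn_integral_gamma_law, measurable, rule nn_integral_cong_AE)
    have "AE x in lborel. x \<noteq> (0::real)"
      by (rule AE_lborel_singleton)
    then show "AE x in lborel. ennreal (indicator {0..} x * x powr (p - 1) * exp (- x) / Gamma p) * ennreal (x ^ n) =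
      ennreal (1 / Gamma p) * ennreal (indicator {0..} x * x powr (p + real n - 1) / exp x)"
    proof eventually_elim
      case (elim x)
      have "x powr (p + real n - 1) = x powr (p - 1) * x ^ n" if "x > 0"
        using that powr_add[of x "p - 1" "real n"] by (simp add: powr_realpow algebra_simps)
      with elim G show ?case
        by (auto simp: ennreal_mult[symmetric] exp_minus field_simps split: split_indicator)
    qed
  qed
  also have "\<dots> = ennreal (1 / Gamma p) * ennreal (Gamma (p + real n))"
    using p by (subst nn_integral_cmult) (auto simp: Gamma_conv_nn_integral_real[symmetric])
  also have "\<dots> = ennreal (Gamma (p + real n) / Gamma p)"
    using G p by (subst ennreal_mult[symmetric]) (auto intro!: less_imp_le[OF Gamma_real_pos])
  finally show ?thesis .
qed

context prob_space
begin

lemma distr_eq_gamma_law: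
  fixes X :: "'a \<Rightarrow> real"
  assumes X [measurable]: "random_variable borel X" and nonneg: "\<And>\<omega>. \<omega> \<in> space M \<Longrightarrow> 0 \<le> X \<omega>"
    and p: "p > 0" and lap: "\<And>l. l \<ge> 0 \<Longrightarrow> expectation (\<lambda>\<omega>. exp (- l * X \<omega>)) = (1 + l) powr (- p)"
  shows "distr M borel X = gamma_law p"
proof (rule finite_measure_eq_if_laplace_eq)
  interpret G: prob_space "gamma_law p" by (rule prob_space_gamma_law[OF p])
  show "finite_measure (distr M borel X)"
    by (rule finite_measure_distr) simp
  show "finite_measure (gamma_law p)" by unfold_locales
  show "AE x in distr M borel X. 0 \<le> x"
    using nonneg by (subst AE_distr_iff) auto
  show "AE x in gamma_law p. 0 \<le> x"
    by (rule eventually_mono[OF AE_gamma_law_pos]) simp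
  fix n :: nat
  have "(\<integral>x. exp (- real n * x) \<partial>distr M borel X) = (1 + real n) powr (- p)"
    by (subst integral_distr) (auto simp: lap[of "real n", simplified])
  also have "\<dots> = (\<integral>x. exp (- real n * x) \<partial>gamma_law p)"
    by (rule integral_eq_nn_integral[THEN trans, symmetric])
      (use laplace_gamma_law[OF p, of "real n"] in simp_all)
  finally show "(\<integral>x. exp (- real n * x) \<partial>distr M borel X) = (\<integral>x. exp (- real n * x) \<partial>gamma_law p)" .
qed simp_all

text \<open>The library's \<^const>\<open>indep_var\<close> forces both variables to have the same type.\<close>
definition indep_rv :: "'b measure \<Rightarrow> ('a \<Rightarrow> 'b) \<Rightarrow> 'c measure \<Rightarrow> ('a \<Rightarrow> 'c) \<Rightarrow> bool" where
  "indep_rv S X T Y \<longleftrightarrow> random_variable S X \<and> random_variable T Y \<and>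
    (\<forall>A\<in>sets S. \<forall>B\<in>sets T.
      emeasure M {\<omega>\<in>space M. X \<omega> \<in> A \<and> Y \<omega> \<in> B} =
      emeasure M {\<omega>\<in>space M. X \<omega> \<in> A} * emeasure M {\<omega>\<in>space M. Y \<omega> \<in> B})"

lemma indep_rvD:
  assumes "indep_rv S X T Y"
  shows "random_variable S X" "random_variable T Y"
    "\<And>A B. A \<in> sets S \<Longrightarrow> B \<in> sets T \<Longrightarrow> emeasure M {\<omega>\<in>space M. X \<omega> \<in> A \<and> Y \<omega> \<in> B} =
      emeasure M {\<omega>\<in>space M. X \<omega> \<in> A} * emeasure M {\<omega>\<in>space M. Y \<omega> \<in> B}"
  using assms by (auto simp: indep_rv_def)

lemma indep_rv_distr:
  assumes "indep_rv S X T Y"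
  shows "distr M (S \<Otimes>\<^sub>M T) (\<lambda>\<omega>. (X \<omega>, Y \<omega>)) = distr M S X \<Otimes>\<^sub>M distr M T Y"
proof -
  note [measurable] = indep_rvD(1,2)[OF assms]
  interpret DX: prob_space "distr M S X" by (rule prob_space_distr) simp
  interpret DY: prob_space "distr M T Y" by (rule prob_space_distr) simp
  show ?thesis
  proof (rule pair_measure_eqI[symmetric])
    fix A B assume AB: "A \<in> sets (distr M S X)" "B \<in> sets (distr M T Y)"
    then have [measurable]: "A \<in> sets S" "B \<in> sets T" by auto
    show "emeasure (distr M S X) A * emeasure (distr M T Y) B =
      emeasure (distr M (S \<Otimes>\<^sub>M T) (\<lambda>\<omega>. (X \<omega>, Y \<omega>))) (A \<times> B)"
      using indep_rvD(3)[OF assms, of A B]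
      by (simp add: emeasure_distr vimage_def Int_def conj_commute)
  qed (auto intro!: DX.sigma_finite_measure_axioms DY.sigma_finite_measure_axioms)
qed

text \<open>Fubini for the product law: \<open>Y\<close> may be evaluated at a second, independent
  sample point \<open>\<omega>'\<close> while \<open>X\<close> is frozen. This replaces conditioning
  throughout the development.\<close>

lemma indep_rv_nn_integral:
  assumes "indep_rv S X T Y" and [measurable]: "f \<in> borel_measurable (S \<Otimes>\<^sub>M T)"
  shows "(\<integral>\<^sup>+\<omega>. f (X \<omega>, Y \<omega>) \<partial>M) = (\<integral>\<^sup>+\<omega>. \<integral>\<^sup>+\<omega>'. f (X \<omega>, Y \<omega>') \<partial>M \<partial>M)"
proof -
  note [measurable] = indep_rvD(1,2)[OF assms(1)]
  interpret DY: prob_space "distr M T Y" by (rule prob_space_distr) simp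
  have "(\<integral>\<^sup>+\<omega>. f (X \<omega>, Y \<omega>) \<partial>M) = (\<integral>\<^sup>+z. f z \<partial>distr M (S \<Otimes>\<^sub>M T) (\<lambda>\<omega>. (X \<omega>, Y \<omega>)))"
    by (subst nn_integral_distr) auto
  also have "\<dots> = (\<integral>\<^sup>+x. \<integral>\<^sup>+y. f (x, y) \<partial>distr M T Y \<partial>distr M S X)"
    unfolding indep_rv_distr[OF assms(1)] by (subst DY.nn_integral_fst[symmetric]) auto
  also have "\<dots> = (\<integral>\<^sup>+\<omega>. \<integral>\<^sup>+y. f (X \<omega>, y) \<partial>distr M T Y \<partial>M)"
    by (subst nn_integral_distr) auto
  also have "\<dots> = (\<integral>\<^sup>+\<omega>. \<integral>\<^sup>+\<omega>'. f (X \<omega>, Y \<omega>') \<partial>M \<partial>M)"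
    by (intro nn_integral_cong, subst nn_integral_distr)
       (auto simp: measurable_space[OF indep_rvD(1)[OF assms(1)]])
  finally show ?thesis .
qed

lemma indep_rv_compose:
  assumes "indep_rv S X T Y" and [measurable]: "f \<in> measurable S S'" "g \<in> measurable T T'"
  shows "indep_rv S' (\<lambda>\<omega>. f (X \<omega>)) T' (\<lambda>\<omega>. g (Y \<omega>))"
proof -
  note [measurable] = indep_rvD(1,2)[OF assms(1)]
  show ?thesis
    unfolding indep_rv_def
  proof (intro conjI ballI)
    fix A B assume [measurable]: "A \<in> sets S'" "B \<in> sets T'"
    have eq: "{\<omega>\<in>space M. f (X \<omega>) \<in> A} = {\<omega>\<in>space M. X \<omega> \<in> f -` A \<inter> space S}"
      "{\<omega>\<in>space M. g (Y \<omega>) \<in> B} = {\<omega>\<in>space M. Y \<omega> \<in> g -` B \<inter> space T}"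
      "{\<omega>\<in>space M. f (X \<omega>) \<in> A \<and> g (Y \<omega>) \<in> B} =
        {\<omega>\<in>space M. X \<omega> \<in> f -` A \<inter> space S \<and> Y \<omega> \<in> g -` B \<inter> space T}"
      using measurable_space[OF indep_rvD(1)[OF assms(1)]] measurable_space[OF indep_rvD(2)[OF assms(1)]]
      by auto
    show "emeasure M {\<omega>\<in>space M. f (X \<omega>) \<in> A \<and> g (Y \<omega>) \<in> B} =
      emeasure M {\<omega>\<in>space M. f (X \<omega>) \<in> A} * emeasure M {\<omega>\<in>space M. g (Y \<omega>) \<in> B}"
      unfolding eq by (rule indep_rvD(3)[OF assms(1)]) measurable
  qed measurable
qed

lemma indep_rv_commute:
  "indep_rv S X T Y \<Longrightarrow> indep_rv T Y S X"
  by (auto simp: indep_rv_def mult.commute conj_commute)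

text \<open>The hypotheses amount to mutual independence of the three variables. Integrating out
  \<open>Z\<close>, then separating \<open>X\<close> from \<open>Y\<close>, then putting
  \<open>Y\<close> and \<open>Z\<close> together again regroups them.\<close>

lemma indep_rv_regroup:
  assumes XY: "indep_rv S X T Y" and XYZ: "indep_rv (S \<Otimes>\<^sub>M T) (\<lambda>\<omega>. (X \<omega>, Y \<omega>)) U Z"
  shows "indep_rv S X (T \<Otimes>\<^sub>M U) (\<lambda>\<omega>. (Y \<omega>, Z \<omega>))"
proof -
  note [measurable] = indep_rvD(1,2)[OF XY] indep_rvD(2)[OF XYZ]
  have YZ: "indep_rv T Y U Z"
    using indep_rv_compose[OF XYZ, of snd T "\<lambda>x. x" U] by simp
  show ?thesis
    unfolding indep_rv_def
  proof (intro conjI ballI)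
    fix A C assume [measurable]: "A \<in> sets S" "C \<in> sets (T \<Otimes>\<^sub>M U)"
    have "emeasure M {\<omega>\<in>space M. X \<omega> \<in> A \<and> (Y \<omega>, Z \<omega>) \<in> C} =
        (\<integral>\<^sup>+\<omega>. (case ((X \<omega>, Y \<omega>), Z \<omega>) of ((x, y), z) \<Rightarrow> indicator A x * indicator C (y, z)) \<partial>M)"
      by (auto simp: nn_integral_indicator[symmetric] simp del: nn_integral_indicator
          intro!: nn_integral_cong split: split_indicator)
    also have "\<dots> = (\<integral>\<^sup>+\<omega>. \<integral>\<^sup>+\<omega>'. (case ((X \<omega>, Y \<omega>), Z \<omega>') of ((x, y), z) \<Rightarrow> indicator A x * indicator C (y, z)) \<partial>M \<partial>M)"
      by (rule indep_rv_nn_integral[OF XYZ]) measurable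
    also have "\<dots> = (\<integral>\<^sup>+\<omega>. (case (X \<omega>, Y \<omega>) of (x, y) \<Rightarrow> indicator A x * (\<integral>\<^sup>+\<omega>'. indicator C (y, Z \<omega>') \<partial>M)) \<partial>M)"
    proof (intro nn_integral_cong)
      fix \<omega> assume \<omega>: "\<omega> \<in> space M"
      have "Y \<omega> \<in> space T" using \<omega> by (rule measurable_space[OF indep_rvD(2)[OF XY]])
      then have [measurable]: "(\<lambda>\<omega>'. indicator C (Y \<omega>, Z \<omega>') :: ennreal) \<in> borel_measurable M" by measurable
      show "(\<integral>\<^sup>+\<omega>'. (case ((X \<omega>, Y \<omega>), Z \<omega>') of ((x, y), z) \<Rightarrow> indicator A x * indicator C (y, z)) \<partial>M)
        = (case (X \<omega>, Y \<omega>) of (x, y) \<Rightarrow> indicator A x * (\<integral>\<^sup>+\<omega>'. indicator C (y, Z \<omega>') \<partial>M))"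
        by (simp add: nn_integral_cmult)
    qed
    also have "\<dots> = (\<integral>\<^sup>+\<omega>. \<integral>\<^sup>+\<omega>''. (case (X \<omega>, Y \<omega>'') of (x, y) \<Rightarrow> indicator A x * (\<integral>\<^sup>+\<omega>'. indicator C (y, Z \<omega>') \<partial>M)) \<partial>M \<partial>M)"
      by (rule indep_rv_nn_integral[OF XY]) measurable
    also have "\<dots> = (\<integral>\<^sup>+\<omega>. indicator A (X \<omega>) \<partial>M) * (\<integral>\<^sup>+\<omega>''. \<integral>\<^sup>+\<omega>'. indicator C (Y \<omega>'', Z \<omega>') \<partial>M \<partial>M)"
      by (simp add: nn_integral_cmult nn_integral_multc)
    also have "(\<integral>\<^sup>+\<omega>''. \<integral>\<^sup>+\<omega>'. indicator C (Y \<omega>'', Z \<omega>') \<partial>M \<partial>M) = (\<integral>\<^sup>+\<omega>. indicator C (Y \<omega>, Z \<omega>) \<partial>M)"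
      by (rule indep_rv_nn_integral[OF YZ, symmetric]) measurable
    also have "(\<integral>\<^sup>+\<omega>. indicator A (X \<omega>) \<partial>M) = emeasure M {\<omega>\<in>space M. X \<omega> \<in> A}"
      by (auto simp: nn_integral_indicator[symmetric] simp del: nn_integral_indicator
          intro!: nn_integral_cong split: split_indicator)
    also have "(\<integral>\<^sup>+\<omega>. indicator C (Y \<omega>, Z \<omega>) \<partial>M) = emeasure M {\<omega>\<in>space M. (Y \<omega>, Z \<omega>) \<in> C}"
      by (auto simp: nn_integral_indicator[symmetric] simp del: nn_integral_indicator
          intro!: nn_integral_cong split: split_indicator)
    finally show "emeasure M {\<omega>\<in>space M. X \<omega> \<in> A \<and> (Y \<omega>, Z \<omega>) \<in> C} =
      emeasure M {\<omega>\<in>space M. X \<omega> \<in> A} * emeasure M {\<omega>\<in>space M. (Y \<omega>, Z \<omega>) \<in> C}" .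
  qed measurable
qed

section \<open>Exponential tilting and normalised gamma vectors\<close>

text \<open>An exponential tilt changes the rate of a gamma law from 1 to \<open>1 + l\<close>, and
  the dilation restores it. In Laplace transforms this is
  \<open>1 + l + n * (1 + l) = (1 + n) * (1 + l)\<close>.\<close>

lemma gamma_dilation_density:
  fixes X :: "'a \<Rightarrow> real"
  assumes X [measurable]: "random_variable borel X" and nonneg: "\<And>\<omega>. \<omega> \<in> space M \<Longrightarrow> 0 \<le> X \<omega>"
    and lap: "\<And>l. l \<ge> 0 \<Longrightarrow> expectation (\<lambda>\<omega>. exp (- l * X \<omega>)) = (1 + l) powr (- p)"
    and l: "l \<ge> 0"
  shows "distr (density M (\<lambda>\<omega>. ennreal ((1 + l) powr p * exp (- l * X \<omega>)))) borel (\<lambda>\<omega>. (1 + l) * X \<omega>)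
    = distr M borel X" (is "?L = _")
proof -
  have int: "integrable M (\<lambda>\<omega>. exp (- l * X \<omega>))" if "l \<ge> 0" for l
    using that nonneg by (intro integrable_const_bound[where B=1]) auto
  have d: "finite_measure (density M (\<lambda>\<omega>. ennreal ((1 + l) powr p * exp (- l * X \<omega>))))"
    using int[OF l] by (auto intro!: finite_measureI simp: emeasure_density nn_integral_eq_integral)
  show ?thesis
  proof (rule finite_measure_eq_if_laplace_eq)
    show "finite_measure ?L"
      by (rule finite_measure.finite_measure_distr[OF d]) simp
    show "finite_measure (distr M borel X)"
      by (rule finite_measure_distr) simp
    show "AE x in ?L. 0 \<le> x"
      using nonneg l by (subst AE_distr_iff) (auto simp: AE_density)
    show "AE x in distr M borel X. 0 \<le> x"
      using nonneg by (subst AE_distr_iff) auto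
    fix n :: nat
    have "(\<integral>x. exp (- real n * x) \<partial>?L) =
        (\<integral>\<omega>. (1 + l) powr p * exp (- (l + real n * (1 + l)) * X \<omega>) \<partial>M)"
      by (subst integral_distr, simp, simp, subst integral_density)
        (auto simp: exp_add[symmetric] algebra_simps mult_exp_exp)
    also have "\<dots> = (1 + l) powr p * ((1 + real n) * (1 + l)) powr (- p)"
      using l lap[of "l + real n * (1 + l)"] by (simp add: algebra_simps)
    also have "\<dots> = (1 + real n) powr (- p)"
      using l by (subst powr_mult) (auto simp: powr_minus divide_simps)
    also have "\<dots> = (\<integral>x. exp (- real n * x) \<partial>distr M borel X)"
      using lap[of "real n"] by (subst integral_distr) auto
    finally show "(\<integral>x. exp (- real n * x) \<partial>?L) = (\<integral>x. exp (- real n * x) \<partial>distr M borel X)" .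
  qed simp_all
qed

text \<open>For each event that the normalised vector lies in \<open>A\<close>, the expectation of
  \<open>exp (- l * S)\<close> on the event factorises for every \<open>l \<ge> 0\<close>.
  Uniqueness of Laplace transforms then makes the law of the sum on that event a multiple of its
  full law.\<close>

lemma gamma_normalised_indep_sum:
  fixes X :: "'i \<Rightarrow> 'a \<Rightarrow> real"
  assumes I: "finite I" "I \<noteq> {}" and ind: "indep_vars (\<lambda>_. borel) X I"
    and nonneg: "\<And>i \<omega>. i \<in> I \<Longrightarrow> \<omega> \<in> space M \<Longrightarrow> 0 \<le> X i \<omega>"
    and lap: "\<And>i l. i \<in> I \<Longrightarrow> l \<ge> 0 \<Longrightarrow> expectation (\<lambda>\<omega>. exp (- l * X i \<omega>)) = (1 + l) powr (- p i)"
  shows "indep_rv (\<Pi>\<^sub>M i\<in>I. borel) (\<lambda>\<omega>. \<lambda>i\<in>I. X i \<omega> / (\<Sum>j\<in>I. X j \<omega>)) borel (\<lambda>\<omega>. \<Sum>j\<in>I. X j \<omega>)"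
proof -
  have X [measurable]: "random_variable borel (X i)" if "i \<in> I" for i
    using ind that by (auto simp: indep_vars_def)
  define S where "S \<omega> = (\<Sum>j\<in>I. X j \<omega>)" for \<omega>
  define T where "T \<omega> = (\<lambda>i\<in>I. X i \<omega> / S \<omega>)" for \<omega>
  define P where "P = (\<Pi>\<^sub>M i\<in>I. (borel :: real measure))"
  have S [measurable]: "random_variable borel S"
    unfolding S_def by measurable
  have S0: "S \<omega> \<ge> 0" if "\<omega> \<in> space M" for \<omega>
    unfolding S_def using nonneg that by (auto intro: sum_nonneg)
  have T [measurable]: "random_variable P T"
    unfolding T_def P_def by measurable
  have Xm [measurable]: "random_variable P (\<lambda>\<omega>. \<lambda>i\<in>I. X i \<omega>)"
    unfolding P_def by measurable
  have [measurable]: "random_variable borel (\<lambda>\<omega>. if i \<in> I then X i \<omega> else 0)" for i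
    by (cases "i \<in> I") auto
  \<comment> \<open>The locale wants a measure at every index, so the variables are extended by 0
    outside \<open>I\<close>.\<close>
  interpret PS: product_sigma_finite "\<lambda>i. distr M borel (\<lambda>\<omega>. if i \<in> I then X i \<omega> else 0)"
    unfolding product_sigma_finite_def
    by (auto intro!: prob_space_imp_sigma_finite prob_space_distr)
  have distr_X: "distr M P (\<lambda>\<omega>. \<lambda>i\<in>I. X i \<omega>) = (\<Pi>\<^sub>M i\<in>I. distr M borel (\<lambda>\<omega>. if i \<in> I then X i \<omega> else 0))"
    using ind I unfolding P_def
    by (subst (asm) indep_vars_iff_distr_eq_PiM') (auto intro!: PiM_cong)
  txt \<open>Tilting by \<^term>\<open>exp (- l * S \<omega>)\<close> has the effect of dilating all the \<^term>\<open>X i\<close> by the same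
    factor, which the normalised vector does not notice.\<close>
  have dil: "distr (density M (\<lambda>\<omega>. ennreal ((1 + l) powr (\<Sum>i\<in>I. p i) * exp (- l * S \<omega>)))) P (\<lambda>\<omega>. \<lambda>i\<in>I. (1 + l) * X i \<omega>)
      = distr M P (\<lambda>\<omega>. \<lambda>i\<in>I. X i \<omega>)" (is "?D = _") if l: "l \<ge> 0" for l
    unfolding distr_X
  proof (rule PS.PiM_eqI)
    have [measurable]: "random_variable P (\<lambda>\<omega>. \<lambda>i\<in>I. (1 + l) * X i \<omega>)"
      unfolding P_def by measurable
    show "sets ?D = sets (\<Pi>\<^sub>M i\<in>I. distr M borel (\<lambda>\<omega>. if i \<in> I then X i \<omega> else 0))"
      unfolding P_def by (auto intro!: sets_PiM_cong)
    fix A assume "\<And>i. i \<in> I \<Longrightarrow> A i \<in> sets (distr M borel (\<lambda>\<omega>. if i \<in> I then X i \<omega> else 0))"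
    then have A [measurable]: "\<And>i. i \<in> I \<Longrightarrow> A i \<in> sets borel" by simp
    have PA [measurable]: "Pi\<^sub>E I A \<in> sets P"
      unfolding P_def using I A by (intro sets_PiM_I_finite) auto
    let ?f = "\<lambda>i x. ennreal ((1 + l) powr p i * exp (- l * x)) * indicator (A i) ((1 + l) * x)"
    have "emeasure ?D (Pi\<^sub>E I A) = (\<integral>\<^sup>+\<omega>. ennreal ((1 + l) powr (\<Sum>i\<in>I. p i) * exp (- l * S \<omega>)) *
        indicator (Pi\<^sub>E I A) (\<lambda>i\<in>I. (1 + l) * X i \<omega>) \<partial>M)"
      by (subst emeasure_distr, simp, simp, subst emeasure_density)
        (auto intro!: nn_integral_cong split: split_indicator)
    also have "\<dots> = (\<integral>\<^sup>+\<omega>. (\<Prod>i\<in>I. ?f i (X i \<omega>)) \<partial>M)"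
    proof (rule nn_integral_cong)
      fix \<omega>
      have "(1 + l) powr (\<Sum>i\<in>I. p i) * exp (- l * S \<omega>) = (\<Prod>i\<in>I. (1 + l) powr p i * exp (- l * X i \<omega>))"
        using l I by (simp add: S_def powr_sum exp_sum prod.distrib sum_distrib_left sum_negf[symmetric] del: sum_negf)
      moreover have "indicator (Pi\<^sub>E I A) (\<lambda>i\<in>I. (1 + l) * X i \<omega>) =
          (\<Prod>i\<in>I. indicator (A i) ((1 + l) * X i \<omega>) :: ennreal)"
      proof (cases "\<forall>i\<in>I. (1 + l) * X i \<omega> \<in> A i")
        case False
        then obtain i where "i \<in> I" "(1 + l) * X i \<omega> \<notin> A i" by auto
        then show ?thesis
          using I by (subst prod_zero) (auto split: split_indicator)
      qed (auto intro!: prod.neutral[symmetric])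
      ultimately show "ennreal ((1 + l) powr (\<Sum>i\<in>I. p i) * exp (- l * S \<omega>)) *
        indicator (Pi\<^sub>E I A) (\<lambda>i\<in>I. (1 + l) * X i \<omega>) = (\<Prod>i\<in>I. ?f i (X i \<omega>))"
        using l by (simp add: prod.distrib prod_ennreal)
    qed
    also have "\<dots> = (\<Prod>i\<in>I. \<integral>\<^sup>+\<omega>. ?f i (X i \<omega>) \<partial>M)"
      using I by (intro indep_vars_nn_integral indep_vars_compose2[OF ind]) auto
    also have "\<dots> = (\<Prod>i\<in>I. emeasure (distr M borel (\<lambda>\<omega>. if i \<in> I then X i \<omega> else 0)) (A i))"
    proof (rule prod.cong[OF refl])
      fix i assume i [simp]: "i \<in> I"
      have "(\<integral>\<^sup>+\<omega>. ?f i (X i \<omega>) \<partial>M) = emeasure (distr (density M (\<lambda>\<omega>. ennreal ((1 + l) powr p i * exp (- l * X i \<omega>))))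
          borel (\<lambda>\<omega>. (1 + l) * X i \<omega>)) (A i)"
        by (subst emeasure_distr, simp, simp, subst emeasure_density)
          (auto intro!: nn_integral_cong split: split_indicator)
      also have "\<dots> = emeasure (distr M borel (X i)) (A i)"
        using l lap[OF i] nonneg by (subst gamma_dilation_density) auto
      finally show "(\<integral>\<^sup>+\<omega>. ?f i (X i \<omega>) \<partial>M) = emeasure (distr M borel (\<lambda>\<omega>. if i \<in> I then X i \<omega> else 0)) (A i)"
        by simp
    qed
    finally show "emeasure ?D (Pi\<^sub>E I A) = (\<Prod>i\<in>I. emeasure (distr M borel (\<lambda>\<omega>. if i \<in> I then X i \<omega> else 0)) (A i))" .
  qed (use I in auto)
  have key: "(\<integral>\<^sup>+\<omega>. ennreal ((1 + l) powr (\<Sum>i\<in>I. p i) * exp (- l * S \<omega>)) * indicator A (T \<omega>) \<partial>M) = emeasure M (T -` A \<inter> space M)"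
    if l: "l \<ge> 0" and A [measurable]: "A \<in> sets P" for l A
  proof -
    have [measurable]: "random_variable P (\<lambda>\<omega>. \<lambda>i\<in>I. (1 + l) * X i \<omega>)"
      unfolding P_def by measurable
    \<comment> \<open>Normalisation is homogeneous of degree 0, so the dilated vector has the same
      image under \<open>t\<close>; this transfers \<open>dil\<close> to the event that
      \<open>T\<close> lies in \<open>A\<close>.\<close>
    define t where "t x = (\<lambda>i\<in>I. x i / (\<Sum>j\<in>I. x j))" for x :: "'i \<Rightarrow> real"
    have [measurable]: "t \<in> measurable P P"
      unfolding t_def P_def using I by measurable
    have tX: "t (\<lambda>i\<in>I. X i \<omega>) = T \<omega>" for \<omega>
      by (simp add: t_def T_def S_def cong: restrict_cong)
    have tlX: "t (\<lambda>i\<in>I. (1 + l) * X i \<omega>) = T \<omega>" for \<omega>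
      using l by (simp add: t_def T_def S_def sum_distrib_left[symmetric] cong: restrict_cong)
    have "(\<integral>\<^sup>+x. indicator A (t x) \<partial>distr M P (\<lambda>\<omega>. \<lambda>i\<in>I. X i \<omega>)) = emeasure M (T -` A \<inter> space M)"
      by (subst nn_integral_distr) (auto simp: tX nn_integral_indicator[symmetric] simp del: nn_integral_indicator
          intro!: nn_integral_cong split: split_indicator)
    moreover have "(\<integral>\<^sup>+x. indicator A (t x) \<partial>distr M P (\<lambda>\<omega>. \<lambda>i\<in>I. X i \<omega>)) =
        (\<integral>\<^sup>+\<omega>. ennreal ((1 + l) powr (\<Sum>i\<in>I. p i) * exp (- l * S \<omega>)) * indicator A (T \<omega>) \<partial>M)"
      by (subst dil[OF l, symmetric], subst nn_integral_distr, simp, simp, subst nn_integral_density)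
        (auto simp: tlX)
    ultimately show ?thesis by simp
  qed
  have lapS: "(\<integral>\<^sup>+\<omega>. ennreal (exp (- l * S \<omega>)) * indicator A (T \<omega>) \<partial>M) = ennreal ((1 + l) powr (- (\<Sum>i\<in>I. p i))) * emeasure M (T -` A \<inter> space M)"
    if l: "l \<ge> 0" and A [measurable]: "A \<in> sets P" for l A
    unfolding key[OF that, symmetric] using l
    by (subst nn_integral_cmult[symmetric]) (auto intro!: nn_integral_cong simp: mult.assoc[symmetric] ennreal_mult[symmetric] powr_minus)
  \<comment> \<open>Taking \<open>A\<close> to be the whole space yields the transform of
    \<open>S\<close> alone.\<close>
  have lapS': "(\<integral>\<^sup>+\<omega>. ennreal (exp (- l * S \<omega>)) \<partial>M) = ennreal ((1 + l) powr (- (\<Sum>i\<in>I. p i)))"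
    if l: "l \<ge> 0" for l
  proof -
    have *: "T \<omega> \<in> space P" if "\<omega> \<in> space M" for \<omega>
      using that by (rule measurable_space[OF T])
    then have "T -` space P \<inter> space M = space M" by auto
    then have "ennreal ((1 + l) powr (- (\<Sum>i\<in>I. p i))) = (\<integral>\<^sup>+\<omega>. ennreal (exp (- l * S \<omega>)) * indicator (space P) (T \<omega>) \<partial>M)"
      using lapS[OF l, of "space P"] by (simp add: emeasure_space_1)
    also have "\<dots> = (\<integral>\<^sup>+\<omega>. ennreal (exp (- l * S \<omega>)) \<partial>M)"
      by (intro nn_integral_cong) (simp add: *)
    finally show ?thesis by simp
  qed
  have "indep_rv P T borel S"
    unfolding indep_rv_def
  proof (intro conjI ballI)
    fix A B assume A [measurable]: "A \<in> sets P" and B [measurable]: "B \<in> sets (borel :: real measure)"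
    let ?c = "emeasure M (T -` A \<inter> space M)"
    \<comment> \<open>The law of \<open>S\<close> restricted to the event against the full law
      scaled by the probability of the event: their transforms agree by \<open>lapS\<close> and
      \<open>lapS'\<close>.\<close>
    have "distr (density M (\<lambda>\<omega>. indicator A (T \<omega>))) borel S = density (distr M borel S) (\<lambda>_. ?c)"
    proof (rule finite_measure_eq_if_laplace_eq)
      show "finite_measure (distr (density M (\<lambda>\<omega>. indicator A (T \<omega>))) borel S)"
      proof (rule finite_measureI)
        have "emeasure (distr (density M (\<lambda>\<omega>. indicator A (T \<omega>))) borel S) UNIV = (\<integral>\<^sup>+\<omega>. indicator A (T \<omega>) \<partial>M)"
          by (subst emeasure_distr, simp, simp, subst emeasure_density)
            (auto intro!: nn_integral_cong split: split_indicator)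
        also have "\<dots> \<le> (\<integral>\<^sup>+\<omega>. 1 \<partial>M)"
          by (intro nn_integral_mono) (auto split: split_indicator)
        finally show "emeasure (distr (density M (\<lambda>\<omega>. indicator A (T \<omega>))) borel S)
          (space (distr (density M (\<lambda>\<omega>. indicator A (T \<omega>))) borel S)) \<noteq> \<infinity>"
          by (auto simp: emeasure_space_1 top_unique)
      qed
      show "finite_measure (density (distr M borel S) (\<lambda>_. ?c))"
        by (rule finite_measureI)
          (auto simp: emeasure_density emeasure_distr emeasure_eq_measure ennreal_mult[symmetric])
      show "AE x in distr (density M (\<lambda>\<omega>. indicator A (T \<omega>))) borel S. 0 \<le> x"
        using S0 by (subst AE_distr_iff) (auto simp: AE_density)
      show "AE x in density (distr M borel S) (\<lambda>_. ?c). 0 \<le> x"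
        using S0 by (subst AE_density) (auto simp: AE_distr_iff)
      fix n :: nat
      have "(\<integral>x. exp (- real n * x) \<partial>distr (density M (\<lambda>\<omega>. indicator A (T \<omega>))) borel S) =
          enn2real (\<integral>\<^sup>+\<omega>. ennreal (exp (- real n * S \<omega>)) * indicator A (T \<omega>) \<partial>M)"
        by (subst integral_eq_nn_integral, simp, simp, subst nn_integral_distr, simp, simp,
            subst nn_integral_density) (auto simp: mult.commute)
      also have "\<dots> = enn2real (\<integral>\<^sup>+\<omega>. ?c * ennreal (exp (- real n * S \<omega>)) \<partial>M)"
        by (subst lapS, simp, simp, subst nn_integral_cmult, simp, subst lapS') (simp_all add: mult.commute)
      also have "\<dots> = (\<integral>x. exp (- real n * x) \<partial>density (distr M borel S) (\<lambda>_. ?c))"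
        by (subst integral_eq_nn_integral, simp, simp, subst nn_integral_density, simp, simp,
            subst nn_integral_distr) auto
      finally show "(\<integral>x. exp (- real n * x) \<partial>distr (density M (\<lambda>\<omega>. indicator A (T \<omega>))) borel S) =
          (\<integral>x. exp (- real n * x) \<partial>density (distr M borel S) (\<lambda>_. ?c))" .
    qed simp_all
    then have "emeasure (distr (density M (\<lambda>\<omega>. indicator A (T \<omega>))) borel S) B =
        emeasure (density (distr M borel S) (\<lambda>_. ?c)) B" by simp
    also have "emeasure (distr (density M (\<lambda>\<omega>. indicator A (T \<omega>))) borel S) B = 
        emeasure M ((T -` A \<inter> space M) \<inter> (S -` B \<inter> space M))"
      by (subst emeasure_distr, simp, simp, subst emeasure_density)
        (auto simp: nn_integral_indicator[symmetric] simp del: nn_integral_indicator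
          intro!: nn_integral_cong split: split_indicator)
    also have "emeasure (density (distr M borel S) (\<lambda>_. ?c)) B = ?c * emeasure M (S -` B \<inter> space M)"
      by (simp add: emeasure_density_const emeasure_distr)
    finally show "emeasure M {\<omega>\<in>space M. T \<omega> \<in> A \<and> S \<omega> \<in> B} =
        emeasure M {\<omega>\<in>space M. T \<omega> \<in> A} * emeasure M {\<omega>\<in>space M. S \<omega> \<in> B}"
      by (simp add: vimage_def Int_def conj_ac)
  qed simp_all
  then show ?thesis
    unfolding P_def T_def S_def .
qed

end

section \<open>Beta laws and the gamma process\<close>

lemma (in prob_space) indep_var_imp_indep_rv:
  assumes "indep_var S X T Y"
  shows "indep_rv S X T Y"
proof -
  note [measurable] = indep_var_rv1[OF assms] indep_var_rv2[OF assms]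
  have "emeasure M {\<omega>\<in>space M. X \<omega> \<in> A \<and> Y \<omega> \<in> B} =
      emeasure M {\<omega>\<in>space M. X \<omega> \<in> A} * emeasure M {\<omega>\<in>space M. Y \<omega> \<in> B}"
    if [measurable]: "A \<in> sets S" "B \<in> sets T" for A B
  proof -
    have "{\<omega>\<in>space M. X \<omega> \<in> A \<and> Y \<omega> \<in> B} = (\<lambda>\<omega>. (X \<omega>, Y \<omega>)) -` (A \<times> B) \<inter> space M"
      "{\<omega>\<in>space M. X \<omega> \<in> A} = X -` A \<inter> space M" "{\<omega>\<in>space M. Y \<omega> \<in> B} = Y -` B \<inter> space M"
      by auto
    then show ?thesis
      using indep_varD[OF assms that] by (simp add: emeasure_eq_measure ennreal_mult[symmetric])
  qed
  then show ?thesis by (auto simp: indep_rv_def)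
qed

definition beta_dens :: "real \<Rightarrow> real \<Rightarrow> real \<Rightarrow> real" where
  "beta_dens s r x = indicator {0<..<1} x * (x powr (s - 1) * (1 - x) powr (r - s - 1) / Beta s (r - s))"

lemma beta_dens_measurable [measurable]:
  "(\<lambda>x. beta_dens (s x) (r x) (f x)) \<in> borel_measurable N"
  if [measurable]: "s \<in> borel_measurable N" "r \<in> borel_measurable N" "f \<in> borel_measurable N"
    "(\<lambda>x. Beta (s x) (r x - s x)) \<in> borel_measurable N"
  unfolding beta_dens_def by measurable

lemma Beta_pos: "0 < a \<Longrightarrow> 0 < b \<Longrightarrow> 0 < (Beta a b :: real)"
  by (simp add: Beta_def Gamma_real_pos)

lemma beta_dens_nonneg: "0 < s \<Longrightarrow> s < r \<Longrightarrow> 0 \<le> beta_dens s r x"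
  using Beta_pos[of s "r - s"] by (auto simp: beta_dens_def)

text \<open>The factor \<open>x ^ n\<close> shifts the first shape parameter by \<open>n\<close>,
  leaving another Beta integral.\<close>

lemma moment_beta_dens:
  assumes "0 < s" "s < r"
  shows "(\<integral>\<^sup>+x. ennreal (beta_dens s r x) * ennreal (x ^ n) \<partial>lborel) =
    ennreal (Beta (s + real n) (r - s) / Beta s (r - s))"
proof -
  have B: "Beta s (r - s) > 0" using assms by (intro Beta_pos) auto
  have "((\<lambda>x. x powr (s + real n - 1) * (1 - x) powr (r - s - 1)) has_integral Beta (s + real n) (r - s)) {0<..<1}"
    using has_integral_Beta_real[of "s + real n" "r - s"] assms by (simp add: has_integral_Icc_iff_Ioo)
  then have "((\<lambda>x. (x powr (s + real n - 1) * (1 - x) powr (r - s - 1)) / Beta s (r - s))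
      has_integral Beta (s + real n) (r - s) / Beta s (r - s)) {0<..<1}"
    by (rule has_integral_divide)
  then have "(\<integral>\<^sup>+x. ennreal (indicator {0<..<1} x * ((x powr (s + real n - 1) * (1 - x) powr (r - s - 1)) / Beta s (r - s))) \<partial>lborel) =
      ennreal (Beta (s + real n) (r - s) / Beta s (r - s))"
    using B by (intro nn_integral_has_integral_lebesgue) auto
  also have "(\<integral>\<^sup>+x. ennreal (indicator {0<..<1} x * ((x powr (s + real n - 1) * (1 - x) powr (r - s - 1)) / Beta s (r - s))) \<partial>lborel) =
      (\<integral>\<^sup>+x. ennreal (beta_dens s r x) * ennreal (x ^ n) \<partial>lborel)"
  proof (rule nn_integral_cong)
    fix x :: real
    have "x powr (s + real n - 1) = x powr (s - 1) * x ^ n" if "x > 0"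
      using that powr_add[of x "s - 1" "real n"] by (simp add: powr_realpow algebra_simps)
    then show "ennreal (indicator {0<..<1} x * ((x powr (s + real n - 1) * (1 - x) powr (r - s - 1)) / Beta s (r - s))) =
        ennreal (beta_dens s r x) * ennreal (x ^ n)"
      using B by (auto simp: beta_dens_def ennreal_mult[symmetric] mult_ac split: split_indicator)
  qed
  finally show ?thesis .
qed

section \<open>Paths and ratios of the gamma process\<close>

locale gamma_process = prob_space M for M :: "'a measure" +
  fixes g :: "real \<Rightarrow> 'a \<Rightarrow> real"
  assumes std: "standard_gamma_process M g"
begin

lemma g_measurable [measurable]: "0 \<le> s \<Longrightarrow> g s \<in> borel_measurable M"
  and g_0: "\<omega> \<in> space M \<Longrightarrow> g 0 \<omega> = 0"
  and g_mono: "\<omega> \<in> space M \<Longrightarrow> 0 \<le> s \<Longrightarrow> s \<le> r \<Longrightarrow> g s \<omega> \<le> g r \<omega>"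
  and g_right_cont: "\<omega> \<in> space M \<Longrightarrow> 0 \<le> s \<Longrightarrow> continuous (at_right s) (\<lambda>s. g s \<omega>)"
  using std by (auto simp: standard_gamma_process_def mono_on_def)

lemma g_nonneg: "\<omega> \<in> space M \<Longrightarrow> 0 \<le> s \<Longrightarrow> 0 \<le> g s \<omega>"
  using g_mono[of \<omega> 0 s] g_0[of \<omega>] by simp

lemma g_indep_increments:
  assumes "0 \<le> t 0" "\<And>i. i < n \<Longrightarrow> t i < t (Suc i)"
  shows "indep_vars (\<lambda>_. borel) (\<lambda>i \<omega>. g (t (Suc i)) \<omega> - g (t i) \<omega>) {..<n}"
  using std assms by (auto simp: standard_gamma_process_def)

lemma g_increment_laplace:
  assumes "0 \<le> s" "s \<le> r" "0 \<le> l"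
  shows "expectation (\<lambda>\<omega>. exp (- l * (g r \<omega> - g s \<omega>))) = (1 + l) powr (- (r - s))"
proof -
  have d: "distr M borel (\<lambda>\<omega>. g r \<omega> - g s \<omega>) = distr M borel (g (r - s))"
    using std assms by (auto simp: standard_gamma_process_def)
  have [measurable]: "g r \<in> borel_measurable M" "g s \<in> borel_measurable M" "g (r - s) \<in> borel_measurable M"
    using assms by auto
  have "expectation (\<lambda>\<omega>. exp (- l * (g r \<omega> - g s \<omega>))) = (\<integral>x. exp (- l * x) \<partial>distr M borel (\<lambda>\<omega>. g r \<omega> - g s \<omega>))"
    by (subst integral_distr) auto
  also have "\<dots> = expectation (\<lambda>\<omega>. exp (- l * g (r - s) \<omega>))"
    unfolding d by (subst integral_distr) auto
  also have "\<dots> = (1 + l) powr (- (r - s))"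
    using std assms by (simp add: standard_gamma_process_def)
  finally show ?thesis .
qed

lemma g_increment_distr:
  assumes "0 \<le> s" "s < r"
  shows "distr M borel (\<lambda>\<omega>. g r \<omega> - g s \<omega>) = gamma_law (r - s)"
  using assms by (intro distr_eq_gamma_law g_increment_laplace) (auto intro: g_mono)

lemma g_distr:
  assumes "0 < s"
  shows "distr M borel (g s) = gamma_law s"
  using g_increment_distr[of 0 s] assms by (simp add: g_0 cong: distr_cong)

lemma AE_g_less:
  assumes "0 \<le> s" "s < r"
  shows "AE \<omega> in M. g s \<omega> < g r \<omega>"
proof -
  have [measurable]: "g r \<in> borel_measurable M" "g s \<in> borel_measurable M"
    using assms by auto
  have "AE x in distr M borel (\<lambda>\<omega>. g r \<omega> - g s \<omega>). 0 < x"
    unfolding g_increment_distr[OF assms] by (rule AE_gamma_law_pos)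
  then show ?thesis by (subst (asm) AE_distr_iff) auto
qed

text \<open>One null set has to serve all pairs of times, since the paths are later read at the
  random time \<open>\<tau>\<close>. Countably many rational pairs suffice, because monotone paths
  let two rationals be inserted between \<open>s\<close> and \<open>r\<close>.\<close>

lemma AE_g_strict_mono: "AE \<omega> in M. \<forall>s r. 0 \<le> s \<longrightarrow> s < r \<longrightarrow> g s \<omega> < g r \<omega>"
proof -
  have "AE \<omega> in M. \<forall>q\<in>\<rat>. \<forall>q'\<in>\<rat>. 0 \<le> q \<longrightarrow> q < q' \<longrightarrow> g q \<omega> < g q' \<omega>"
    by (intro AE_ball_countable' AE_impI countable_rat) (auto intro: AE_g_less)
  then show ?thesis
    using AE_space
  proof eventually_elim
    case (elim \<omega>)
    show ?case
    proof (intro allI impI)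
      fix s r :: real assume sr: "0 \<le> s" "s < r"
      obtain q where q: "q \<in> \<rat>" "s < q" "q < r" using Rats_dense_in_real sr by blast
      obtain q' where q': "q' \<in> \<rat>" "q < q'" "q' < r" using Rats_dense_in_real q by blast
      have "g s \<omega> \<le> g q \<omega>" "g q' \<omega> \<le> g r \<omega>" "g q \<omega> < g q' \<omega>"
        using elim sr q q' by (auto intro!: g_mono)
      then show "g s \<omega> < g r \<omega>" by simp
    qed
  qed
qed

text \<open>The case of two increments, over the grid 0, \<open>s\<close>, \<open>r\<close>, keeping
  only the first normalised component.\<close>

lemma g_ratio_indep:
  assumes "0 < s" "s < r"
  shows "indep_rv borel (\<lambda>\<omega>. g s \<omega> / g r \<omega>) borel (g r)"
proof -
  define t where "t i = (if i = 0 then 0 else if i = Suc 0 then s else r)" for i :: nat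
  let ?X = "\<lambda>i \<omega>. g (t (Suc i)) \<omega> - g (t i) \<omega>"
  have I: "indep_rv (\<Pi>\<^sub>M i\<in>{..<2}. borel) (\<lambda>\<omega>. \<lambda>i\<in>{..<2}. ?X i \<omega> / (\<Sum>j<2. ?X j \<omega>)) borel (\<lambda>\<omega>. \<Sum>j<2. ?X j \<omega>)"
    using assms by (intro gamma_normalised_indep_sum[where p="\<lambda>i. t (Suc i) - t i"] g_indep_increments g_increment_laplace)
      (auto simp: t_def less_2_cases_iff lessThan_empty_iff intro: g_mono)
  have "indep_rv borel (\<lambda>\<omega>. (\<lambda>i\<in>{..<2::nat}. ?X i \<omega> / (\<Sum>j<2. ?X j \<omega>)) 0) borel (\<lambda>\<omega>. \<Sum>j<2. ?X j \<omega>)"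
    by (rule indep_rv_compose[OF I]) (auto intro!: measurable_component_singleton)
  then have "indep_rv borel (\<lambda>\<omega>. (g s \<omega> - g 0 \<omega>) / (g r \<omega> - g 0 \<omega>)) borel (\<lambda>\<omega>. g r \<omega> - g 0 \<omega>)"
    by (simp add: t_def numeral_2_eq_2)
  then show ?thesis
    using assms by (auto simp: indep_rv_def g_0 cong: conj_cong)
qed

text \<open>Since \<open>g s\<close> is the product of the ratio and the independent
  \<open>g r\<close>, the moments of the ratio are quotients of gamma moments. These are the beta
  moments, and moments determine a law on the unit interval.\<close>

lemma distr_g_ratio:
  assumes "0 < s" "s < r"
  shows "distr M borel (\<lambda>\<omega>. g s \<omega> / g r \<omega>) = density lborel (\<lambda>x. ennreal (beta_dens s r x))"
proof -
  have [measurable]: "g r \<in> borel_measurable M" "g s \<in> borel_measurable M"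
    using assms by auto
  have nonneg: "0 \<le> g s \<omega>" "g s \<omega> \<le> g r \<omega>" "0 \<le> g r \<omega>" if "\<omega> \<in> space M" for \<omega>
    using that assms by (auto intro: g_nonneg g_mono)
  have r01: "0 \<le> g s \<omega> / g r \<omega>" "g s \<omega> / g r \<omega> \<le> 1" if "\<omega> \<in> space M" for \<omega>
    using nonneg[OF that] by (auto simp: divide_le_eq_1)
  have mom: "(\<integral>\<^sup>+\<omega>. ennreal ((g s \<omega> / g r \<omega>) ^ n) \<partial>M) = ennreal (Beta (s + real n) (r - s) / Beta s (r - s))" for n
  proof -
    have G: "Gamma s > 0" "Gamma r > 0" "Gamma (s + real n) > 0" "Gamma (r + real n) > 0" "Gamma (r - s) > 0"
      using assms by (auto intro!: Gamma_real_pos)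
    have "ennreal (Gamma (s + real n) / Gamma s) = (\<integral>\<^sup>+x. ennreal (x ^ n) \<partial>distr M borel (g s))"
      using assms by (simp add: g_distr moment_gamma_law)
    also have "\<dots> = (\<integral>\<^sup>+\<omega>. ennreal (g s \<omega> ^ n) \<partial>M)"
      by (subst nn_integral_distr) auto
    also have "\<dots> = (\<integral>\<^sup>+\<omega>. (case (g s \<omega> / g r \<omega>, g r \<omega>) of (x, y) \<Rightarrow> ennreal (x ^ n) * ennreal (y ^ n)) \<partial>M)"
    proof (rule nn_integral_cong)
      fix \<omega> assume \<omega>: "\<omega> \<in> space M"
      \<comment> \<open>If \<open>g r \<omega> = 0\<close> then \<open>g s \<omega> = 0\<close> by
        monotonicity, so the factorisation holds at every sample point.\<close>
      have "g s \<omega> = g s \<omega> / g r \<omega> * g r \<omega>"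
        using nonneg[OF \<omega>] by (cases "g r \<omega> = 0") auto
      then have "g s \<omega> ^ n = (g s \<omega> / g r \<omega>) ^ n * g r \<omega> ^ n"
        by (metis power_mult_distrib)
      then show "ennreal (g s \<omega> ^ n) = (case (g s \<omega> / g r \<omega>, g r \<omega>) of (x, y) \<Rightarrow> ennreal (x ^ n) * ennreal (y ^ n))"
        using nonneg[OF \<omega>] r01[OF \<omega>] by (simp add: ennreal_mult[symmetric])
    qed
    also have "\<dots> = (\<integral>\<^sup>+\<omega>. \<integral>\<^sup>+\<omega>'. (case (g s \<omega> / g r \<omega>, g r \<omega>') of (x, y) \<Rightarrow> ennreal (x ^ n) * ennreal (y ^ n)) \<partial>M \<partial>M)"
      by (rule indep_rv_nn_integral[OF g_ratio_indep[OF assms]]) measurable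
    also have "\<dots> = (\<integral>\<^sup>+\<omega>. ennreal ((g s \<omega> / g r \<omega>) ^ n) \<partial>M) * (\<integral>\<^sup>+\<omega>. ennreal (g r \<omega> ^ n) \<partial>M)"
      by (simp add: nn_integral_cmult nn_integral_multc)
    also have "(\<integral>\<^sup>+\<omega>. ennreal (g r \<omega> ^ n) \<partial>M) = (\<integral>\<^sup>+x. ennreal (x ^ n) \<partial>distr M borel (g r))"
      by (subst nn_integral_distr) auto
    also have "\<dots> = ennreal (Gamma (r + real n) / Gamma r)"
      using assms by (simp add: g_distr moment_gamma_law)
    finally have e: "ennreal (Gamma (s + real n) / Gamma s) =
      (\<integral>\<^sup>+\<omega>. ennreal ((g s \<omega> / g r \<omega>) ^ n) \<partial>M) * ennreal (Gamma (r + real n) / Gamma r)" .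
    have "(\<integral>\<^sup>+\<omega>. ennreal ((g s \<omega> / g r \<omega>) ^ n) \<partial>M) =
        (\<integral>\<^sup>+\<omega>. ennreal ((g s \<omega> / g r \<omega>) ^ n) \<partial>M) * ennreal (Gamma (r + real n) / Gamma r) * ennreal (Gamma r / Gamma (r + real n))"
      using G by (simp add: mult.assoc ennreal_mult[symmetric])
    also have "\<dots> = ennreal (Gamma (s + real n) / Gamma s * (Gamma r / Gamma (r + real n)))"
      unfolding e[symmetric] using G by (simp add: ennreal_mult[symmetric])
    also have "Gamma (s + real n) / Gamma s * (Gamma r / Gamma (r + real n)) = Beta (s + real n) (r - s) / Beta s (r - s)"
      using G by (simp add: Beta_def algebra_simps)
    finally show ?thesis .
  qed
  have b [measurable]: "beta_dens s r \<in> borel_measurable borel" by measurable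
  have bb: "0 \<le> beta_dens s r x" for x
    using assms by (rule beta_dens_nonneg)
  have d1: "(\<integral>\<^sup>+x. ennreal (beta_dens s r x) \<partial>lborel) = 1"
    using moment_beta_dens[OF assms, of 0] Beta_pos[of s "r - s"] assms by simp
  show ?thesis
  proof (rule finite_measure_eq_if_moments_eq)
    show "finite_measure (distr M borel (\<lambda>\<omega>. g s \<omega> / g r \<omega>))"
      by (rule finite_measure_distr) simp
    show "finite_measure (density lborel (\<lambda>x. ennreal (beta_dens s r x)))"
      by (rule finite_measureI) (simp add: emeasure_density d1)
    show "AE x in distr M borel (\<lambda>\<omega>. g s \<omega> / g r \<omega>). x \<in> {0..1}"
      using r01 by (subst AE_distr_iff) auto
    show "AE x in density lborel (\<lambda>x. ennreal (beta_dens s r x)). x \<in> {0..1}"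
      by (subst AE_density) (auto simp: beta_dens_def split: split_indicator)
    fix n
    have "(\<integral>x. x ^ n \<partial>distr M borel (\<lambda>\<omega>. g s \<omega> / g r \<omega>)) = expectation (\<lambda>\<omega>. (g s \<omega> / g r \<omega>) ^ n)"
      by (subst integral_distr) auto
    also have "\<dots> = enn2real (ennreal (Beta (s + real n) (r - s) / Beta s (r - s)))"
      unfolding mom[symmetric] using r01 by (subst integral_eq_nn_integral) auto
    also have "\<dots> = enn2real (\<integral>\<^sup>+x. ennreal (x ^ n) \<partial>density lborel (\<lambda>x. ennreal (beta_dens s r x)))"
      unfolding moment_beta_dens[OF assms, symmetric] by (subst nn_integral_density) auto
    also have "\<dots> = (\<integral>x. x ^ n \<partial>density lborel (\<lambda>x. ennreal (beta_dens s r x)))"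
      by (rule integral_eq_nn_integral[symmetric]) (auto simp: AE_density beta_dens_def split: split_indicator)
    finally show "(\<integral>x. x ^ n \<partial>distr M borel (\<lambda>\<omega>. g s \<omega> / g r \<omega>)) = (\<integral>x. x ^ n \<partial>density lborel (\<lambda>x. ennreal (beta_dens s r x)))" .
  qed simp_all
qed


section \<open>Independence inside a bridge of fixed length\<close>

text \<open>The share of the increment over \<open>(s, r]\<close> that is reached by time
  \<open>min u r\<close>. The constant branch for a bridge that has ended by time \<open>u\<close>
  holds even where the quotient would be 0 / 0.\<close>

definition bridge_ratio :: "real \<Rightarrow> real \<Rightarrow> real \<Rightarrow> 'a \<Rightarrow> real" where
  "bridge_ratio u s r \<omega> = (if r \<le> u then 1 else (g u \<omega> - g s \<omega>) / (g r \<omega> - g s \<omega>))"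

text \<open>Together the two conclusions say that the past shape, the ratio at \<open>s\<close> and
  the future share are mutually independent. They come from three facts: normalised increments
  before \<open>s\<close> are independent of \<open>g s\<close>, normalised increments after
  \<open>s\<close> are independent of \<open>g r - g s\<close>, and the two blocks of increments are
  independent.\<close>

lemma bridge_indep:
  assumes s: "0 < s" "s < r" "s < u" and V: "finite V" "V \<subseteq> {0..s}"
  shows "indep_rv (\<Pi>\<^sub>M v\<in>V. borel) (\<lambda>\<omega>. \<lambda>v\<in>V. g v \<omega> / g s \<omega>) (borel \<Otimes>\<^sub>M borel)
      (\<lambda>\<omega>. (g s \<omega> / g r \<omega>, bridge_ratio u s r \<omega>))"
    and "indep_rv borel (\<lambda>\<omega>. g s \<omega> / g r \<omega>) borel (bridge_ratio u s r)"
proof -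
  \<comment> \<open>If \<open>u \<ge> r\<close> the future share is constant and any time strictly
    between \<open>s\<close> and \<open>r\<close> will do; the midpoint lets both cases use the same
    grid.\<close>
  define s' where "s' = (if u < r then u else (s + r) / 2)"
  have s': "s < s'" "s' < r" using s by (auto simp: s'_def)
  \<comment> \<open>Adding 0 and \<open>s\<close> to \<open>V\<close> makes every \<open>g v\<close>
    a partial sum of increments and guarantees at least one increment before
    \<open>s\<close>.\<close>
  define ts where "ts = sorted_list_of_set (insert 0 (insert s V))"
  define n where "n = length ts - 1"
  have set_ts: "set ts = insert 0 (insert s V)" and sorted: "sorted ts" "distinct ts"
    using V by (simp_all add: ts_def del: sorted_list_of_set_insert_remove)
  have "length ts = card (set ts)" using sorted by (simp add: distinct_card)
  moreover have "card {0, s} \<le> card (set ts)"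
    unfolding set_ts using V by (intro card_mono) auto
  ultimately have len: "length ts = Suc n" "n \<ge> 1" using s by (auto simp: n_def)
  have lt: "ts ! i < ts ! j" if "i < j" "j \<le> n" for i j
    using that sorted len sorted_wrt_nth_less[of "(<)" ts i j] by (simp add: strict_sorted_iff)
  have range: "ts ! i \<in> {0..s}" if "i \<le> n" for i
    using that len set_ts V nth_mem[of i ts] s by auto
  have idx: "\<exists>k\<le>n. ts ! k = v" if "v \<in> insert 0 (insert s V)" for v
    using that len unfolding set_ts[symmetric] in_set_conv_nth by (auto simp: less_Suc_eq_le)
  have ts0: "ts ! 0 = 0"
  proof -
    obtain k where k: "k \<le> n" "ts ! k = 0" using idx[of 0] by auto
    then show ?thesis using lt[of 0 k] range[of 0] by (cases "k = 0") auto
  qed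
  have tsn: "ts ! n = s"
  proof -
    obtain k where k: "k \<le> n" "ts ! k = s" using idx[of s] by auto
    then show ?thesis using lt[of k n] range[of n] by (cases "k = n") auto
  qed
  \<comment> \<open>Indices below \<open>n\<close> belong to increments before \<open>s\<close>;
    \<open>n\<close> and \<open>Suc n\<close> are the two increments on either side of
    \<open>s'\<close>.\<close>
  define t where "t i = (if i \<le> n then ts ! i else if i = Suc n then s' else r)" for i
  have t0: "t 0 = 0" and tn: "t n = s" "t (Suc n) = s'" "t (Suc (Suc n)) = r"
    by (simp_all add: t_def ts0 tsn)
  have t_less: "t i < t (Suc i)" if "i < n + 2" for i
    using that lt[of i "Suc i"] s' tsn
    by (cases "i < n"; cases "i = n") (auto simp: t_def)
  have t_nonneg: "0 \<le> t i" for i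
    using range[of i] s s' by (auto simp: t_def)
  define X where "X i \<omega> = g (t (Suc i)) \<omega> - g (t i) \<omega>" for i \<omega>
  have X [measurable]: "X i \<in> borel_measurable M" for i
    unfolding X_def using t_nonneg by measurable
  have ind: "indep_vars (\<lambda>_. borel) X {..<n + 2}"
    unfolding X_def using t_less by (intro g_indep_increments) (auto simp: t0)
  have X_nonneg: "0 \<le> X i \<omega>" if "i < n + 2" "\<omega> \<in> space M" for i \<omega>
    unfolding X_def using that t_less[of i] t_nonneg[of i] g_mono[of \<omega> "t i" "t (Suc i)"] by auto
  have X_lap: "expectation (\<lambda>\<omega>. exp (- l * X i \<omega>)) = (1 + l) powr (- (t (Suc i) - t i))"
    if "i < n + 2" "l \<ge> 0" for i l
    unfolding X_def using that t_less[of i] t_nonneg[of i] by (intro g_increment_laplace) auto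
  have sumX: "(\<Sum>j<k. X j \<omega>) = g (t k) \<omega>" if "\<omega> \<in> space M" for k \<omega>
    using g_0[OF that] sum_lessThan_telescope[of "\<lambda>i. g (t i) \<omega>" k] by (simp add: X_def t0)
  let ?J = "{n, Suc n}"
  have sumJ: "(\<Sum>j\<in>?J. X j \<omega>) = g r \<omega> - g s \<omega>" for \<omega>
    by (simp add: X_def tn)
  have I1: "indep_rv (\<Pi>\<^sub>M i\<in>{..<n}. borel) (\<lambda>\<omega>. \<lambda>i\<in>{..<n}. X i \<omega> / (\<Sum>j<n. X j \<omega>)) borel (\<lambda>\<omega>. \<Sum>j<n. X j \<omega>)"
    using len by (intro gamma_normalised_indep_sum[where p="\<lambda>i. t (Suc i) - t i"] indep_vars_subset[OF ind] X_lap X_nonneg)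
      (auto simp: lessThan_empty_iff)
  have I2: "indep_rv (\<Pi>\<^sub>M i\<in>?J. borel) (\<lambda>\<omega>. \<lambda>i\<in>?J. X i \<omega> / (\<Sum>j\<in>?J. X j \<omega>)) borel (\<lambda>\<omega>. \<Sum>j\<in>?J. X j \<omega>)"
    by (intro gamma_normalised_indep_sum[where p="\<lambda>i. t (Suc i) - t i"] indep_vars_subset[OF ind] X_lap X_nonneg)
      auto
  have I3: "indep_rv (\<Pi>\<^sub>M i\<in>{..<n}. borel) (\<lambda>\<omega>. \<lambda>i\<in>{..<n}. X i \<omega>) (\<Pi>\<^sub>M i\<in>?J. borel) (\<lambda>\<omega>. \<lambda>i\<in>?J. X i \<omega>)"
    by (intro indep_var_imp_indep_rv indep_var_restrict[OF ind]) auto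
  obtain k where k: "\<And>v. v \<in> V \<Longrightarrow> k v \<le> n \<and> ts ! (k v) = v"
    using idx by (metis insertCI)
  let ?\<Theta> = "\<lambda>\<omega>. \<lambda>v\<in>V. g v \<omega> / g s \<omega>"
  let ?\<xi> = "bridge_ratio u s r"
  let ?PV = "\<Pi>\<^sub>M v\<in>V. borel :: real measure"
  have gv: "g v \<omega> = (\<Sum>j<k v. X j \<omega>)" if "v \<in> V" "\<omega> \<in> space M" for v \<omega>
    using k[OF that(1)] sumX[OF that(2)] by (simp add: t_def)
  have gs: "g s \<omega> = (\<Sum>j<n. X j \<omega>)" if "\<omega> \<in> space M" for \<omega>
    using sumX[OF that] tn by simp
  \<comment> \<open>The telescoping sums use \<open>g 0 = 0\<close>, which is known on
    \<open>space M\<close> only, so variables are replaced through this congruence.\<close>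
  have cong: "indep_rv S A T B \<longleftrightarrow> indep_rv S A' T B'"
    if "\<And>\<omega>. \<omega> \<in> space M \<Longrightarrow> A \<omega> = A' \<omega>" "\<And>\<omega>. \<omega> \<in> space M \<Longrightarrow> B \<omega> = B' \<omega>" for S A A' T B B'
    using that unfolding indep_rv_def by (simp cong: measurable_cong conj_cong)
  have \<xi>_eq: "?\<xi> \<omega> = (if r \<le> u then 1 else X n \<omega> / (X n \<omega> + X (Suc n) \<omega>))" for \<omega>
    by (auto simp: bridge_ratio_def X_def tn s'_def)
  have \<Theta>_s: "indep_rv ?PV ?\<Theta> borel (g s)"
  proof -
    have "indep_rv ?PV (\<lambda>\<omega>. (\<lambda>x. \<lambda>v\<in>V. \<Sum>j<k v. x j) (\<lambda>i\<in>{..<n}. X i \<omega> / (\<Sum>j<n. X j \<omega>))) borel (\<lambda>\<omega>. (\<lambda>x. x) (\<Sum>j<n. X j \<omega>))"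
    proof (rule indep_rv_compose[OF I1])
      have "(\<lambda>x. x j) \<in> borel_measurable (\<Pi>\<^sub>M i\<in>{..<n}. borel)" if "v \<in> V" "j < k v" for v j
        using k[OF that(1)] that by (intro measurable_component_singleton) auto
      then show "(\<lambda>x. \<lambda>v\<in>V. \<Sum>j<k v. x j) \<in> (\<Pi>\<^sub>M i\<in>{..<n}. borel) \<rightarrow>\<^sub>M ?PV"
        by (intro measurable_restrict borel_measurable_sum) auto
    qed simp
    then show ?thesis
    proof (subst cong)
      fix \<omega> assume \<omega>: "\<omega> \<in> space M"
      show "?\<Theta> \<omega> = (\<lambda>x. \<lambda>v\<in>V. \<Sum>j<k v. x j) (\<lambda>i\<in>{..<n}. X i \<omega> / (\<Sum>j<n. X j \<omega>))"
        using k by (fastforce intro!: restrict_ext simp: gs[OF \<omega>] gv \<omega> sum_divide_distrib intro: sum.cong)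
      show "g s \<omega> = (\<lambda>x. x) (\<Sum>j<n. X j \<omega>)" by (simp add: gs[OF \<omega>])
    qed
  qed
  have \<Theta>s_W\<xi>: "indep_rv (?PV \<Otimes>\<^sub>M borel) (\<lambda>\<omega>. (?\<Theta> \<omega>, g s \<omega>)) (borel \<Otimes>\<^sub>M borel) (\<lambda>\<omega>. (g r \<omega> - g s \<omega>, ?\<xi> \<omega>))"
  proof -
    let ?f = "\<lambda>x. (\<lambda>v\<in>V. (\<Sum>j<k v. x j) / (\<Sum>j<n. x j), \<Sum>j<n. x j :: real)"
    let ?h = "\<lambda>x. (x n + x (Suc n), if r \<le> u then 1 else x n / (x n + x (Suc n)) :: real)"
    have "indep_rv (?PV \<Otimes>\<^sub>M borel) (\<lambda>\<omega>. ?f (\<lambda>i\<in>{..<n}. X i \<omega>)) (borel \<Otimes>\<^sub>M borel) (\<lambda>\<omega>. ?h (\<lambda>i\<in>?J. X i \<omega>))"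
    proof (rule indep_rv_compose[OF I3])
      have "(\<lambda>x. x j) \<in> borel_measurable (\<Pi>\<^sub>M i\<in>{..<n}. borel)" if "v \<in> V" "j < k v" for v j
        using k[OF that(1)] that by (intro measurable_component_singleton) auto
      then have "(\<lambda>x. \<lambda>v\<in>V. (\<Sum>j<k v. x j) / (\<Sum>j<n. x j)) \<in> (\<Pi>\<^sub>M i\<in>{..<n}. borel) \<rightarrow>\<^sub>M ?PV"
        by (intro measurable_restrict borel_measurable_divide borel_measurable_sum) auto
      then show "?f \<in> (\<Pi>\<^sub>M i\<in>{..<n}. borel) \<rightarrow>\<^sub>M ?PV \<Otimes>\<^sub>M borel"
        by measurable
      show "?h \<in> (\<Pi>\<^sub>M i\<in>?J. borel) \<rightarrow>\<^sub>M borel \<Otimes>\<^sub>M borel"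
        by measurable
    qed
    then show ?thesis
    proof (subst cong)
      fix \<omega> assume \<omega>: "\<omega> \<in> space M"
      show "(?\<Theta> \<omega>, g s \<omega>) = ?f (\<lambda>i\<in>{..<n}. X i \<omega>)"
        using k by (fastforce intro!: restrict_ext arg_cong2[where f="(/)"] simp: gs[OF \<omega>] gv \<omega> intro: sum.cong)
      show "(g r \<omega> - g s \<omega>, ?\<xi> \<omega>) = ?h (\<lambda>i\<in>?J. X i \<omega>)"
        using sumJ[of \<omega>] by (simp add: \<xi>_eq)
    qed
  qed
  have \<xi>_W: "indep_rv borel ?\<xi> borel (\<lambda>\<omega>. g r \<omega> - g s \<omega>)"
  proof -
    have "indep_rv borel (\<lambda>\<omega>. (\<lambda>x. if r \<le> u then 1 else x n) (\<lambda>i\<in>?J. X i \<omega> / (\<Sum>j\<in>?J. X j \<omega>))) borel (\<lambda>\<omega>. (\<lambda>x. x) (\<Sum>j\<in>?J. X j \<omega>))"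
      by (rule indep_rv_compose[OF I2]) measurable
    then show ?thesis
      by (subst cong) (auto simp: \<xi>_eq sumJ[symmetric])
  qed
  \<comment> \<open>Regrouping makes the past shape independent of the triple of \<open>g s\<close>,
    the increment after \<open>s\<close> and the future share; the ratio is then computed as
    \<open>g s\<close> over the sum of the first two.\<close>
  have "indep_rv ?PV (\<lambda>\<omega>. (\<lambda>x. x) (?\<Theta> \<omega>)) (borel \<Otimes>\<^sub>M borel)
      (\<lambda>\<omega>. (\<lambda>p. (fst p / (fst p + fst (snd p)), snd (snd p))) (g s \<omega>, (g r \<omega> - g s \<omega>, ?\<xi> \<omega>)))"
    by (rule indep_rv_compose[OF indep_rv_regroup[OF \<Theta>_s \<Theta>s_W\<xi>]]) measurable
  then show "indep_rv ?PV ?\<Theta> (borel \<Otimes>\<^sub>M borel) (\<lambda>\<omega>. (g s \<omega> / g r \<omega>, ?\<xi> \<omega>))"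
    by simp
  \<comment> \<open>The pair is swapped so that the future share comes first; a second regrouping
    then separates it from both \<open>g s\<close> and the increment after \<open>s\<close>.\<close>
  have "indep_rv borel (\<lambda>\<omega>. snd (?\<Theta> \<omega>, g s \<omega>)) (borel \<Otimes>\<^sub>M borel) (\<lambda>\<omega>. (\<lambda>p. (snd p, fst p)) (g r \<omega> - g s \<omega>, ?\<xi> \<omega>))"
    by (rule indep_rv_compose[OF \<Theta>s_W\<xi>]) measurable
  from indep_rv_commute[OF this]
  have "indep_rv (borel \<Otimes>\<^sub>M borel) (\<lambda>\<omega>. (?\<xi> \<omega>, g r \<omega> - g s \<omega>)) borel (g s)"
    by simp
  from indep_rv_regroup[OF \<xi>_W this]
  have "indep_rv borel (\<lambda>\<omega>. (\<lambda>x. x) (?\<xi> \<omega>)) borel (\<lambda>\<omega>. (\<lambda>p. snd p / (fst p + snd p)) (g r \<omega> - g s \<omega>, g s \<omega>))"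
    by (rule indep_rv_compose) measurable
  from indep_rv_commute[OF this] show "indep_rv borel (\<lambda>\<omega>. g s \<omega> / g r \<omega>) borel ?\<xi>"
    by simp
qed

text \<open>Almost surely \<open>g v / g r\<close> is the past shape times the ratio
  \<open>B = g s / g r\<close>, and the bridge at \<open>u\<close> is \<open>B + (1 - B)\<close>
  times the future share. Independence separates the three, and \<open>x\<close> stands for the
  value of \<open>B\<close>. The past factor does not involve \<open>r\<close>, which is the source
  of the Markov property.\<close>

lemma bridge_formula:
  fixes c :: "real \<times> real \<Rightarrow> ennreal"
  assumes s: "0 < s" "s < r" "s < u" and V: "finite V" "V \<subseteq> {0..s}"
    and D: "\<And>v. v \<in> V \<Longrightarrow> D v \<in> sets borel"
    and c [measurable]: "c \<in> borel_measurable (borel \<Otimes>\<^sub>M borel)"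
  shows "(\<integral>\<^sup>+\<omega>. (\<Prod>v\<in>V. indicator (D v) (g v \<omega> / g r \<omega>)) * c (g s \<omega> / g r \<omega>, g (min u r) \<omega> / g r \<omega>) \<partial>M) =
    (\<integral>\<^sup>+x. ennreal (beta_dens s r x) * ((\<integral>\<^sup>+\<omega>. (\<Prod>v\<in>V. indicator (D v) (g v \<omega> / g s \<omega> * x)) \<partial>M) *
      (\<integral>\<^sup>+\<omega>. c (x, x + (1 - x) * bridge_ratio u s r \<omega>) \<partial>M)) \<partial>lborel)"
proof -
  let ?PV = "\<Pi>\<^sub>M v\<in>V. borel :: real measure"
  let ?\<Theta> = "\<lambda>\<omega>. \<lambda>v\<in>V. g v \<omega> / g s \<omega>"
  let ?\<xi> = "bridge_ratio u s r"
  let ?B = "\<lambda>\<omega>. g s \<omega> / g r \<omega>"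
  note indep = bridge_indep[OF s V]
  note [measurable] = indep_rvD(1)[OF indep(1)] indep_rvD(1,2)[OF indep(2)]
  define a where "a = (\<lambda>(\<theta>, x). \<Prod>v\<in>V. indicator (D v) (\<theta> v * x) :: ennreal)"
  have a [measurable]: "a \<in> borel_measurable (?PV \<Otimes>\<^sub>M borel)"
    unfolding a_def using D by measurable
  define C where "C = (\<lambda>(x, y). c (x, x + (1 - x) * y))"
  have C [measurable]: "C \<in> borel_measurable (borel \<Otimes>\<^sub>M borel)"
    unfolding C_def by measurable
  define A where "A x = (\<integral>\<^sup>+\<omega>. a (?\<Theta> \<omega>, x) \<partial>M)" for x
  have A [measurable]: "A \<in> borel_measurable borel"
    unfolding A_def by measurable
  have "(\<integral>\<^sup>+\<omega>. (\<Prod>v\<in>V. indicator (D v) (g v \<omega> / g r \<omega>)) * c (g s \<omega> / g r \<omega>, g (min u r) \<omega> / g r \<omega>) \<partial>M)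
      = (\<integral>\<^sup>+\<omega>. (case ((?B \<omega>, ?\<xi> \<omega>), ?\<Theta> \<omega>) of ((x, y), \<theta>) \<Rightarrow> a (\<theta>, x) * C (x, y)) \<partial>M)"
  proof (rule nn_integral_cong_AE, use AE_g_strict_mono AE_space in eventually_elim)
    case (elim \<omega>)
    have pos: "0 < g s \<omega>" "g s \<omega> < g r \<omega>" "0 < g r \<omega>"
      using elim s g_0[of \<omega>] by (metis order_refl, blast intro: less_imp_le, metis less_trans order_refl)
    have "a (?\<Theta> \<omega>, ?B \<omega>) = (\<Prod>v\<in>V. indicator (D v) (g v \<omega> / g r \<omega>))"
      unfolding a_def prod.case by (rule prod.cong) (use pos in auto)
    moreover have "?B \<omega> + (1 - ?B \<omega>) * ?\<xi> \<omega> = g (min u r) \<omega> / g r \<omega>"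
    proof (cases "r \<le> u")
      case False
      have "1 - ?B \<omega> = (g r \<omega> - g s \<omega>) / g r \<omega>" using pos by (simp add: field_simps)
      then show ?thesis
        using False pos by (simp add: bridge_ratio_def min_def add_divide_distrib[symmetric])
    qed (use pos in \<open>simp add: bridge_ratio_def min_def\<close>)
    ultimately show ?case by (simp add: C_def)
  qed
  also have "\<dots> = (\<integral>\<^sup>+\<omega>. \<integral>\<^sup>+\<omega>'. (case ((?B \<omega>, ?\<xi> \<omega>), ?\<Theta> \<omega>') of ((x, y), \<theta>) \<Rightarrow> a (\<theta>, x) * C (x, y)) \<partial>M \<partial>M)"
    by (rule indep_rv_nn_integral[OF indep_rv_commute[OF indep(1)]]) measurable
  also have "\<dots> = (\<integral>\<^sup>+\<omega>. (case (?B \<omega>, ?\<xi> \<omega>) of (x, y) \<Rightarrow> A x * C (x, y)) \<partial>M)"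
    by (simp add: A_def nn_integral_multc)
  also have "\<dots> = (\<integral>\<^sup>+\<omega>. \<integral>\<^sup>+\<omega>'. (case (?B \<omega>, ?\<xi> \<omega>') of (x, y) \<Rightarrow> A x * C (x, y)) \<partial>M \<partial>M)"
    by (rule indep_rv_nn_integral[OF indep(2)]) measurable
  also have "\<dots> = (\<integral>\<^sup>+\<omega>. A (?B \<omega>) * (\<integral>\<^sup>+\<omega>'. C (?B \<omega>, ?\<xi> \<omega>') \<partial>M) \<partial>M)"
    by (simp add: nn_integral_cmult)
  also have "\<dots> = (\<integral>\<^sup>+x. A x * (\<integral>\<^sup>+\<omega>'. C (x, ?\<xi> \<omega>') \<partial>M) \<partial>distr M borel ?B)"
    by (subst nn_integral_distr) auto
  also have "\<dots> = (\<integral>\<^sup>+x. ennreal (beta_dens s r x) * (A x * (\<integral>\<^sup>+\<omega>'. C (x, ?\<xi> \<omega>') \<partial>M)) \<partial>lborel)"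
    unfolding distr_g_ratio[OF s(1,2)] by (subst nn_integral_density) auto
  also have "A = (\<lambda>x. \<integral>\<^sup>+\<omega>. (\<Prod>v\<in>V. indicator (D v) (g v \<omega> / g s \<omega> * x)) \<partial>M)"
    unfolding A_def a_def prod.case by (intro ext nn_integral_cong prod.cong) auto
  finally show ?thesis
    by (simp add: C_def)
qed

end

section \<open>Mixing over the random length\<close>

text \<open>\<open>Gamma\<close> has poles, but it is the pointwise inverse of the continuous
  function \<open>rGamma\<close>.\<close>

lemma measurable_Gamma_real [measurable]: "Gamma \<in> borel_measurable (borel :: real measure)"
  and measurable_rGamma_real [measurable]: "rGamma \<in> borel_measurable (borel :: real measure)"
proof -
  show r: "rGamma \<in> borel_measurable (borel :: real measure)"
    by (intro borel_measurable_continuous_onI continuous_on_rGamma)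
  then show "Gamma \<in> borel_measurable (borel :: real measure)"
    unfolding Gamma_def[abs_def] by measurable
qed

text \<open>Up to a factor depending on \<open>s\<close> and \<open>x\<close> only, this is the likelihood of \<open>\<tau> = r\<close> when the
  bridge is observed up to time \<open>s\<close>, where its value is \<open>x\<close>.\<close>
definition likelihood :: "real \<Rightarrow> real \<Rightarrow> real \<Rightarrow> real" where
  "likelihood s r x = Gamma r * rGamma (r - s) * (1 - x) powr (r - s - 1)"

lemma measurable_likelihood [measurable]:
  assumes [measurable]: "s \<in> borel_measurable N" "r \<in> borel_measurable N" "f \<in> borel_measurable N"
  shows "(\<lambda>z. likelihood (s z) (r z) (f z)) \<in> borel_measurable N"
  unfolding likelihood_def by measurable

lemma likelihood_pos: "0 \<le> s \<Longrightarrow> s < r \<Longrightarrow> x < 1 \<Longrightarrow> 0 < likelihood s r x"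
  by (auto simp: likelihood_def rGamma_inverse_Gamma intro!: mult_pos_pos Gamma_real_pos)

text \<open>The first factor is free of \<open>r\<close> and so cancels between numerator and
  denominator of Bayes' formula. The second still makes sense at \<open>s = 0\<close>, which lets
  \<open>t = 0\<close> be treated like every other time.\<close>

lemma beta_dens_eq_likelihood:
  "0 < s \<Longrightarrow> s < r \<Longrightarrow> beta_dens s r x = indicator {0<..<1} x * (x powr (s - 1) / Gamma s) * likelihood s r x"
  using Gamma_real_pos[of s] Gamma_real_pos[of "r - s"] Gamma_real_pos[of r]
  by (auto simp: beta_dens_def likelihood_def Beta_def rGamma_inverse_Gamma field_simps split: split_indicator)

lemma likelihood_nonneg: "0 \<le> s \<Longrightarrow> 0 \<le> indicator {s<..K} r * likelihood s r x"
  by (auto simp: likelihood_def rGamma_inverse_Gamma less_imp_le[OF Gamma_real_pos] split: split_indicator)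

lemma likelihood_tendsto:
  assumes "0 \<le> t" "t < r" "S \<longlonglongrightarrow> t" "X \<longlonglongrightarrow> x" "x < 1"
  shows "(\<lambda>n. likelihood (S n) r (X n)) \<longlonglongrightarrow> likelihood t r x"
proof -
  have "(\<lambda>n. rGamma (r - S n)) \<longlonglongrightarrow> rGamma (r - t)"
    using assms by (intro isCont_tendsto_compose[OF isCont_rGamma[OF continuous_ident]] tendsto_intros)
  then show ?thesis
    unfolding likelihood_def using assms by (intro tendsto_intros) auto
qed

text \<open>Two singularities threaten: the pole of \<open>Gamma\<close> as \<open>r\<close> tends
  to 0, and the exponent near -1 as \<open>r\<close> tends to \<open>s\<close>. Raising both Gamma
  arguments by 1 moves them into the compact interval from 1 to \<open>K + 1\<close> and leaves the
  factor \<open>(r - s) / r \<le> 1\<close>. Keeping \<open>x \<le> y < 1\<close> controls the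
  remaining \<open>1 / (1 - x)\<close>.\<close>

lemma likelihood_bound:
  fixes K y :: real
  assumes y: "y < 1"
  obtains C where "\<And>s r x. 0 \<le> s \<Longrightarrow> s < r \<Longrightarrow> r \<le> K \<Longrightarrow> 0 \<le> x \<Longrightarrow> x \<le> y \<Longrightarrow> likelihood s r x \<le> C"
proof -
  have "bounded (Gamma ` {1..K + 1})"
    by (intro compact_imp_bounded compact_continuous_image continuous_on_Gamma)
      (auto elim!: nonpos_Ints_cases)
  then obtain C1 where "\<forall>w\<in>Gamma ` {1..K + 1}. norm w \<le> C1"
    unfolding bounded_iff by blast
  then have C1: "\<bar>Gamma z\<bar> \<le> C1" if "z \<in> {1..K + 1}" for z
    using that by (metis imageI real_norm_def)
  have "bounded (rGamma ` {1..K + 1})"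
    by (intro compact_imp_bounded compact_continuous_image continuous_on_rGamma) auto
  then obtain C2 where "\<forall>w\<in>rGamma ` {1..K + 1}. norm w \<le> C2"
    unfolding bounded_iff by blast
  then have C2: "\<bar>rGamma z\<bar> \<le> C2" if "z \<in> {1..K + 1}" for z
    using that by (metis imageI real_norm_def)
  show ?thesis
  proof (rule that)
    fix s r x :: real assume *: "0 \<le> s" "s < r" "r \<le> K" "0 \<le> x" "x \<le> y"
    have "Gamma r = Gamma (r + 1) / r"
    proof -
      have "r \<notin> \<int>\<^sub>\<le>\<^sub>0" using * by (auto elim!: nonpos_Ints_cases)
      from Gamma_plus1[OF this] show ?thesis using * by simp
    qed
    moreover have "rGamma (r - s) = rGamma (r - s + 1) * (r - s)"
      using rGamma_plus1[of "r - s"] by (simp add: mult.commute)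
    ultimately have "Gamma r * rGamma (r - s) = Gamma (r + 1) * rGamma (r - s + 1) * ((r - s) / r)"
      by simp
    moreover have "(1 - x) powr (r - s - 1) = (1 - x) powr (r - s) / (1 - x)"
      using * y by (simp add: powr_diff)
    ultimately have "likelihood s r x = Gamma (r + 1) * rGamma (r - s + 1) * ((r - s) / r) * ((1 - x) powr (r - s) / (1 - x))"
      by (simp add: likelihood_def)
    also have "\<dots> \<le> C1 * C2 * 1 * (1 / (1 - y))"
    proof (intro mult_mono frac_le)
      show "Gamma (r + 1) \<le> C1" "rGamma (r - s + 1) \<le> C2"
        using C1[of "r + 1"] C2[of "r - s + 1"] * by auto
      have C12: "0 \<le> C1" "0 \<le> C2"
        using order_trans[OF abs_ge_zero C1[of "r + 1"]] order_trans[OF abs_ge_zero C2[of "r - s + 1"]] * by simp_all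
      then show "0 \<le> C1" "0 \<le> C1 * C2" "0 \<le> C1 * C2 * 1" by auto
      show "0 \<le> rGamma (r - s + 1)"
        using * Gamma_real_pos[of "r - s + 1"] by (auto simp: rGamma_inverse_Gamma)
      show "(1 - x) powr (r - s) \<le> 1"
        using * y by (intro powr_le1) auto
    qed (use * y in auto)
    finally show "likelihood s r x \<le> C1 * C2 * 1 * (1 / (1 - y))" .
  qed
qed

section \<open>Measurability of the path at a random time\<close>

lemma (in gamma_process) g_right_limit:
  assumes "\<omega> \<in> space M" "0 \<le> s" "X \<longlonglongrightarrow> s" "\<And>n. s < X n"
  shows "(\<lambda>n. g (X n) \<omega>) \<longlonglongrightarrow> g s \<omega>"
proof -
  have "filterlim X (at_right s) sequentially"
    using assms(3) assms(4)[THEN less_imp_neq, symmetric] assms(4) by (auto simp: filterlim_at)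
  with g_right_cont[OF assms(1,2)] show ?thesis
    unfolding continuous_within by (rule filterlim_compose)
qed

text \<open>Right-continuity allows the time to be rounded up to a countable grid. The measure
  \<open>N\<close> is left open because the result is needed both for \<open>M\<close> and for the
  smaller sigma-algebra generated by the process, against which \<open>\<tau>\<close> is
  independent.\<close>

lemma (in gamma_process) g_joint_measurable:
  assumes N: "space N = space M" "\<And>s. 0 \<le> s \<Longrightarrow> g s \<in> borel_measurable N"
  shows "(\<lambda>(r :: real, \<omega>). g (max 0 r) \<omega>) \<in> borel_measurable (borel \<Otimes>\<^sub>M N)"
proof (rule borel_measurable_LIMSEQ_real)
  \<comment> \<open>A grid point strictly to the right of \<open>max 0 r\<close>, at distance at
    most \<open>1 / (n + 1)\<close>; strictness is what \<open>g_right_limit\<close> asks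
    for.\<close>
  define q where "q n r = (real (nat \<lfloor>real (Suc n) * max 0 r\<rfloor>) + 1) / real (Suc n)" for n and r :: real
  fix n
  have "(\<lambda>p. g ((real (nat \<lfloor>real (Suc n) * max 0 (fst p)\<rfloor>) + 1) / real (Suc n)) (snd p)) \<in> borel_measurable (borel \<Otimes>\<^sub>M N)"
  proof (rule measurable_compose_countable[where f="\<lambda>i p. g ((real i + 1) / real (Suc n)) (snd p)"])
    show "(\<lambda>p. g ((real i + 1) / real (Suc n)) (snd p)) \<in> borel_measurable (borel \<Otimes>\<^sub>M N)" for i
      by (rule measurable_compose[OF measurable_snd N(2)]) auto
  qed measurable
  then show "(\<lambda>(r, \<omega>). g (q n r) \<omega>) \<in> borel_measurable (borel \<Otimes>\<^sub>M N)"
    by (simp add: q_def case_prod_beta')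
next
  define q where "q n r = (real (nat \<lfloor>real (Suc n) * max 0 r\<rfloor>) + 1) / real (Suc n)" for n and r :: real
  fix p :: "real \<times> 'a" assume "p \<in> space (borel \<Otimes>\<^sub>M N)"
  then obtain r \<omega> where p: "p = (r, \<omega>)" "\<omega> \<in> space M"
    using N by (cases p) (auto simp: space_pair_measure)
  define m where "m = max 0 r"
  have q1: "m < q n r" and q2: "q n r \<le> m + inverse (real (Suc n))" for n
  proof -
    have "real (nat \<lfloor>real (Suc n) * max 0 r\<rfloor>) = of_int \<lfloor>real (Suc n) * max 0 r\<rfloor>"
      by (intro of_nat_nat) auto
    then have q: "q n r = (real_of_int \<lfloor>real (Suc n) * m\<rfloor> + 1) / real (Suc n)"
      by (simp only: q_def m_def)
    have *: "real_of_int \<lfloor>real (Suc n) * m\<rfloor> \<le> real (Suc n) * m"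
      "real (Suc n) * m < real_of_int \<lfloor>real (Suc n) * m\<rfloor> + 1"
      by linarith+
    show "m < q n r"
      unfolding q using * by (subst pos_less_divide_eq) (auto simp: mult.commute)
    have "m + inverse (real (Suc n)) = (real (Suc n) * m + 1) / real (Suc n)"
      by (simp add: add_divide_distrib inverse_eq_divide del: of_nat_Suc)
    then show "q n r \<le> m + inverse (real (Suc n))"
      unfolding q using *(1) by (simp add: divide_right_mono del: of_nat_Suc)
  qed
  have "(\<lambda>n. q n r) \<longlonglongrightarrow> m"
  proof (rule tendsto_sandwich[of "\<lambda>_. m" _ _ "\<lambda>n. m + inverse (real (Suc n))"])
    show "(\<lambda>n. m + inverse (real (Suc n))) \<longlonglongrightarrow> m"
      using tendsto_add[OF tendsto_const LIMSEQ_inverse_real_of_nat, of m] by simp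
    show "(\<lambda>n. m) \<longlonglongrightarrow> m" by simp
  qed (use q1 q2 in \<open>auto intro!: always_eventually less_imp_le simp del: of_nat_Suc\<close>)
  then show "(\<lambda>n. (case p of (r, \<omega>) \<Rightarrow> g (q n r) \<omega>)) \<longlonglongrightarrow> (case p of (r, \<omega>) \<Rightarrow> g (max 0 r) \<omega>)"
    using p q1 unfolding m_def by (auto intro!: g_right_limit)
qed

lemma (in gamma_process) measurable_g_at [measurable]:
  assumes "f \<in> borel_measurable N" "w \<in> measurable N M"
  shows "(\<lambda>z. g (max 0 (f z)) (w z)) \<in> borel_measurable N"
  using measurable_compose[OF measurable_Pair[OF assms] g_joint_measurable[OF refl g_measurable]] by simp

lemma (in gamma_process) measurable_bridge_ratio [measurable]:
  assumes [measurable]: "f \<in> borel_measurable N" "w \<in> measurable N M" and "0 \<le> u" "0 \<le> s"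
  shows "(\<lambda>z. bridge_ratio u s (f z) (w z)) \<in> borel_measurable N"
proof -
  have [measurable]: "g u \<in> borel_measurable M" "g s \<in> borel_measurable M" using assms by auto
  have "bridge_ratio u s (f z) (w z) = (if f z \<le> u then 1 else (g u (w z) - g s (w z)) / (g (max 0 (f z)) (w z) - g s (w z)))" for z
    using assms by (auto simp: bridge_ratio_def max_def)
  then show ?thesis by simp
qed

section \<open>The bridge of random length\<close>

locale gamma_bridge = gamma_process +
  fixes \<tau> :: "'a \<Rightarrow> real"
  assumes tau_measurable [measurable]: "\<tau> \<in> borel_measurable M"
    and tau_pos: "\<omega> \<in> space M \<Longrightarrow> 0 < \<tau> \<omega>"
    and tau_indep: "indep_set (sigma_sets (space M) (gen_sets M \<tau>))
      (sigma_sets (space M) (\<Union>s\<in>{0..}. gen_sets M (g s)))"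
begin

abbreviation "\<zeta> \<equiv> zeta g \<tau>"

definition g_algebra :: "'a measure" where
  "g_algebra = sigma (space M) (\<Union>s\<in>{0..}. gen_sets M (g s))"

lemma space_g_algebra [simp]: "space g_algebra = space M"
  and sets_g_algebra: "sets g_algebra = sigma_sets (space M) (\<Union>s\<in>{0..}. gen_sets M (g s))"
  by (auto simp: g_algebra_def gen_sets_def intro!: sets_measure_of space_measure_of)

lemma g_measurable_g_algebra: "0 \<le> s \<Longrightarrow> g s \<in> borel_measurable g_algebra"
  by (rule measurableI) (auto simp: sets_g_algebra gen_sets_def intro!: sigma_sets.Basic)

text \<open>The whole path is represented by the identity map into the coarser sigma-algebra
  \<open>g_algebra\<close>, so that no path space is required to freeze \<open>\<tau>\<close> and
  integrate over the process.\<close>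

lemma tau_indep_rv: "indep_rv borel \<tau> g_algebra (\<lambda>\<omega>. \<omega>)"
proof -
  have sub: "sets g_algebra \<subseteq> sets M"
    unfolding sets_g_algebra by (rule sets.sigma_sets_subset) (auto simp: gen_sets_def)
  have "(\<lambda>\<omega>. \<omega>) \<in> measurable M g_algebra"
    by (rule measurableI) (use sub in \<open>auto simp: Int_absorb2 sets.sets_into_space\<close>)
  moreover have "emeasure M {\<omega>\<in>space M. \<tau> \<omega> \<in> A \<and> \<omega> \<in> B} =
      emeasure M {\<omega>\<in>space M. \<tau> \<omega> \<in> A} * emeasure M {\<omega>\<in>space M. \<omega> \<in> B}"
    if A: "A \<in> sets borel" and B: "B \<in> sets g_algebra" for A B
  proof -
    have BM: "B \<in> sets M" using B sub by auto
    have "\<tau> -` A \<inter> space M \<in> sigma_sets (space M) (gen_sets M \<tau>)"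
      using A by (auto simp: gen_sets_def)
    then have "prob ((\<tau> -` A \<inter> space M) \<inter> B) = prob (\<tau> -` A \<inter> space M) * prob B"
      using B unfolding sets_g_algebra by (rule indep_setD[OF tau_indep])
    moreover have "{\<omega>\<in>space M. \<tau> \<omega> \<in> A \<and> \<omega> \<in> B} = (\<tau> -` A \<inter> space M) \<inter> B"
      "{\<omega>\<in>space M. \<tau> \<omega> \<in> A} = \<tau> -` A \<inter> space M" "{\<omega>\<in>space M. \<omega> \<in> B} = B"
      using sets.sets_into_space[OF BM] by auto
    ultimately show ?thesis
      by (simp add: emeasure_eq_measure ennreal_mult[symmetric])
  qed
  ultimately show ?thesis by (simp add: indep_rv_def)
qed

lemma zeta_measurable [measurable]: "0 \<le> s \<Longrightarrow> \<zeta> s \<in> borel_measurable M"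
proof -
  assume s: "0 \<le> s"
  have "(\<lambda>\<omega>. g (max 0 (min s (\<tau> \<omega>))) \<omega> / g (max 0 (\<tau> \<omega>)) \<omega>) \<in> borel_measurable M"
    by measurable
  moreover have "\<zeta> s \<omega> = g (max 0 (min s (\<tau> \<omega>))) \<omega> / g (max 0 (\<tau> \<omega>)) \<omega>" if "\<omega> \<in> space M" for \<omega>
    using tau_pos[OF that] s by (simp add: zeta_def)
  ultimately show ?thesis by (simp cong: measurable_cong)
qed

lemma zeta_range: "\<omega> \<in> space M \<Longrightarrow> 0 \<le> s \<Longrightarrow> \<zeta> s \<omega> \<in> {0..1}"
  using tau_pos[of \<omega>] g_nonneg[of \<omega> "min s (\<tau> \<omega>)"] g_mono[of \<omega> "min s (\<tau> \<omega>)" "\<tau> \<omega>"]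
  by (auto simp: zeta_def divide_le_eq_1)

lemma Fzc_sets: "Fzc M g \<tau> s \<subseteq> sets M"
  unfolding Fzc_def by (rule sets.sigma_sets_subset) (auto simp: gen_sets_def)

text \<open>Independence freezes \<open>\<tau>\<close>, \<open>bridge_formula\<close> is applied to
  each frozen length, and Fubini moves the integral over \<open>\<tau>\<close> inside the one over
  \<open>x\<close>. The past factor is free of the length and stays outside.\<close>

lemma zeta_mixture_formula:
  fixes c :: "real \<times> real \<Rightarrow> ennreal"
  assumes s: "0 < s" "s < u" and V: "finite V" "V \<subseteq> {0..s}"
    and D: "\<And>v. v \<in> V \<Longrightarrow> D v \<in> sets borel"
    and c [measurable]: "c \<in> borel_measurable (borel \<Otimes>\<^sub>M borel)"
  shows "(\<integral>\<^sup>+\<omega>. (\<Prod>v\<in>V. indicator (D v) (\<zeta> v \<omega>)) * (indicator {s<..K} (\<tau> \<omega>) * c (\<zeta> s \<omega>, \<zeta> u \<omega>)) \<partial>M) =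
    (\<integral>\<^sup>+x. (\<integral>\<^sup>+\<omega>. (\<Prod>v\<in>V. indicator (D v) (g v \<omega> / g s \<omega> * x)) \<partial>M) *
      ennreal (indicator {0<..<1} x * (x powr (s - 1) / Gamma s)) *
      (\<integral>\<^sup>+\<omega>. ennreal (indicator {s<..K} (\<tau> \<omega>) * likelihood s (\<tau> \<omega>) x) *
        (\<integral>\<^sup>+\<omega>'. c (x, x + (1 - x) * bridge_ratio u s (\<tau> \<omega>) \<omega>') \<partial>M) \<partial>M) \<partial>lborel)"
proof -
  have u: "0 \<le> u" "0 \<le> s" using s by auto
  have gV [measurable]: "g v \<in> borel_measurable M" if "v \<in> V" for v
    using that V by (intro g_measurable) auto
  have [measurable]: "g s \<in> borel_measurable M" using s by auto
  define f where "f = (\<lambda>(r, \<omega>). (\<Prod>v\<in>V. indicator (D v) (g v \<omega> / g (max 0 r) \<omega>)) * (indicator {s<..K} r *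
      c (g s \<omega> / g (max 0 r) \<omega>, g (max 0 (min u r)) \<omega> / g (max 0 r) \<omega>)))"
  have f [measurable]: "f \<in> borel_measurable (borel \<Otimes>\<^sub>M g_algebra)"
  proof -
    have j: "(\<lambda>z. g (max 0 (fst z)) (snd z)) \<in> borel_measurable (borel \<Otimes>\<^sub>M g_algebra)"
      using g_joint_measurable[OF space_g_algebra g_measurable_g_algebra] by (simp add: case_prod_beta')
    then have [measurable]: "(\<lambda>z. g (max 0 (k z)) (snd z)) \<in> borel_measurable (borel \<Otimes>\<^sub>M g_algebra)"
      if "k \<in> borel_measurable (borel \<Otimes>\<^sub>M g_algebra)" for k
      using measurable_compose[OF measurable_Pair[OF that measurable_snd] j] by simp
    have [measurable]: "g s \<in> borel_measurable g_algebra" "\<And>v. v \<in> V \<Longrightarrow> g v \<in> borel_measurable g_algebra"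
      using s V by (auto intro!: g_measurable_g_algebra)
    show ?thesis
      unfolding f_def case_prod_beta' using D by measurable
  qed
  define A where "A x = (\<integral>\<^sup>+\<omega>. (\<Prod>v\<in>V. indicator (D v) (g v \<omega> / g s \<omega> * x)) \<partial>M :: ennreal)" for x
  have A [measurable]: "A \<in> borel_measurable borel"
    unfolding A_def using D by measurable
  define C where "C r x = (\<integral>\<^sup>+\<omega>. c (x, x + (1 - x) * bridge_ratio u s r \<omega>) \<partial>M)" for r x
  have C [measurable]: "(\<lambda>z. C (p z) (q z)) \<in> borel_measurable N"
    if [measurable]: "p \<in> borel_measurable N" "q \<in> borel_measurable N" for N :: "'z measure" and p q
    unfolding C_def using u by measurable
  interpret MB: pair_sigma_finite M lborel ..
  \<comment> \<open>On \<open>s < \<tau>\<close> the past times \<open>v \<le> s\<close> are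
    unaffected by stopping at \<open>\<tau>\<close>; elsewhere the indicator makes both sides
    vanish.\<close>
  have "(\<integral>\<^sup>+\<omega>. (\<Prod>v\<in>V. indicator (D v) (\<zeta> v \<omega>)) * (indicator {s<..K} (\<tau> \<omega>) * c (\<zeta> s \<omega>, \<zeta> u \<omega>)) \<partial>M) = (\<integral>\<^sup>+\<omega>. f (\<tau> \<omega>, \<omega>) \<partial>M)"
  proof (rule nn_integral_cong)
    fix \<omega> assume "\<omega> \<in> space M"
    then have \<tau>: "0 < \<tau> \<omega>" by (rule tau_pos)
    show "(\<Prod>v\<in>V. indicator (D v) (\<zeta> v \<omega>)) * (indicator {s<..K} (\<tau> \<omega>) * c (\<zeta> s \<omega>, \<zeta> u \<omega>)) = f (\<tau> \<omega>, \<omega>)"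
    proof (cases "s < \<tau> \<omega>")
      case True
      then have "(\<Prod>v\<in>V. indicator (D v) (\<zeta> v \<omega>) :: ennreal) = (\<Prod>v\<in>V. indicator (D v) (g v \<omega> / g (max 0 (\<tau> \<omega>)) \<omega>))"
        using V \<tau> by (intro prod.cong) (auto simp: zeta_def min_def)
      then show ?thesis
        using True s by (simp add: f_def zeta_def min_absorb1)
    qed (simp add: f_def)
  qed
  also have "\<dots> = (\<integral>\<^sup>+\<omega>. \<integral>\<^sup>+\<omega>'. f (\<tau> \<omega>, \<omega>') \<partial>M \<partial>M)"
    by (rule indep_rv_nn_integral[OF tau_indep_rv f])
  also have "\<dots> = (\<integral>\<^sup>+\<omega>. \<integral>\<^sup>+x. A x * ennreal (indicator {0<..<1} x * (x powr (s - 1) / Gamma s)) *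
      (ennreal (indicator {s<..K} (\<tau> \<omega>) * likelihood s (\<tau> \<omega>) x) * C (\<tau> \<omega>) x) \<partial>lborel \<partial>M)"
  proof (rule nn_integral_cong)
    fix \<omega> assume \<omega>: "\<omega> \<in> space M"
    show "(\<integral>\<^sup>+\<omega>'. f (\<tau> \<omega>, \<omega>') \<partial>M) = (\<integral>\<^sup>+x. A x * ennreal (indicator {0<..<1} x * (x powr (s - 1) / Gamma s)) *
      (ennreal (indicator {s<..K} (\<tau> \<omega>) * likelihood s (\<tau> \<omega>) x) * C (\<tau> \<omega>) x) \<partial>lborel)"
    proof (cases "\<tau> \<omega> \<in> {s<..K}")
      case True
      have "(\<integral>\<^sup>+\<omega>'. f (\<tau> \<omega>, \<omega>') \<partial>M) = (\<integral>\<^sup>+\<omega>'. (\<Prod>v\<in>V. indicator (D v) (g v \<omega>' / g (\<tau> \<omega>) \<omega>')) *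
          c (g s \<omega>' / g (\<tau> \<omega>) \<omega>', g (min u (\<tau> \<omega>)) \<omega>' / g (\<tau> \<omega>) \<omega>') \<partial>M)"
        using True s by (simp add: f_def max_def min_def)
      also have "\<dots> = (\<integral>\<^sup>+x. ennreal (beta_dens s (\<tau> \<omega>) x) * (A x * C (\<tau> \<omega>) x) \<partial>lborel)"
        unfolding A_def C_def using True s V D by (intro bridge_formula) auto
      also have "\<dots> = (\<integral>\<^sup>+x. A x * ennreal (indicator {0<..<1} x * (x powr (s - 1) / Gamma s)) *
          (ennreal (indicator {s<..K} (\<tau> \<omega>) * likelihood s (\<tau> \<omega>) x) * C (\<tau> \<omega>) x) \<partial>lborel)"
      proof (intro nn_integral_cong)
        fix x :: real
        have "ennreal (beta_dens s (\<tau> \<omega>) x) = ennreal (indicator {0<..<1} x * (x powr (s - 1) / Gamma s)) * ennreal (likelihood s (\<tau> \<omega>) x)"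
          using True s likelihood_pos[of s "\<tau> \<omega>" x] Gamma_real_pos[of s]
          by (cases "x < 1") (simp_all add: beta_dens_eq_likelihood ennreal_mult[symmetric])
        then show "ennreal (beta_dens s (\<tau> \<omega>) x) * (A x * C (\<tau> \<omega>) x) =
          A x * ennreal (indicator {0<..<1} x * (x powr (s - 1) / Gamma s)) *
          (ennreal (indicator {s<..K} (\<tau> \<omega>) * likelihood s (\<tau> \<omega>) x) * C (\<tau> \<omega>) x)"
          using True by (simp only: indicator_simps mult_1 mult_ac)
      qed
      finally show ?thesis .
    qed (auto simp: f_def)
  qed
  also have "\<dots> = (\<integral>\<^sup>+x. \<integral>\<^sup>+\<omega>. A x * ennreal (indicator {0<..<1} x * (x powr (s - 1) / Gamma s)) *
      (ennreal (indicator {s<..K} (\<tau> \<omega>) * likelihood s (\<tau> \<omega>) x) * C (\<tau> \<omega>) x) \<partial>M \<partial>lborel)"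
    by (rule MB.Fubini'[symmetric]) measurable
  also have "\<dots> = (\<integral>\<^sup>+x. A x * ennreal (indicator {0<..<1} x * (x powr (s - 1) / Gamma s)) *
      (\<integral>\<^sup>+\<omega>. ennreal (indicator {s<..K} (\<tau> \<omega>) * likelihood s (\<tau> \<omega>) x) * C (\<tau> \<omega>) x \<partial>M) \<partial>lborel)"
    by (intro nn_integral_cong nn_integral_cmult) measurable
  finally show ?thesis
    by (simp add: A_def C_def)
qed

end

section \<open>The Markov property for the raw filtration\<close>

text \<open>The range of \<open>h\<close> permits nonnegative integrals and the dominating constant
  1; continuity is what the right limit needs. Clipped powers will be substituted for
  \<open>h\<close>.\<close>

locale gamma_bridge_test = gamma_bridge +
  fixes u :: real and h :: "real \<Rightarrow> real"
  assumes u_pos: "0 < u" and h_cont: "continuous_on UNIV h"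
    and h_nonneg: "\<And>x. 0 \<le> h x" and h_le_1: "\<And>x. h x \<le> 1"
begin

lemma h_measurable [measurable]: "h \<in> borel_measurable borel"
  using h_cont by (rule borel_measurable_continuous_onI)

text \<open>The conditional expectation of \<open>h (\<zeta> u)\<close> given \<open>\<tau> = r\<close> and \<open>\<zeta> s = x\<close>, for \<open>s < r\<close>.\<close>
definition bridge_mean :: "real \<Rightarrow> real \<Rightarrow> real \<Rightarrow> real" where
  "bridge_mean s r x = (\<integral>\<omega>. h (x + (1 - x) * bridge_ratio u s r \<omega>) \<partial>M)"

definition post_num :: "real \<Rightarrow> real \<Rightarrow> real \<Rightarrow> real" where
  "post_num K s x = (\<integral>\<omega>. indicator {s<..K} (\<tau> \<omega>) * (likelihood s (\<tau> \<omega>) x * bridge_mean s (\<tau> \<omega>) x) \<partial>M)"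

definition post_den :: "real \<Rightarrow> real \<Rightarrow> real \<Rightarrow> real" where
  "post_den K s x = (\<integral>\<omega>. indicator {s<..K} (\<tau> \<omega>) * likelihood s (\<tau> \<omega>) x \<partial>M)"

text \<open>Bayes' formula for the law of \<open>\<tau>\<close> conditioned to lie in \<open>{s<..K}\<close>; the truncation at \<open>K\<close> keeps
  the likelihood bounded.\<close>
definition post_mean :: "real \<Rightarrow> real \<Rightarrow> real \<Rightarrow> real" where
  "post_mean K s x = post_num K s x / post_den K s x"

lemma measurable_bridge_mean [measurable]:
  assumes [measurable]: "f \<in> borel_measurable N" "k \<in> borel_measurable N" and s: "0 \<le> s"
  shows "(\<lambda>z. bridge_mean s (f z) (k z)) \<in> borel_measurable N"
  unfolding bridge_mean_def using s u_pos[THEN less_imp_le] by measurable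

lemma bridge_mean_range:
  assumes "0 \<le> s"
  shows "0 \<le> bridge_mean s r x" "bridge_mean s r x \<le> 1"
    "(\<integral>\<^sup>+\<omega>. ennreal (h (x + (1 - x) * bridge_ratio u s r \<omega>)) \<partial>M) = ennreal (bridge_mean s r x)"
proof -
  have [measurable]: "bridge_ratio u s r \<in> borel_measurable M"
    using assms u_pos[THEN less_imp_le] by measurable
  have int: "integrable M (\<lambda>\<omega>. h (x + (1 - x) * bridge_ratio u s r \<omega>))"
    using h_nonneg h_le_1 by (intro integrable_const_bound[where B=1]) auto
  show "0 \<le> bridge_mean s r x"
    unfolding bridge_mean_def by (intro Bochner_Integration.integral_nonneg h_nonneg)
  have "bridge_mean s r x \<le> (\<integral>\<omega>. 1 \<partial>M)"
    unfolding bridge_mean_def using int by (intro integral_mono h_le_1) auto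
  then show "bridge_mean s r x \<le> 1" by (simp add: prob_space)
  show "(\<integral>\<^sup>+\<omega>. ennreal (h (x + (1 - x) * bridge_ratio u s r \<omega>)) \<partial>M) = ennreal (bridge_mean s r x)"
    unfolding bridge_mean_def using int h_nonneg by (intro nn_integral_eq_integral) auto
qed

lemma post_mean_measurable [measurable]: "0 \<le> s \<Longrightarrow> post_mean K s \<in> borel_measurable borel"
  unfolding post_mean_def[abs_def] post_num_def post_den_def by measurable

lemma post_integrable:
  assumes "0 \<le> s" "0 \<le> x" "x < 1"
  shows "integrable M (\<lambda>\<omega>. indicator {s<..K} (\<tau> \<omega>) * likelihood s (\<tau> \<omega>) x)"
proof -
  obtain C where C: "\<And>s r x'. 0 \<le> s \<Longrightarrow> s < r \<Longrightarrow> r \<le> K \<Longrightarrow> 0 \<le> x' \<Longrightarrow> x' \<le> x \<Longrightarrow> likelihood s r x' \<le> C"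
    using likelihood_bound[OF assms(3)] by metis
  have "norm (indicator {s<..K} (\<tau> \<omega>) * likelihood s (\<tau> \<omega>) x) \<le> \<bar>C\<bar>" for \<omega>
    using C[of s "\<tau> \<omega>" x] likelihood_nonneg[OF assms(1), of K "\<tau> \<omega>" x] assms by (auto split: split_indicator)
  then show ?thesis by (intro integrable_const_bound[where B="\<bar>C\<bar>"]) auto
qed

lemma post_num_le: 
  assumes s: "0 \<le> s" and int: "integrable M (\<lambda>\<omega>. indicator {s<..K} (\<tau> \<omega>) * likelihood s (\<tau> \<omega>) x)"
  shows "integrable M (\<lambda>\<omega>. indicator {s<..K} (\<tau> \<omega>) * (likelihood s (\<tau> \<omega>) x * bridge_mean s (\<tau> \<omega>) x))"
    and "post_num K s x \<le> post_den K s x"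
proof -
  have le: "indicator {s<..K} (\<tau> \<omega>) * (likelihood s (\<tau> \<omega>) x * bridge_mean s (\<tau> \<omega>) x) \<le>
      indicator {s<..K} (\<tau> \<omega>) * likelihood s (\<tau> \<omega>) x" for \<omega>
    unfolding mult.assoc[symmetric]
    by (rule mult_left_le[OF bridge_mean_range(2)[OF s] likelihood_nonneg[OF s]])
  have nn: "0 \<le> indicator {s<..K} (\<tau> \<omega>) * (likelihood s (\<tau> \<omega>) x * bridge_mean s (\<tau> \<omega>) x)" for \<omega>
    unfolding mult.assoc[symmetric]
    by (rule mult_nonneg_nonneg[OF likelihood_nonneg[OF s] bridge_mean_range(1)[OF s]])
  show i: "integrable M (\<lambda>\<omega>. indicator {s<..K} (\<tau> \<omega>) * (likelihood s (\<tau> \<omega>) x * bridge_mean s (\<tau> \<omega>) x))"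
  proof (rule Bochner_Integration.integrable_bound[OF int])
    show "AE \<omega> in M. norm (indicator {s<..K} (\<tau> \<omega>) * (likelihood s (\<tau> \<omega>) x * bridge_mean s (\<tau> \<omega>) x)) \<le>
        norm (indicator {s<..K} (\<tau> \<omega>) * likelihood s (\<tau> \<omega>) x)"
      using le nn likelihood_nonneg[OF s, of K _ x] by (intro AE_I2) (auto simp: abs_of_nonneg simp del: abs_mult)
  qed (use s in measurable)
  show "post_num K s x \<le> post_den K s x"
    unfolding post_num_def post_den_def using i int le by (intro integral_mono)
qed

lemma post_num_nonneg: "0 \<le> s \<Longrightarrow> 0 \<le> post_num K s x"
  unfolding post_num_def mult.assoc[symmetric]
  by (intro Bochner_Integration.integral_nonneg mult_nonneg_nonneg[OF likelihood_nonneg bridge_mean_range(1)])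

lemma post_den_nonneg: "0 \<le> s \<Longrightarrow> 0 \<le> post_den K s x"
  unfolding post_den_def by (intro Bochner_Integration.integral_nonneg likelihood_nonneg)

lemma post_mean_range:
  assumes "0 \<le> s"
  shows "0 \<le> post_mean K s x" "post_mean K s x \<le> 1"
proof -
  show "0 \<le> post_mean K s x"
    using assms by (simp add: post_mean_def post_num_nonneg post_den_nonneg)
  show "post_mean K s x \<le> 1"
  proof (cases "integrable M (\<lambda>\<omega>. indicator {s<..K} (\<tau> \<omega>) * likelihood s (\<tau> \<omega>) x)")
    case True
    then show ?thesis
      using post_num_le(2)[OF assms True] post_den_nonneg[OF assms, of K x] post_num_nonneg[OF assms, of K x]
      by (auto simp: post_mean_def divide_le_eq_1)
  next
    case False
    \<comment> \<open>Without integrability the Bochner integral is 0 by convention and so is the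
      quotient; the range therefore holds for every real \<open>x\<close>, also outside the unit
      interval.\<close>
    then have "post_den K s x = 0" unfolding post_den_def by (rule not_integrable_integral_eq)
    then show ?thesis by (simp add: post_mean_def)
  qed
qed

text \<open>Bayes' formula in integrated form. The mixture formula is applied to both sides, once
  with \<open>h\<close> of the second coordinate and once with \<open>post_mean\<close> of the
  first; for each \<open>x\<close> the inner integrals agree because numerator equals denominator
  times quotient.\<close>

lemma markov_cylinder:
  assumes s: "0 < s" "s < u" and V: "finite V" "V \<subseteq> {0..s}"
    and D: "\<And>v. v \<in> V \<Longrightarrow> D v \<in> sets borel"
  shows "(\<integral>\<^sup>+\<omega>. (\<Prod>v\<in>V. indicator (D v) (\<zeta> v \<omega>)) * (indicator {s<..K} (\<tau> \<omega>) * ennreal (h (\<zeta> u \<omega>))) \<partial>M) =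
    (\<integral>\<^sup>+\<omega>. (\<Prod>v\<in>V. indicator (D v) (\<zeta> v \<omega>)) * (indicator {s<..K} (\<tau> \<omega>) * ennreal (post_mean K s (\<zeta> s \<omega>))) \<partial>M)"
proof -
  have s0: "0 \<le> s" using s by simp
  note [measurable] = post_mean_measurable[OF s0]
  have inner: "(\<integral>\<^sup>+\<omega>. ennreal (indicator {s<..K} (\<tau> \<omega>) * likelihood s (\<tau> \<omega>) x) * ennreal (bridge_mean s (\<tau> \<omega>) x) \<partial>M) =
      (\<integral>\<^sup>+\<omega>. ennreal (indicator {s<..K} (\<tau> \<omega>) * likelihood s (\<tau> \<omega>) x) * ennreal (post_mean K s x) \<partial>M)"
    if x: "x \<in> {0<..<1}" for x
  proof -
    have int: "integrable M (\<lambda>\<omega>. indicator {s<..K} (\<tau> \<omega>) * likelihood s (\<tau> \<omega>) x)"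
      using x s0 by (intro post_integrable) auto
    have "(\<integral>\<^sup>+\<omega>. ennreal (indicator {s<..K} (\<tau> \<omega>) * likelihood s (\<tau> \<omega>) x) * ennreal (bridge_mean s (\<tau> \<omega>) x) \<partial>M) =
        (\<integral>\<^sup>+\<omega>. ennreal (indicator {s<..K} (\<tau> \<omega>) * (likelihood s (\<tau> \<omega>) x * bridge_mean s (\<tau> \<omega>) x)) \<partial>M)"
      by (intro nn_integral_cong, subst ennreal_mult[symmetric])
        (auto simp: likelihood_nonneg[OF s0] bridge_mean_range[OF s0] mult.assoc)
    also have "\<dots> = ennreal (post_num K s x)"
      unfolding post_num_def using post_num_le(1)[OF s0 int]
      by (intro nn_integral_eq_integral)
        (auto simp: mult.assoc[symmetric] intro!: mult_nonneg_nonneg[OF likelihood_nonneg] bridge_mean_range s0)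
    \<comment> \<open>A vanishing denominator forces a vanishing numerator, so 0 / 0 = 0 does no
      harm.\<close>
    also have "post_num K s x = post_den K s x * post_mean K s x"
      using post_num_le(2)[OF s0 int] post_num_nonneg[OF s0, of K x]
      by (cases "post_den K s x = 0") (auto simp: post_mean_def)
    also have "ennreal (post_den K s x * post_mean K s x) = ennreal (post_den K s x) * ennreal (post_mean K s x)"
      using post_den_nonneg[OF s0] post_mean_range[OF s0] by (intro ennreal_mult) auto
    also have "ennreal (post_den K s x) = (\<integral>\<^sup>+\<omega>. ennreal (indicator {s<..K} (\<tau> \<omega>) * likelihood s (\<tau> \<omega>) x) \<partial>M)"
      unfolding post_den_def using int likelihood_nonneg[OF s0]
      by (intro nn_integral_eq_integral[symmetric]) auto
    finally show ?thesis by (simp add: nn_integral_multc)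
  qed
  have "(\<integral>\<^sup>+\<omega>. (\<Prod>v\<in>V. indicator (D v) (\<zeta> v \<omega>)) * (indicator {s<..K} (\<tau> \<omega>) * (\<lambda>p. ennreal (h (snd p))) (\<zeta> s \<omega>, \<zeta> u \<omega>)) \<partial>M) =
    (\<integral>\<^sup>+\<omega>. (\<Prod>v\<in>V. indicator (D v) (\<zeta> v \<omega>)) * (indicator {s<..K} (\<tau> \<omega>) * (\<lambda>p. ennreal (post_mean K s (fst p))) (\<zeta> s \<omega>, \<zeta> u \<omega>)) \<partial>M)"
    by (subst (1 2) zeta_mixture_formula[OF s V D]; (assumption | measurable)?)
      (auto intro!: nn_integral_cong simp: bridge_mean_range(3)[OF s0] emeasure_space_1 inner split: split_indicator)
  then show ?thesis by simp
qed

text \<open>Both sides are finite measures of \<open>A\<close>. They agree on cylinders by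
  \<open>markov_cylinder\<close> and trivially on null sets, and Dynkin's argument extends this to
  the completed sigma-algebra.\<close>

lemma markov_level:
  assumes s: "0 < s" "s < u" and A: "A \<in> Fzc M g \<tau> s"
  shows "(\<integral>\<^sup>+\<omega>. indicator A \<omega> * (indicator {s<..K} (\<tau> \<omega>) * ennreal (h (\<zeta> u \<omega>))) \<partial>M) =
    (\<integral>\<^sup>+\<omega>. indicator A \<omega> * (indicator {s<..K} (\<tau> \<omega>) * ennreal (post_mean K s (\<zeta> s \<omega>))) \<partial>M)"
proof -
  have s0: "0 \<le> s" using s by simp
  note [measurable] = post_mean_measurable[OF s0]
  have [measurable]: "\<zeta> u \<in> borel_measurable M" "\<zeta> s \<in> borel_measurable M" using s by auto
  define m1 where "m1 = density M (\<lambda>\<omega>. indicator {s<..K} (\<tau> \<omega>) * ennreal (h (\<zeta> u \<omega>)))"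
  define m2 where "m2 = density M (\<lambda>\<omega>. indicator {s<..K} (\<tau> \<omega>) * ennreal (post_mean K s (\<zeta> s \<omega>)))"
  have m1: "emeasure m1 B = (\<integral>\<^sup>+\<omega>. indicator B \<omega> * (indicator {s<..K} (\<tau> \<omega>) * ennreal (h (\<zeta> u \<omega>))) \<partial>M)"
    and m2: "emeasure m2 B = (\<integral>\<^sup>+\<omega>. indicator B \<omega> * (indicator {s<..K} (\<tau> \<omega>) * ennreal (post_mean K s (\<zeta> s \<omega>))) \<partial>M)"
    if "B \<in> sets M" for B
    using that by (simp_all add: m1_def m2_def emeasure_density mult.commute)
  define cyl where "cyl V D = {\<omega>\<in>space M. \<forall>v\<in>V. \<zeta> v \<omega> \<in> D v}" for V :: "real set" and D :: "real \<Rightarrow> real set"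
  define C where "C = {cyl V D | V D. finite V \<and> V \<subseteq> {0..s} \<and> (\<forall>v. D v \<in> sets borel)}"
  have cyl_sets: "cyl V D \<in> sets M" if "finite V" "V \<subseteq> {0..s}" "\<forall>v. D v \<in> sets borel" for V D
  proof -
    have [measurable]: "\<zeta> v \<in> borel_measurable M" if "v \<in> V" for v
      using that \<open>V \<subseteq> {0..s}\<close> by auto
    show ?thesis
      unfolding cyl_def using that by measurable
  qed
  have C_sets: "C \<subseteq> sets M" using cyl_sets by (auto simp: C_def)
  have C_Int: "B \<inter> B' \<in> C" if BB: "B \<in> C" "B' \<in> C" for B B'
  proof -
    obtain V D V' D' where *: "B = cyl V D" "B' = cyl V' D'" "finite V" "finite V'" "V \<subseteq> {0..s}" "V' \<subseteq> {0..s}"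
      "\<forall>v. D v \<in> sets borel" "\<forall>v. D' v \<in> sets borel"
      using BB by (auto simp: C_def)
    \<comment> \<open>Coordinates constrained in only one of the two cylinders are padded with
      \<open>UNIV\<close>.\<close>
    have "B \<inter> B' = cyl (V \<union> V') (\<lambda>v. (if v \<in> V then D v else UNIV) \<inter> (if v \<in> V' then D' v else UNIV))"
      using * by (auto simp: cyl_def)
    moreover have "\<forall>v. (if v \<in> V then D v else UNIV) \<inter> (if v \<in> V' then D' v else UNIV) \<in> sets borel"
      using * by auto
    ultimately show ?thesis using * unfolding C_def by blast
  qed
  have gen: "A \<in> sigma_sets (space M) (C \<union> null_sets M)"
  proof -
    have "(\<Union>v\<in>{0..s}. gen_sets M (\<zeta> v)) \<subseteq> C"
    proof safe
      fix v B assume v: "v \<in> {0..s}" and "B \<in> gen_sets M (\<zeta> v)"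
      then obtain E where E: "E \<in> sets borel" "B = \<zeta> v -` E \<inter> space M" by (auto simp: gen_sets_def)
      have "B = cyl {v} (\<lambda>_. E)" using E by (auto simp: cyl_def)
      then show "B \<in> C" using v E unfolding C_def by blast
    qed
    then have "Fzc M g \<tau> s \<subseteq> sigma_sets (space M) (C \<union> null_sets M)"
      unfolding Fzc_def by (intro sigma_sets_mono') auto
    then show ?thesis using A by auto
  qed
  \<comment> \<open>Intersecting a null set with any measurable set gives a null set, so completion
    does not spoil stability.\<close>
  have stable: "Int_stable (C \<union> null_sets M)"
    using C_Int C_sets by (intro Int_stableI) (auto intro: null_set_Int1 null_set_Int2)
  have closed: "C \<union> null_sets M \<subseteq> Pow (space M)"
    using order_trans[OF _ sets.space_closed, of "C \<union> null_sets M" M] C_sets by auto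
  have C_eq: "emeasure m1 B = emeasure m2 B" if BC: "B \<in> C" for B
  proof -
    obtain V D where *: "B = cyl V D" "finite V" "V \<subseteq> {0..s}" "\<forall>v. D v \<in> sets borel"
      using BC by (auto simp: C_def)
    have ind: "indicator B \<omega> = (\<Prod>v\<in>V. indicator (D v) (\<zeta> v \<omega>) :: ennreal)" if \<omega>: "\<omega> \<in> space M" for \<omega>
    proof (cases "\<omega> \<in> B")
      case False
      then obtain v where "v \<in> V" "\<zeta> v \<omega> \<notin> D v" using * \<omega> by (auto simp: cyl_def)
      then show ?thesis using False * by (subst prod_zero) (auto split: split_indicator)
    qed (auto simp: * cyl_def)
    have "B \<in> sets M" using BC C_sets by auto
    then show ?thesis
      using markov_cylinder[OF s *(2,3), of D K] *(4) by (simp add: m1 m2 ind cong: nn_integral_cong)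
  qed
  have null_eq: "emeasure m1 B = emeasure m2 B" if "B \<in> null_sets M" for B
  proof -
    have BM: "B \<in> sets M" and notB: "AE \<omega> in M. \<omega> \<notin> B" using that by (auto intro: AE_not_in)
    show ?thesis
      unfolding m1[OF BM] m2[OF BM]
      by (rule nn_integral_cong_AE) (use notB in eventually_elim, simp)
  qed
  from stable closed gen have "A \<in> sets M \<and> emeasure m1 A = emeasure m2 A"
  proof (induction A rule: sigma_sets_induct_disjoint)
    case (basic A)
    then show ?case using C_sets C_eq null_eq by auto
  next
    case (compl A)
    \<comment> \<open>The cylinder without constraints supplies equality of the total masses, needed
      for complements.\<close>
    have "space M \<in> C"
      unfolding C_def cyl_def by (auto intro!: exI[of _ "{}"])
    then have total: "emeasure m1 (space M) = emeasure m2 (space M)" by (rule C_eq)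
    have "emeasure m1 (space M) \<le> (\<integral>\<^sup>+\<omega>. 1 \<partial>M)"
      unfolding m1[OF sets.top] using h_le_1
      by (intro nn_integral_mono) (auto simp: ennreal_le_1 split: split_indicator)
    then have fin: "emeasure m1 (space M) \<noteq> \<infinity>" by (auto simp: emeasure_space_1 top_unique)
    have sp: "space m1 = space M" "space m2 = space M" "sets m1 = sets M" "sets m2 = sets M"
      by (simp_all add: m1_def m2_def)
    have AM: "A \<in> sets M" and Aeq: "emeasure m1 A = emeasure m2 A" using compl by auto
    have finA: "emeasure m1 A \<noteq> \<infinity>" "emeasure m2 A \<noteq> \<infinity>"
      using fin emeasure_space[of m1 A] Aeq by (auto simp: sp top_unique)
    have "emeasure m1 (space m1 - A) = emeasure m2 (space m2 - A)"
      using AM finA by (subst (1 2) emeasure_compl) (auto simp: sp total Aeq)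
    then show ?case using AM by (auto simp: sp)
  next
    case (union A)
    then have "range A \<subseteq> sets m1" "range A \<subseteq> sets m2" by (auto simp: m1_def m2_def)
    with union have "emeasure m1 (\<Union>i. A i) = emeasure m2 (\<Union>i. A i)"
      by (simp add: suminf_emeasure[symmetric])
    then show ?case using union by auto
  qed simp_all
  then show ?thesis using m1[of A] m2[of A] by simp
qed

section \<open>Right limits\<close>


text \<open>Right-continuity of the path at \<open>t\<close> moves the share to its limit, the
  limiting denominator \<open>g r - g t\<close> being almost surely positive; bounded convergence
  does the rest.\<close>

lemma bridge_mean_tendsto:
  assumes t: "0 \<le> t" "t < r" and S: "S \<longlonglongrightarrow> t" "\<And>n. t < S n" and X: "X \<longlonglongrightarrow> x"
  shows "(\<lambda>n. bridge_mean (S n) r (X n)) \<longlonglongrightarrow> bridge_mean t r x"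
proof -
  have S0: "0 \<le> S n" for n using S(2)[of n] t by simp
  note u0 = u_pos[THEN less_imp_le]
  show ?thesis
    unfolding bridge_mean_def
  proof (rule integral_dominated_convergence[where w="\<lambda>_. 1"])
    show "(\<lambda>\<omega>. h (x + (1 - x) * bridge_ratio u t r \<omega>)) \<in> borel_measurable M"
      using u0 t(1) by measurable
    show "(\<lambda>\<omega>. h (X n + (1 - X n) * bridge_ratio u (S n) r \<omega>)) \<in> borel_measurable M" for n
      using u0 S0[of n] by measurable
    show "AE \<omega> in M. (\<lambda>n. h (X n + (1 - X n) * bridge_ratio u (S n) r \<omega>)) \<longlonglongrightarrow> h (x + (1 - x) * bridge_ratio u t r \<omega>)"
      using AE_g_strict_mono AE_space
    proof eventually_elim
      case (elim \<omega>)
      have "g t \<omega> < g r \<omega>" using elim t by auto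
      moreover have "(\<lambda>n. g (S n) \<omega>) \<longlonglongrightarrow> g t \<omega>"
        using elim t S by (intro g_right_limit) auto
      ultimately have "(\<lambda>n. bridge_ratio u (S n) r \<omega>) \<longlonglongrightarrow> bridge_ratio u t r \<omega>"
        unfolding bridge_ratio_def by (auto intro!: tendsto_intros)
      then have "(\<lambda>n. X n + (1 - X n) * bridge_ratio u (S n) r \<omega>) \<longlonglongrightarrow> x + (1 - x) * bridge_ratio u t r \<omega>"
        by (intro tendsto_intros X)
      moreover have "isCont h z" for z
        using h_cont by (simp add: continuous_on_eq_continuous_at)
      ultimately show ?case by (rule isCont_tendsto_compose[rotated])
    qed
    show "AE \<omega> in M. norm (h (X n + (1 - X n) * bridge_ratio u (S n) r \<omega>)) \<le> 1" for n
      using h_nonneg h_le_1 by auto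
  qed simp
qed

text \<open>Numerator and denominator converge separately by dominated convergence, with the
  constant from \<open>likelihood_bound\<close>; the limiting denominator is assumed nonzero for the
  quotient.\<close>

lemma post_mean_tendsto:
  assumes t: "0 \<le> t" and S: "S \<longlonglongrightarrow> t" "\<And>n. t < S n"
    and X: "X \<longlonglongrightarrow> x" "\<And>n. 0 \<le> X n" and x: "x < 1"
    and den: "post_den K t x \<noteq> 0"
  shows "(\<lambda>n. post_mean K (S n) (X n)) \<longlonglongrightarrow> post_mean K t x"
proof -
  have S0: "0 \<le> S n" for n using S(2)[of n] t by simp
  \<comment> \<open>A level strictly between \<open>x\<close> and 1: the sequence eventually stays
    below it, and the likelihood bound is valid up to it.\<close>
  define y where "y = (1 + x) / 2"
  have y: "x < y" "y < 1" using x by (auto simp: y_def)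
  obtain C where C: "\<And>s r x'. 0 \<le> s \<Longrightarrow> s < r \<Longrightarrow> r \<le> K \<Longrightarrow> 0 \<le> x' \<Longrightarrow> x' \<le> y \<Longrightarrow> likelihood s r x' \<le> C"
    using likelihood_bound[OF y(2)] by metis
  have "eventually (\<lambda>n. X n < y) sequentially"
    using X(1) y(1) by (rule order_tendstoD)
  then obtain N where N: "\<And>n. n \<ge> N \<Longrightarrow> X n < y" by (auto simp: eventually_sequentially)
  have bound: "norm (indicator {S (n + N)<..K} r * likelihood (S (n + N)) r (X (n + N))) \<le> \<bar>C\<bar>" for n r
    using C[of "S (n + N)" r "X (n + N)"] likelihood_nonneg[OF S0[of "n + N"], of K r "X (n + N)"] S0[of "n + N"] X(2)[of "n + N"] N[of "n + N"]
    by (auto split: split_indicator)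
  \<comment> \<open>Approach from the right matters: for \<open>r \<le> t\<close> all terms are 0,
    so the boundary point \<open>r = t\<close> causes no jump.\<close>
  have ind: "(\<lambda>n. indicator {S n<..K} r :: real) \<longlonglongrightarrow> indicator {t<..K} r" for r
  proof (cases "t < r")
    case True
    have "eventually (\<lambda>n. S n < r) sequentially"
      using S(1) True by (rule order_tendstoD)
    then have "eventually (\<lambda>n. indicator {S n<..K} r = (indicator {t<..K} r :: real)) sequentially"
      by eventually_elim (use True in \<open>auto split: split_indicator\<close>)
    then show ?thesis by (rule tendsto_eventually)
  next
    case False
    then have "indicator {S n<..K} r = (indicator {t<..K} r :: real)" for n
      using S(2)[of n] by (auto split: split_indicator)
    then show ?thesis by simp
  qed
  have limL: "(\<lambda>n. indicator {S n<..K} r * likelihood (S n) r (X n)) \<longlonglongrightarrow> indicator {t<..K} r * likelihood t r x" for r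
  proof (cases "t < r")
    case True
    then show ?thesis using t S X x by (intro tendsto_mult ind likelihood_tendsto)
  next
    case False
    then have "\<not> S n < r" for n using S(2)[of n] by simp
    with False show ?thesis by simp
  qed
  have limLH: "(\<lambda>n. indicator {S n<..K} r * (likelihood (S n) r (X n) * bridge_mean (S n) r (X n))) \<longlonglongrightarrow>
      indicator {t<..K} r * (likelihood t r x * bridge_mean t r x)" for r
  proof (cases "t < r")
    case True
    then show ?thesis using t S X x by (intro tendsto_mult ind likelihood_tendsto bridge_mean_tendsto)
  next
    case False
    then have "\<not> S n < r" for n using S(2)[of n] by simp
    with False show ?thesis by simp
  qed
  have "(\<lambda>n. post_den K (S (n + N)) (X (n + N))) \<longlonglongrightarrow> post_den K t x"
    unfolding post_den_def
  proof (rule integral_dominated_convergence[where w="\<lambda>_. \<bar>C\<bar>"])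
    show "AE \<omega> in M. (\<lambda>n. indicator {S (n + N)<..K} (\<tau> \<omega>) * likelihood (S (n + N)) (\<tau> \<omega>) (X (n + N)))
        \<longlonglongrightarrow> indicator {t<..K} (\<tau> \<omega>) * likelihood t (\<tau> \<omega>) x"
      by (intro AE_I2 LIMSEQ_ignore_initial_segment[OF limL])
    show "AE \<omega> in M. norm (indicator {S (n + N)<..K} (\<tau> \<omega>) * likelihood (S (n + N)) (\<tau> \<omega>) (X (n + N))) \<le> \<bar>C\<bar>" for n
      by (intro AE_I2 bound)
  qed measurable
  moreover have "(\<lambda>n. post_num K (S (n + N)) (X (n + N))) \<longlonglongrightarrow> post_num K t x"
    unfolding post_num_def
  proof (rule integral_dominated_convergence[where w="\<lambda>_. \<bar>C\<bar>"])
    show "AE \<omega> in M. (\<lambda>n. indicator {S (n + N)<..K} (\<tau> \<omega>) * (likelihood (S (n + N)) (\<tau> \<omega>) (X (n + N)) * bridge_mean (S (n + N)) (\<tau> \<omega>) (X (n + N))))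
        \<longlonglongrightarrow> indicator {t<..K} (\<tau> \<omega>) * (likelihood t (\<tau> \<omega>) x * bridge_mean t (\<tau> \<omega>) x)"
      by (intro AE_I2 LIMSEQ_ignore_initial_segment[OF limLH])
    show "AE \<omega> in M. norm (indicator {S (n + N)<..K} (\<tau> \<omega>) * (likelihood (S (n + N)) (\<tau> \<omega>) (X (n + N)) * bridge_mean (S (n + N)) (\<tau> \<omega>) (X (n + N)))) \<le> \<bar>C\<bar>" for n
    proof (intro AE_I2)
      fix \<omega>
      have "norm (indicator {S (n + N)<..K} (\<tau> \<omega>) * likelihood (S (n + N)) (\<tau> \<omega>) (X (n + N))) *
          norm (bridge_mean (S (n + N)) (\<tau> \<omega>) (X (n + N))) \<le> \<bar>C\<bar> * 1"
        using bridge_mean_range(1,2)[OF S0] by (intro mult_mono bound) auto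
      then show "norm (indicator {S (n + N)<..K} (\<tau> \<omega>) * (likelihood (S (n + N)) (\<tau> \<omega>) (X (n + N)) * bridge_mean (S (n + N)) (\<tau> \<omega>) (X (n + N)))) \<le> \<bar>C\<bar>"
        by (simp only: mult.assoc[symmetric] norm_mult mult_1_right)
    qed
    show "(\<lambda>\<omega>. indicator {t<..K} (\<tau> \<omega>) * (likelihood t (\<tau> \<omega>) x * bridge_mean t (\<tau> \<omega>) x)) \<in> borel_measurable M"
      using t by measurable
    show "(\<lambda>\<omega>. indicator {S (n + N)<..K} (\<tau> \<omega>) * (likelihood (S (n + N)) (\<tau> \<omega>) (X (n + N)) * bridge_mean (S (n + N)) (\<tau> \<omega>) (X (n + N)))) \<in> borel_measurable M" for n
      using S0[of "n + N"] by measurable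
  qed measurable
  ultimately have "(\<lambda>n. post_mean K (S (n + N)) (X (n + N))) \<longlonglongrightarrow> post_mean K t x"
    unfolding post_mean_def using den by (intro tendsto_divide)
  then show ?thesis by (rule LIMSEQ_offset)
qed

text \<open>The likelihood is strictly positive on \<open>t < \<tau> \<le> K\<close>, so a vanishing
  integral would make this event null.\<close>

lemma post_den_pos:
  assumes t: "0 \<le> t" and pos: "prob {\<omega>\<in>space M. \<tau> \<omega> \<in> {t<..K}} \<noteq> 0" and x: "0 \<le> x" "x < 1"
  shows "post_den K t x \<noteq> 0"
proof
  assume "post_den K t x = 0"
  then have "AE \<omega> in M. indicator {t<..K} (\<tau> \<omega>) * likelihood t (\<tau> \<omega>) x = 0"
    unfolding post_den_def using post_integrable[OF t x] likelihood_nonneg[OF t]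
    by (subst (asm) integral_nonneg_eq_0_iff_AE) auto
  then have "AE \<omega> in M. \<tau> \<omega> \<notin> {t<..K}"
  proof eventually_elim
    case (elim \<omega>)
    then show ?case using likelihood_pos[OF t, of "\<tau> \<omega>" x] x by (auto split: split_indicator_asm)
  qed
  then have "emeasure M {\<omega>\<in>space M. \<tau> \<omega> \<in> {t<..K}} = 0"
    by (subst (asm) AE_iff_measurable[OF _ refl]) auto
  with pos show False by (simp add: emeasure_eq_measure)
qed

text \<open>Strict growth of the path makes the bridge reach 1 exactly at \<open>\<tau>\<close>.
  Hence \<open>\<zeta> t\<close> alone reveals whether \<open>\<tau> \<le> t\<close>.\<close>

lemma AE_zeta:
  assumes t: "0 \<le> t"
  shows "AE \<omega> in M. (\<tau> \<omega> \<le> t \<longrightarrow> \<zeta> t \<omega> = 1) \<and> (t < \<tau> \<omega> \<longrightarrow> \<zeta> t \<omega> < 1)"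
  using AE_g_strict_mono AE_space
proof eventually_elim
  case (elim \<omega>)
  have "0 < \<tau> \<omega>" using elim by (auto intro: tau_pos)
  then have "0 < g (\<tau> \<omega>) \<omega>" using elim(1) g_0[OF elim(2)] by (metis order_refl)
  moreover have "t < \<tau> \<omega> \<Longrightarrow> g t \<omega> < g (\<tau> \<omega>) \<omega>" using elim(1) t by auto
  ultimately show ?case by (auto simp: zeta_def min_def)
qed

text \<open>The same \<open>A\<close> belongs to every later sigma-algebra, so
  \<open>markov_level\<close> applies to it along times \<open>S n\<close> decreasing to
  \<open>t\<close>, and both sides pass to the limit.\<close>

lemma markov_right_limit:
  assumes t: "0 \<le> t" "t < u" and A: "\<And>s. t < s \<Longrightarrow> A \<in> Fzc M g \<tau> s"
  shows "(\<integral>\<omega>. indicator A \<omega> * (indicator {t<..K} (\<tau> \<omega>) * h (\<zeta> u \<omega>)) \<partial>M) =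
    (\<integral>\<omega>. indicator A \<omega> * (indicator {t<..K} (\<tau> \<omega>) * post_mean K t (\<zeta> t \<omega>)) \<partial>M)"
proof (cases "prob {\<omega>\<in>space M. \<tau> \<omega> \<in> {t<..K}} = 0")
  \<comment> \<open>Here the denominator may vanish, but both integrands are almost surely
    0.\<close>
  case True
  then have "AE \<omega> in M. \<tau> \<omega> \<notin> {t<..K}"
    by (subst AE_iff_measurable[OF _ refl]) (auto simp: emeasure_eq_measure)
  then show ?thesis
  proof (intro integral_cong_AE)
    assume *: "AE \<omega> in M. \<tau> \<omega> \<notin> {t<..K}"
    then show "AE \<omega> in M. indicator A \<omega> * (indicator {t<..K} (\<tau> \<omega>) * h (\<zeta> u \<omega>)) =
      indicator A \<omega> * (indicator {t<..K} (\<tau> \<omega>) * post_mean K t (\<zeta> t \<omega>))"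
      by eventually_elim auto
  qed (use t A Fzc_sets[of u] in \<open>auto intro!: borel_measurable_times borel_measurable_indicator
        measurable_compose[OF zeta_measurable post_mean_measurable] measurable_compose[OF zeta_measurable h_measurable]\<close>)
next
  case False
  have u0: "0 \<le> u" using u_pos by simp
  \<comment> \<open>The offset 2 places even the first point strictly between \<open>t\<close> and
    \<open>u\<close>.\<close>
  define S where "S n = t + (u - t) / real (n + 2)" for n
  have St: "t < S n" and Su: "S n < u" for n
  proof -
    show "t < S n" using t by (simp add: S_def)
    have "(u - t) / real (n + 2) < u - t"
      using t by (simp add: divide_less_eq)
    then show "S n < u" by (simp add: S_def)
  qed
  have S0: "0 < S n" "0 \<le> S n" for n using St[of n] t by auto
  have Slim: "S \<longlonglongrightarrow> t"
    unfolding S_def by real_asymp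
  have AM [measurable]: "A \<in> sets M"
    using A[OF t(2)] Fzc_sets by auto
  have [measurable]: "\<zeta> u \<in> borel_measurable M" "\<zeta> t \<in> borel_measurable M" "\<And>n. \<zeta> (S n) \<in> borel_measurable M"
    "post_mean K t \<in> borel_measurable borel" "\<And>n. post_mean K (S n) \<in> borel_measurable borel"
    using u0 t S0 by auto
  have level: "(\<integral>\<omega>. indicator A \<omega> * (indicator {S n<..K} (\<tau> \<omega>) * h (\<zeta> u \<omega>)) \<partial>M) =
    (\<integral>\<omega>. indicator A \<omega> * (indicator {S n<..K} (\<tau> \<omega>) * post_mean K (S n) (\<zeta> (S n) \<omega>)) \<partial>M)" for n
  proof -
    have "(\<integral>\<omega>. indicator A \<omega> * (indicator {S n<..K} (\<tau> \<omega>) * f \<omega>) \<partial>M) =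
        enn2real (\<integral>\<^sup>+\<omega>. indicator A \<omega> * (indicator {S n<..K} (\<tau> \<omega>) * ennreal (f \<omega>)) \<partial>M)"
      if [measurable]: "f \<in> borel_measurable M" and "\<And>\<omega>. 0 \<le> f \<omega>" for f
      using that by (subst integral_eq_nn_integral)
        (auto intro!: arg_cong[where f=enn2real] nn_integral_cong split: split_indicator)
    then show ?thesis
      using markov_level[OF S0(1) Su A[OF St], of n K] h_nonneg post_mean_range(1)[OF S0(2)] by simp
  qed
  have ind: "eventually (\<lambda>n. indicator {S n<..K} r = (indicator {t<..K} r :: real)) sequentially" for r
  proof (cases "t < r")
    case True
    have "eventually (\<lambda>n. S n < r) sequentially"
      using Slim True by (rule order_tendstoD)
    then show ?thesis
      by eventually_elim (use True in \<open>auto split: split_indicator\<close>)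
  next
    case False
    then have "indicator {S n<..K} r = (indicator {t<..K} r :: real)" for n
      using St[of n] by (auto split: split_indicator)
    then show ?thesis by simp
  qed
  have L: "(\<lambda>n. \<integral>\<omega>. indicator A \<omega> * (indicator {S n<..K} (\<tau> \<omega>) * h (\<zeta> u \<omega>)) \<partial>M) \<longlonglongrightarrow>
      (\<integral>\<omega>. indicator A \<omega> * (indicator {t<..K} (\<tau> \<omega>) * h (\<zeta> u \<omega>)) \<partial>M)"
  proof (rule integral_dominated_convergence[where w="\<lambda>_. 1"])
    show "AE \<omega> in M. (\<lambda>n. indicator A \<omega> * (indicator {S n<..K} (\<tau> \<omega>) * h (\<zeta> u \<omega>))) \<longlonglongrightarrow>
        indicator A \<omega> * (indicator {t<..K} (\<tau> \<omega>) * h (\<zeta> u \<omega>))"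
      by (intro AE_I2 tendsto_mult tendsto_const tendsto_eventually ind)
    show "AE \<omega> in M. norm (indicator A \<omega> * (indicator {S n<..K} (\<tau> \<omega>) * h (\<zeta> u \<omega>))) \<le> 1" for n
      using h_nonneg h_le_1 by (intro AE_I2) (auto split: split_indicator)
  qed measurable
  have R: "(\<lambda>n. \<integral>\<omega>. indicator A \<omega> * (indicator {S n<..K} (\<tau> \<omega>) * post_mean K (S n) (\<zeta> (S n) \<omega>)) \<partial>M) \<longlonglongrightarrow>
      (\<integral>\<omega>. indicator A \<omega> * (indicator {t<..K} (\<tau> \<omega>) * post_mean K t (\<zeta> t \<omega>)) \<partial>M)"
  proof (rule integral_dominated_convergence[where w="\<lambda>_. 1"])
    show "AE \<omega> in M. (\<lambda>n. indicator A \<omega> * (indicator {S n<..K} (\<tau> \<omega>) * post_mean K (S n) (\<zeta> (S n) \<omega>))) \<longlonglongrightarrow>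
        indicator A \<omega> * (indicator {t<..K} (\<tau> \<omega>) * post_mean K t (\<zeta> t \<omega>))"
      using AE_zeta[OF t(1)] AE_g_strict_mono AE_space
    proof eventually_elim
      case (elim \<omega>)
      show ?case
      proof (cases "\<tau> \<omega> \<in> {t<..K}")
        case True
        have "(\<lambda>n. g (min (S n) (\<tau> \<omega>)) \<omega>) \<longlonglongrightarrow> g t \<omega>"
        proof (rule g_right_limit[OF elim(3) t(1)])
          show "(\<lambda>n. min (S n) (\<tau> \<omega>)) \<longlonglongrightarrow> t"
            using tendsto_min[OF Slim tendsto_const, of "\<tau> \<omega>"] True by (simp add: min_def)
        qed (use True St in auto)
        moreover have "0 < g (\<tau> \<omega>) \<omega>"
          using elim(2,3) g_0[OF elim(3)] tau_pos[OF elim(3)] by (metis order_refl)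
        moreover have "min t (\<tau> \<omega>) = t" using True by auto
        ultimately have lim: "(\<lambda>n. \<zeta> (S n) \<omega>) \<longlonglongrightarrow> \<zeta> t \<omega>"
          unfolding zeta_def by (auto intro!: tendsto_intros)
        have "(\<lambda>n. post_mean K (S n) (\<zeta> (S n) \<omega>)) \<longlonglongrightarrow> post_mean K t (\<zeta> t \<omega>)"
        proof (rule post_mean_tendsto[OF t(1) Slim St lim])
          show "0 \<le> \<zeta> (S n) \<omega>" for n using zeta_range[OF elim(3) S0(2)] by auto
          show "\<zeta> t \<omega> < 1" using elim(1) True by auto
          then show "post_den K t (\<zeta> t \<omega>) \<noteq> 0"
            using zeta_range[OF elim(3) t(1)] by (intro post_den_pos[OF t(1) False]) auto
        qed
        then show ?thesis
          by (intro tendsto_mult tendsto_const tendsto_eventually[OF ind])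
      next
        case False
        then have "\<tau> \<omega> \<notin> {S n<..K}" for n using St[of n] by auto
        with False show ?thesis by simp
      qed
    qed
    show "AE \<omega> in M. norm (indicator A \<omega> * (indicator {S n<..K} (\<tau> \<omega>) * post_mean K (S n) (\<zeta> (S n) \<omega>))) \<le> 1" for n
      using post_mean_range[OF S0(2)] by (intro AE_I2) (auto split: split_indicator)
  qed measurable
  show ?thesis
    using L R unfolding level by (rule LIMSEQ_unique)
qed

text \<open>The unobservable indicator of \<open>\<tau>\<close> is traded for the test
  \<open>\<zeta> t < 1\<close>. If \<open>\<tau> \<le> t\<close>, then almost surely
  \<open>\<zeta> t = \<zeta> u = 1\<close> and the candidate is exact; on
  \<open>t < \<tau> \<le> K\<close> the error integrates to 0 over \<open>A\<close>; on
  \<open>\<tau> > K\<close> it is at most 1.\<close>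

lemma markov_right_approx:
  assumes t: "0 \<le> t" "t < u" and A: "\<And>s. t < s \<Longrightarrow> A \<in> Fzc M g \<tau> s"
  shows "\<bar>\<integral>\<omega>. indicator A \<omega> * (h (\<zeta> u \<omega>) - (if \<zeta> t \<omega> < 1 then post_mean K t (\<zeta> t \<omega>) else h 1)) \<partial>M\<bar>
    \<le> prob {\<omega>\<in>space M. K < \<tau> \<omega>}"
proof -
  have u0: "0 \<le> u" using u_pos by simp
  have AM [measurable]: "A \<in> sets M"
    using A[OF t(2)] Fzc_sets by auto
  have [measurable]: "\<zeta> u \<in> borel_measurable M" "\<zeta> t \<in> borel_measurable M" "post_mean K t \<in> borel_measurable borel"
    using u0 t by auto
  note rng = h_nonneg h_le_1 post_mean_range[OF t(1)]
  define p where "p \<omega> = (if \<zeta> t \<omega> < 1 then post_mean K t (\<zeta> t \<omega>) else h 1)" for \<omega>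
  have p_measurable [measurable]: "p \<in> borel_measurable M"
    unfolding p_def by measurable
  let ?a = "\<lambda>\<omega>. indicator A \<omega> * (indicator {t<..K} (\<tau> \<omega>) * h (\<zeta> u \<omega>)) :: real"
  let ?b = "\<lambda>\<omega>. indicator A \<omega> * (indicator {t<..K} (\<tau> \<omega>) * post_mean K t (\<zeta> t \<omega>)) :: real"
  let ?c = "\<lambda>\<omega>. indicator A \<omega> * (indicator {K<..} (\<tau> \<omega>) * (h (\<zeta> u \<omega>) - p \<omega>)) :: real"
  have p_range: "0 \<le> p \<omega>" "p \<omega> \<le> 1" for \<omega>
    using rng by (auto simp: p_def)
  have diff: "\<bar>h (\<zeta> u \<omega>) - p \<omega>\<bar> \<le> 1" for \<omega>
    using h_nonneg[of "\<zeta> u \<omega>"] h_le_1[of "\<zeta> u \<omega>"] p_range[of \<omega>] by (simp add: abs_le_iff)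
  have ia: "integrable M ?a" and ib: "integrable M ?b"
    using rng by (auto intro!: integrable_const_bound[where B=1] split: split_indicator)
  have ic: "integrable M ?c"
    using diff by (intro integrable_const_bound[where B=1]) (auto split: split_indicator)
  \<comment> \<open>The extra indicator of \<open>{t<..}\<close> on the last term keeps the three
    cases disjoint when \<open>K < t\<close>.\<close>
  have "(\<integral>\<omega>. indicator A \<omega> * (h (\<zeta> u \<omega>) - p \<omega>) \<partial>M) = (\<integral>\<omega>. (?a \<omega> - ?b \<omega>) + indicator {t<..} (\<tau> \<omega>) * ?c \<omega> \<partial>M)"
  proof (rule integral_cong_AE)
    show "AE \<omega> in M. indicator A \<omega> * (h (\<zeta> u \<omega>) - p \<omega>) = (?a \<omega> - ?b \<omega>) + indicator {t<..} (\<tau> \<omega>) * ?c \<omega>"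
      using AE_zeta[OF t(1)] AE_zeta[OF u0]
      by eventually_elim (use t in \<open>auto split: split_indicator simp: algebra_simps p_def\<close>)
  qed measurable
  also have "\<dots> = (\<integral>\<omega>. ?a \<omega> \<partial>M) - (\<integral>\<omega>. ?b \<omega> \<partial>M) + (\<integral>\<omega>. indicator {t<..} (\<tau> \<omega>) * ?c \<omega> \<partial>M)"
  proof -
    have "integrable M (\<lambda>\<omega>. indicator {t<..} (\<tau> \<omega>) * ?c \<omega>)"
      using diff by (intro integrable_const_bound[where B=1]) (auto split: split_indicator)
    then show ?thesis using ia ib by (simp del: mult_eq_if)
  qed
  also have "\<dots> = (\<integral>\<omega>. indicator {t<..} (\<tau> \<omega>) * ?c \<omega> \<partial>M)"
    using markov_right_limit[OF t A, of K] by simp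
  also have "\<bar>\<dots>\<bar> \<le> (\<integral>\<omega>. indicator {\<omega>\<in>space M. K < \<tau> \<omega>} \<omega> \<partial>M)"
  proof (rule order_trans[OF integral_abs_bound])
    show "(\<integral>\<omega>. \<bar>indicator {t<..} (\<tau> \<omega>) * ?c \<omega>\<bar> \<partial>M) \<le> (\<integral>\<omega>. indicator {\<omega>\<in>space M. K < \<tau> \<omega>} \<omega> \<partial>M)"
      using diff by (intro Bochner_Integration.integral_mono' integrable_const_bound[where B=1])
        (auto split: split_indicator)
  qed
  finally show ?thesis by (simp add: p_def)
qed

end

section \<open>Conditional expectations\<close>

text \<open>Testing on the event where the conditional expectation exceeds \<open>p\<close>, and on
  its complement, recovers the absolute value; each of the two contributes at most
  \<open>e\<close>.\<close>

lemma (in prob_space) cond_exp_L1_approx: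
  assumes sub: "subalgebra M F" and f [measurable]: "integrable M f"
    and p: "p \<in> borel_measurable F" "integrable M p"
    and le: "\<And>A. A \<in> sets F \<Longrightarrow> \<bar>\<integral>\<omega>. indicator A \<omega> * (f \<omega> - p \<omega>) \<partial>M\<bar> \<le> e"
  shows "(\<integral>\<omega>. \<bar>real_cond_exp M F f \<omega> - p \<omega>\<bar> \<partial>M) \<le> 2 * e"
proof -
  interpret F: finite_measure_subalgebra M F by unfold_locales (rule sub)
  let ?Y = "real_cond_exp M F f"
  have [measurable]: "p \<in> borel_measurable F" "?Y \<in> borel_measurable F" by (auto simp: p)
  have Y: "integrable M ?Y" using f by (rule F.real_cond_exp_int)
  have spF: "space F = space M" using sub by (simp add: subalgebra_def)
  have setsF: "B \<in> sets M" if "B \<in> sets F" for B using sub that by (auto simp: subalgebra_def)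
  have int: "integrable M (\<lambda>\<omega>. indicator B \<omega> * k \<omega>)" if "B \<in> sets M" "integrable M k" for B and k :: "'a \<Rightarrow> real"
    using integrable_mult_indicator[OF that] by simp
  have eq: "(\<integral>\<omega>. indicator B \<omega> * (?Y \<omega> - p \<omega>) \<partial>M) = (\<integral>\<omega>. indicator B \<omega> * (f \<omega> - p \<omega>) \<partial>M)" if B: "B \<in> sets F" for B
  proof -
    have "(\<integral>\<omega>. indicator B \<omega> * ?Y \<omega> \<partial>M) = (\<integral>\<omega>. indicator B \<omega> * f \<omega> \<partial>M)"
      using B int[OF setsF[OF B] f] by (intro F.real_cond_exp_intg) auto
    then show ?thesis
      using int[OF setsF[OF B] f] int[OF setsF[OF B] p(2)] int[OF setsF[OF B] Y]
      by (simp add: right_diff_distrib)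
  qed
  define A where "A = {\<omega>\<in>space F. p \<omega> < ?Y \<omega>}"
  have A: "A \<in> sets F" "space F - A \<in> sets F"
    unfolding A_def by measurable
  note iA = int[OF setsF[OF A(1)]] int[OF setsF[OF A(2)]]
  have "(\<integral>\<omega>. \<bar>?Y \<omega> - p \<omega>\<bar> \<partial>M) = (\<integral>\<omega>. indicator A \<omega> * (?Y \<omega> - p \<omega>) - indicator (space F - A) \<omega> * (?Y \<omega> - p \<omega>) \<partial>M)"
    by (intro Bochner_Integration.integral_cong) (auto simp: A_def spF split: split_indicator)
  also have "\<dots> = (\<integral>\<omega>. indicator A \<omega> * (f \<omega> - p \<omega>) \<partial>M) - (\<integral>\<omega>. indicator (space F - A) \<omega> * (f \<omega> - p \<omega>) \<partial>M)"
    using iA[OF Bochner_Integration.integrable_diff[OF Y p(2)]]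
    by (subst Bochner_Integration.integral_diff) (auto simp: eq A)
  also have "\<dots> \<le> 2 * e"
    using le[OF A(1)] le[OF A(2)] by linarith
  finally show ?thesis .
qed

text \<open>A single \<open>p\<close>, measurable for the smaller algebra, is L1-close to both
  conditional expectations, because events of \<open>G\<close> are also events of \<open>F\<close>.
  The triangle inequality then makes their distance arbitrarily small.\<close>

lemma (in prob_space) cond_exp_eq_if_approx:
  assumes sub: "subalgebra M F" "subalgebra F G" and f: "integrable M f"
    and approx: "\<And>e. e > 0 \<Longrightarrow> \<exists>p. p \<in> borel_measurable G \<and> integrable M p \<and>
      (\<forall>A\<in>sets F. \<bar>\<integral>\<omega>. indicator A \<omega> * (f \<omega> - p \<omega>) \<partial>M\<bar> \<le> e)"
  shows "AE \<omega> in M. real_cond_exp M F f \<omega> = real_cond_exp M G f \<omega>"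
proof -
  have sG: "subalgebra M G" using sub by (auto simp: subalgebra_def)
  interpret F: finite_measure_subalgebra M F by unfold_locales (rule sub)
  interpret G: finite_measure_subalgebra M G by unfold_locales (rule sG)
  let ?Y = "real_cond_exp M F f" and ?Z = "real_cond_exp M G f"
  have Y: "integrable M ?Y" and Z: "integrable M ?Z"
    using f F.real_cond_exp_int G.real_cond_exp_int by auto
  have "(\<integral>\<omega>. \<bar>?Y \<omega> - ?Z \<omega>\<bar> \<partial>M) \<le> e" if e: "e > 0" for e
  proof -
    obtain p where p: "p \<in> borel_measurable G" "integrable M p"
      "\<And>A. A \<in> sets F \<Longrightarrow> \<bar>\<integral>\<omega>. indicator A \<omega> * (f \<omega> - p \<omega>) \<partial>M\<bar> \<le> e / 4"
      using approx[of "e / 4"] e by auto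
    have pF: "p \<in> borel_measurable F" using p(1) by (rule measurable_from_subalg[OF sub(2)])
    have GF: "A \<in> sets F" if "A \<in> sets G" for A using that sub(2) by (auto simp: subalgebra_def)
    have "(\<integral>\<omega>. \<bar>?Y \<omega> - ?Z \<omega>\<bar> \<partial>M) \<le> (\<integral>\<omega>. \<bar>?Y \<omega> - p \<omega>\<bar> + \<bar>?Z \<omega> - p \<omega>\<bar> \<partial>M)"
      using Y Z p(2) by (intro integral_mono) auto
    also have "\<dots> = (\<integral>\<omega>. \<bar>?Y \<omega> - p \<omega>\<bar> \<partial>M) + (\<integral>\<omega>. \<bar>?Z \<omega> - p \<omega>\<bar> \<partial>M)"
      using Y Z p(2) by (intro Bochner_Integration.integral_add) auto
    also have "\<dots> \<le> 2 * (e / 4) + 2 * (e / 4)"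
      using cond_exp_L1_approx[OF sub(1) f pF p(2,3)] cond_exp_L1_approx[OF sG f p(1,2) p(3)[OF GF]]
      by (intro add_mono) auto
    finally show ?thesis by simp
  qed
  then have "(\<integral>\<omega>. \<bar>?Y \<omega> - ?Z \<omega>\<bar> \<partial>M) \<le> 0"
    by (rule field_le_epsilon[of _ 0, simplified])
  moreover have "0 \<le> (\<integral>\<omega>. \<bar>?Y \<omega> - ?Z \<omega>\<bar> \<partial>M)" by simp
  ultimately have "(\<integral>\<omega>. \<bar>?Y \<omega> - ?Z \<omega>\<bar> \<partial>M) = 0" by (rule antisym)
  then have "AE \<omega> in M. \<bar>?Y \<omega> - ?Z \<omega>\<bar> = 0"
    using Y Z by (subst (asm) integral_nonneg_eq_0_iff_AE) auto
  then show ?thesis by eventually_elim simp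
qed

text \<open>Conditional expectation is self-adjoint: for \<open>A\<close> in \<open>F\<close>,
  integrating the \<open>G\<close>-expectation of \<open>k\<close> over \<open>A\<close> equals
  integrating \<open>k\<close> against \<open>\<alpha>\<close>, the \<open>G\<close>-conditional
  probability of \<open>A\<close>. The hypothesis thus says that \<open>Z\<close> has the same
  moments under the weights \<open>indicator A\<close> and \<open>\<alpha>\<close>, hence the same
  law under both. No regular conditional distribution is involved.\<close>

lemma (in prob_space) cond_exp_eq_if_moments_eq:
  fixes Z :: "'a \<Rightarrow> real"
  assumes sub: "subalgebra M F" "subalgebra F G"
    and Z [measurable]: "Z \<in> borel_measurable M" and Z01: "\<And>\<omega>. \<omega> \<in> space M \<Longrightarrow> Z \<omega> \<in> {0..1}"
    and moments: "\<And>m::nat. AE \<omega> in M. real_cond_exp M F (\<lambda>\<omega>. Z \<omega> ^ m) \<omega> = real_cond_exp M G (\<lambda>\<omega>. Z \<omega> ^ m) \<omega>"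
    and h [measurable]: "h \<in> borel_measurable borel" and B: "\<And>x. \<bar>h x\<bar> \<le> B"
  shows "AE \<omega> in M. real_cond_exp M F (\<lambda>\<omega>. h (Z \<omega>)) \<omega> = real_cond_exp M G (\<lambda>\<omega>. h (Z \<omega>)) \<omega>"
proof -
  have sG: "subalgebra M G" using sub by (auto simp: subalgebra_def)
  interpret F: finite_measure_subalgebra M F by unfold_locales (rule sub)
  interpret G: finite_measure_subalgebra M G by unfold_locales (rule sG)
  have inth: "integrable M (\<lambda>\<omega>. h (Z \<omega>))"
    using B by (intro integrable_const_bound[where B=B]) auto
  have intm: "integrable M (\<lambda>\<omega>. Z \<omega> ^ m)" for m
    using Z01 by (intro integrable_const_bound[where B=1]) (auto simp: power_le_one)
  have int: "integrable M (\<lambda>\<omega>. indicator A \<omega> * k \<omega>)" if "A \<in> sets M" "integrable M k" for A and k :: "'a \<Rightarrow> real"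
    using integrable_mult_indicator[OF that] by simp
  show ?thesis
  proof (rule F.real_cond_exp_charact[OF _ inth])
    show "integrable M (real_cond_exp M G (\<lambda>\<omega>. h (Z \<omega>)))"
      using inth by (rule G.real_cond_exp_int)
    show "real_cond_exp M G (\<lambda>\<omega>. h (Z \<omega>)) \<in> borel_measurable F"
      by (rule measurable_from_subalg[OF sub(2)]) simp
    fix A assume AF: "A \<in> sets F"
    then have A [measurable]: "A \<in> sets M" using sub(1) by (auto simp: subalgebra_def)
    define \<alpha> where "\<alpha> = real_cond_exp M G (indicator A)"
    have \<alpha>G [measurable]: "\<alpha> \<in> borel_measurable G" by (simp add: \<alpha>_def)
    have \<alpha>M [measurable]: "\<alpha> \<in> borel_measurable M" by (simp add: \<alpha>_def)
    have iA: "integrable M (indicator A :: 'a \<Rightarrow> real)"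
      by (intro integrable_const_bound[where B=1]) auto
    have "AE \<omega> in M. 0 \<le> \<alpha> \<omega>"
      unfolding \<alpha>_def by (intro G.real_cond_exp_pos) auto
    moreover have "AE \<omega> in M. \<alpha> \<omega> \<le> real_cond_exp M G (\<lambda>_. 1) \<omega>"
      unfolding \<alpha>_def using iA by (intro G.real_cond_exp_mono) (auto split: split_indicator)
    moreover have "AE \<omega> in M. real_cond_exp M G (\<lambda>_. 1) \<omega> = 1"
      by (intro G.real_cond_exp_F_meas) auto
    ultimately have \<alpha>01: "AE \<omega> in M. 0 \<le> \<alpha> \<omega> \<and> \<alpha> \<omega> \<le> 1" by eventually_elim auto
    have int\<alpha>: "integrable M (\<lambda>\<omega>. \<alpha> \<omega> * k \<omega>)" if "integrable M k" for k
    proof (rule Bochner_Integration.integrable_bound[OF that])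
      show "(\<lambda>\<omega>. \<alpha> \<omega> * k \<omega>) \<in> borel_measurable M" using that by measurable
      show "AE \<omega> in M. norm (\<alpha> \<omega> * k \<omega>) \<le> norm (k \<omega>)"
        using \<alpha>01 by eventually_elim (auto simp: abs_mult intro: mult_left_le_one_le)
    qed
    have swap: "(\<integral>\<omega>. indicator A \<omega> * real_cond_exp M G k \<omega> \<partial>M) = (\<integral>\<omega>. \<alpha> \<omega> * k \<omega> \<partial>M)" if k: "integrable M k" for k
    proof -
      have Yk: "integrable M (real_cond_exp M G k)" using k by (rule G.real_cond_exp_int)
      have "(\<integral>\<omega>. \<alpha> \<omega> * k \<omega> \<partial>M) = (\<integral>\<omega>. \<alpha> \<omega> * real_cond_exp M G k \<omega> \<partial>M)"
        using k int\<alpha>[OF k] by (intro G.real_cond_exp_intg(2)[symmetric]) auto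
      also have "\<dots> = (\<integral>\<omega>. real_cond_exp M G k \<omega> * real_cond_exp M G (indicator A) \<omega> \<partial>M)"
        by (simp add: \<alpha>_def mult.commute)
      also have "\<dots> = (\<integral>\<omega>. real_cond_exp M G k \<omega> * indicator A \<omega> \<partial>M)"
        using int[OF A Yk] by (intro G.real_cond_exp_intg(2)) (auto simp: mult.commute)
      finally show ?thesis by (simp add: mult.commute)
    qed
    have mom: "(\<integral>\<omega>. indicator A \<omega> * Z \<omega> ^ m \<partial>M) = (\<integral>\<omega>. \<alpha> \<omega> * Z \<omega> ^ m \<partial>M)" for m
    proof -
      have "(\<integral>\<omega>. indicator A \<omega> * Z \<omega> ^ m \<partial>M) = (\<integral>\<omega>. indicator A \<omega> * real_cond_exp M F (\<lambda>\<omega>. Z \<omega> ^ m) \<omega> \<partial>M)"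
        using AF int[OF A intm] by (intro F.real_cond_exp_intg(2)[symmetric]) auto
      also have "\<dots> = (\<integral>\<omega>. indicator A \<omega> * real_cond_exp M G (\<lambda>\<omega>. Z \<omega> ^ m) \<omega> \<partial>M)"
        using moments[of m] by (intro integral_cong_AE) auto
      also have "\<dots> = (\<integral>\<omega>. \<alpha> \<omega> * Z \<omega> ^ m \<partial>M)" by (rule swap[OF intm])
      finally show ?thesis .
    qed
    define N1 where "N1 = distr (density M (\<lambda>\<omega>. ennreal (indicator A \<omega>))) borel Z"
    define N2 where "N2 = distr (density M (\<lambda>\<omega>. ennreal (\<alpha> \<omega>))) borel Z"
    have N1: "(\<integral>x. k x \<partial>N1) = (\<integral>\<omega>. indicator A \<omega> * k (Z \<omega>) \<partial>M)" if [measurable]: "k \<in> borel_measurable borel" for k :: "real \<Rightarrow> real"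
      unfolding N1_def by (subst integral_distr, simp, simp, subst integral_density) auto
    have N2: "(\<integral>x. k x \<partial>N2) = (\<integral>\<omega>. \<alpha> \<omega> * k (Z \<omega>) \<partial>M)" if [measurable]: "k \<in> borel_measurable borel" for k :: "real \<Rightarrow> real"
      unfolding N2_def using \<alpha>01 by (subst integral_distr, simp, simp, subst integral_density) auto
    have "N1 = N2"
    proof (rule finite_measure_eq_if_moments_eq)
      have "(\<integral>\<^sup>+\<omega>. ennreal (\<alpha> \<omega>) \<partial>M) = ennreal (\<integral>\<omega>. \<alpha> \<omega> \<partial>M)"
        using int\<alpha>[of "\<lambda>_. 1"] \<alpha>01 by (intro nn_integral_eq_integral) auto
      then have "finite_measure (density M (\<lambda>\<omega>. ennreal (\<alpha> \<omega>)))"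
        by (intro finite_measureI) (auto simp: emeasure_density cong: nn_integral_cong)
      then show "finite_measure N2"
        unfolding N2_def by (rule finite_measure.finite_measure_distr) simp
      have "(\<integral>\<^sup>+\<omega>. ennreal (indicator A \<omega>) \<partial>M) = ennreal (\<integral>\<omega>. indicator A \<omega> \<partial>M)"
        using iA by (intro nn_integral_eq_integral) auto
      then have "finite_measure (density M (\<lambda>\<omega>. ennreal (indicator A \<omega>)))"
        by (intro finite_measureI) (auto simp: emeasure_density cong: nn_integral_cong)
      then show "finite_measure N1"
        unfolding N1_def by (rule finite_measure.finite_measure_distr) simp
      show "AE x in N1. x \<in> {0..1}" "AE x in N2. x \<in> {0..1}"
        unfolding N1_def N2_def using Z01 by (subst AE_distr_iff, simp, simp, subst AE_density, auto)+
      show "(\<integral>x. x ^ m \<partial>N1) = (\<integral>x. x ^ m \<partial>N2)" for m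
        by (simp add: N1 N2 mom)
    qed (simp_all add: N1_def N2_def)
    then have "(\<integral>\<omega>. indicator A \<omega> * h (Z \<omega>) \<partial>M) = (\<integral>\<omega>. \<alpha> \<omega> * h (Z \<omega>) \<partial>M)"
      using N1[OF h] N2[OF h] by simp
    also have "\<dots> = (\<integral>\<omega>. indicator A \<omega> * real_cond_exp M G (\<lambda>\<omega>. h (Z \<omega>)) \<omega> \<partial>M)"
      by (rule swap[OF inth, symmetric])
    finally show "(\<integral>\<omega>\<in>A. h (Z \<omega>) \<partial>M) = (\<integral>\<omega>\<in>A. real_cond_exp M G (\<lambda>\<omega>. h (Z \<omega>)) \<omega> \<partial>M)"
      by (simp add: set_lebesgue_integral_def)
  qed
qed

section \<open>The right-limit filtration against the present value\<close>

context gamma_bridge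
begin

text \<open>Each \<open>Fzc M g \<tau> s\<close> is itself a sigma-algebra, so closing the
  intersection under sigma operations does not leave it.\<close>

lemma sets_Fzc_plus_subset: "t < s \<Longrightarrow> A \<in> sets (Fzc_plus M g \<tau> t) \<Longrightarrow> A \<in> Fzc M g \<tau> s"
proof -
  assume s: "t < s" and A: "A \<in> sets (Fzc_plus M g \<tau> t)"
  have Pow: "(\<Union>v\<in>{0..s}. gen_sets M (\<zeta> v)) \<union> null_sets M \<subseteq> Pow (space M)" for s
    using sets.sets_into_space by (auto simp: gen_sets_def)
  have "(\<Inter>s\<in>{t<..}. Fzc M g \<tau> s) \<subseteq> Pow (space M)"
    using s sigma_sets_into_sp[OF Pow] unfolding Fzc_def by blast
  then have "sets (Fzc_plus M g \<tau> t) = sigma_sets (space M) (\<Inter>s\<in>{t<..}. Fzc M g \<tau> s)"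
    unfolding Fzc_plus_def by (rule sets_measure_of)
  also have "\<dots> \<subseteq> sigma_sets (space M) (Fzc M g \<tau> s)"
    using s by (intro sigma_sets_mono') auto
  also have "\<dots> = Fzc M g \<tau> s"
    unfolding Fzc_def by (rule sigma_sets_sigma_sets_eq[OF Pow])
  finally show ?thesis using A by auto
qed

lemma subalgebra_Fzc_plus: "subalgebra M (Fzc_plus M g \<tau> t)"
proof -
  have "(\<Inter>s\<in>{t<..}. Fzc M g \<tau> s) \<subseteq> Pow (space M)"
    using Fzc_sets[of "t + 1"] sets.space_closed[of M] by (auto 0 3)
  then show ?thesis
    unfolding subalgebra_def using sets_Fzc_plus_subset[of t "t + 1"] Fzc_sets[of "t + 1"]
    by (auto simp: Fzc_plus_def space_measure_of)
qed

lemma subalgebra_zeta: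
  assumes t: "0 \<le> t"
  shows "subalgebra (Fzc_plus M g \<tau> t) (vimage_algebra (space M) (\<zeta> t) borel)"
proof -
  have "\<zeta> t -` B \<inter> space M \<in> sets (Fzc_plus M g \<tau> t)" if "B \<in> sets borel" for B
  proof -
    have "\<zeta> t -` B \<inter> space M \<in> Fzc M g \<tau> s" if "t < s" for s
      unfolding Fzc_def using \<open>B \<in> sets borel\<close> that t
      by (intro sigma_sets.Basic UnI1 UN_I[of t]) (auto simp: gen_sets_def)
    moreover have "(\<Inter>s\<in>{t<..}. Fzc M g \<tau> s) \<subseteq> Pow (space M)"
      using Fzc_sets[of "t + 1"] sets.space_closed[of M] by (auto 0 3)
    ultimately show ?thesis
      unfolding Fzc_plus_def by (simp add: sets_measure_of)
  qed
  then show ?thesis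
    using subalgebra_Fzc_plus[of t] by (auto simp: subalgebra_def sets_vimage_algebra2)
qed

lemma markov_moments:
  assumes t: "0 \<le> t" "t < u"
  shows "AE \<omega> in M. real_cond_exp M (Fzc_plus M g \<tau> t) (\<lambda>\<omega>. \<zeta> u \<omega> ^ m) \<omega> =
    real_cond_exp M (vimage_algebra (space M) (\<zeta> t) borel) (\<lambda>\<omega>. \<zeta> u \<omega> ^ m) \<omega>"
proof (rule cond_exp_eq_if_approx[OF subalgebra_Fzc_plus subalgebra_zeta[OF t(1)]])
  \<comment> \<open>Clipping changes nothing on the unit interval, where \<open>\<zeta> u\<close>
    lives, and makes the power bounded and continuous on the whole line.\<close>
  define h where "h x = max 0 (min 1 x) ^ m" for x :: real
  interpret T: gamma_bridge_test M g \<tau> u h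
    by unfold_locales (use t in \<open>auto simp: h_def power_le_one intro!: continuous_intros\<close>)
  have u0: "0 \<le> u" using t by simp
  have h_eq: "\<zeta> u \<omega> ^ m = h (\<zeta> u \<omega>)" if "\<omega> \<in> space M" for \<omega>
    using zeta_range[OF that u0] by (simp add: h_def)
  have [measurable]: "\<zeta> u \<in> borel_measurable M" using u0 by auto
  show "integrable M (\<lambda>\<omega>. \<zeta> u \<omega> ^ m)"
    using zeta_range[OF _ u0] by (intro integrable_const_bound[where B=1]) (auto simp: power_le_one)
  fix e :: real assume e: "e > 0"
  \<comment> \<open>Since \<open>\<tau>\<close> is finite, some natural number \<open>n\<close>
    serves as a truncation level with tail probability below \<open>e\<close>.\<close>
  have "(\<lambda>n. prob {\<omega>\<in>space M. real n < \<tau> \<omega>}) \<longlonglongrightarrow> prob (\<Inter>n. {\<omega>\<in>space M. real n < \<tau> \<omega>})"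
    by (intro finite_Lim_measure_decseq) (auto simp: decseq_def)
  moreover have "(\<Inter>n. {\<omega>\<in>space M. real n < \<tau> \<omega>}) = {}"
    by auto (metis less_asym reals_Archimedean2)
  ultimately have "(\<lambda>n. prob {\<omega>\<in>space M. real n < \<tau> \<omega>}) \<longlonglongrightarrow> 0" by simp
  from order_tendstoD(2)[OF this e] obtain n where n: "prob {\<omega>\<in>space M. real n < \<tau> \<omega>} < e"
    by (auto simp: eventually_sequentially)
  define q where "q x = (if x < 1 then T.post_mean (real n) t x else h 1)" for x
  have [measurable]: "q \<in> borel_measurable borel"
    unfolding q_def using T.post_mean_measurable[OF t(1)] by measurable
  show "\<exists>p. p \<in> borel_measurable (vimage_algebra (space M) (\<zeta> t) borel) \<and> integrable M p \<and>
      (\<forall>A\<in>sets (Fzc_plus M g \<tau> t). \<bar>\<integral>\<omega>. indicator A \<omega> * (\<zeta> u \<omega> ^ m - p \<omega>) \<partial>M\<bar> \<le> e)"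
  proof (intro exI[of _ "\<lambda>\<omega>. q (\<zeta> t \<omega>)"] conjI ballI)
    show "(\<lambda>\<omega>. q (\<zeta> t \<omega>)) \<in> borel_measurable (vimage_algebra (space M) (\<zeta> t) borel)"
      by (rule measurable_compose[OF measurable_vimage_algebra1]) auto
    show "integrable M (\<lambda>\<omega>. q (\<zeta> t \<omega>))"
      using t T.post_mean_range[OF t(1)] T.h_nonneg T.h_le_1
      by (intro integrable_const_bound[where B=1]) (auto simp: q_def intro!: measurable_compose[OF zeta_measurable])
    fix A assume "A \<in> sets (Fzc_plus M g \<tau> t)"
    then have "\<bar>\<integral>\<omega>. indicator A \<omega> * (h (\<zeta> u \<omega>) - q (\<zeta> t \<omega>)) \<partial>M\<bar> \<le> prob {\<omega>\<in>space M. real n < \<tau> \<omega>}"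
      unfolding q_def using t by (intro T.markov_right_approx sets_Fzc_plus_subset) auto
    then show "\<bar>\<integral>\<omega>. indicator A \<omega> * (\<zeta> u \<omega> ^ m - q (\<zeta> t \<omega>)) \<partial>M\<bar> \<le> e"
      using n by (simp add: h_eq cong: Bochner_Integration.integral_cong)
  qed
qed

end

theorem mainTheorem10:
  fixes M :: "'a measure" and g :: "real \<Rightarrow> 'a \<Rightarrow> real" and \<tau> :: "'a \<Rightarrow> real"
    and h :: "real \<Rightarrow> real" and t u :: real
  assumes "prob_space M"
    and "complete_measure M"
    and "standard_gamma_process M g"
    and "\<tau> \<in> borel_measurable M"
    and "\<forall>\<omega>\<in>space M. 0 < \<tau> \<omega>"
    and "prob_space.indep_set M (sigma_sets (space M) (gen_sets M \<tau>))
           (sigma_sets (space M) (\<Union>s\<in>{0..}. gen_sets M (g s)))"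
    and "\<exists>\<alpha>>0. (\<integral>\<^sup>+ \<omega>. ennreal (\<tau> \<omega> powr \<alpha>) \<partial>M) < \<infinity>"
    and "0 \<le> t" and "t < u"
    and "h \<in> borel_measurable borel" and "\<exists>B. \<forall>x. \<bar>h x\<bar> \<le> B"
  shows "AE \<omega> in M. real_cond_exp M (Fzc_plus M g \<tau> t) (\<lambda>\<omega>. h (zeta g \<tau> u \<omega>)) \<omega>
                   = real_cond_exp M (vimage_algebra (space M) (zeta g \<tau> t) borel)
                       (\<lambda>\<omega>. h (zeta g \<tau> u \<omega>)) \<omega>"
proof -
  interpret prob_space M by fact
  interpret gamma_bridge M g \<tau>
    by unfold_locales (use assms in auto)
  obtain B where B: "\<And>x. \<bar>h x\<bar> \<le> B" using assms(11) by auto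
  have u: "0 \<le> u" using assms by simp
  show ?thesis
    by (rule cond_exp_eq_if_moments_eq[OF subalgebra_Fzc_plus subalgebra_zeta[OF assms(8)]
        zeta_measurable[OF u] zeta_range[OF _ u] markov_moments[OF assms(8,9)] assms(10) B])
qed

end
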